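(* Let $p>2$ be a prime. For every $\epsilon>0$ there exists a pro-$p$ group $G$ such that $s_{p^k}(G)$ is of type $p^{k^2}$ and $s_{p^k}^{\triangleleft}(G)$ is of type $p^{k^{2-\epsilon}}$ (as functions of the positive integer $k$).
   Context: For a group $G$, $s_n(G)$ is the number of subgroups of $G$ of index $n$ and $s_n^{\triangleleft}(G)$ is the number of normal subgroups of $G$ of index $n$. A function $f:\mathbb{N}\to\mathbb{R}$ is said to be of type $g$, where $g:\mathbb{N}\to\mathbb{R}$, if there exists a constant $C$ such that $f(n)<g(n)^C$ holds for all $n$, and $f(n)^C>g(n)$ holds for infinitely many $n$.
   Formalization: The claim is proved for 0 < ε ≤ 2 only; for ε > 2 it is false for every group, since p^{k^{2-ε}} tends to 1 from above and no function with natural number values is of that type. *)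

theory Defs
  imports "HOL-Algebra.Coset" "HOL-Analysis.Analysis"
begin

definition topological_group :: "('a, 'b) monoid_scheme \<Rightarrow> 'a topology \<Rightarrow> bool" where
  "topological_group G T \<longleftrightarrow>
     group G \<and> topspace T = carrier G \<and>
     continuous_map (prod_topology T T) T (\<lambda>(x, y). x \<otimes>\<^bsub>G\<^esub> y) \<and>
     continuous_map T T (\<lambda>x. inv\<^bsub>G\<^esub> x)"

text \<open>A profinite group is a compact Hausdorff topological group whose open subgroups form a base
  for the neighbourhoods of the identity; it is pro-\<open>p\<close> if moreover every open normal subgroup has
  index a power of \<open>p\<close>.\<close>

definition profinite_group :: "('a, 'b) monoid_scheme \<Rightarrow> 'a topology \<Rightarrow> bool" where
  "profinite_group G T \<longleftrightarrow>
     topological_group G T \<and> compact_space T \<and> Hausdorff_space T \<and>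
     (\<forall>U. openin T U \<and> \<one>\<^bsub>G\<^esub> \<in> U \<longrightarrow> (\<exists>H. subgroup H G \<and> openin T H \<and> H \<subseteq> U))"

definition pro_p_group :: "nat \<Rightarrow> ('a, 'b) monoid_scheme \<Rightarrow> 'a topology \<Rightarrow> bool" where
  "pro_p_group p G T \<longleftrightarrow>
     profinite_group G T \<and>
     (\<forall>N. N \<lhd> G \<and> openin T N \<longrightarrow> (\<exists>k::nat. card (rcosets\<^bsub>G\<^esub> N) = p ^ k))"

text \<open>The finiteness condition only matters for \<open>n = 0\<close>, since an infinite set has cardinality 0.
  All subgroups are counted, not just the open ones.\<close>

definition subgroups_of_index :: "('a, 'b) monoid_scheme \<Rightarrow> nat \<Rightarrow> 'a set set" where
  "subgroups_of_index G n =
     {H. subgroup H G \<and> finite (rcosets\<^bsub>G\<^esub> H) \<and> card (rcosets\<^bsub>G\<^esub> H) = n}"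

definition normal_subgroups_of_index :: "('a, 'b) monoid_scheme \<Rightarrow> nat \<Rightarrow> 'a set set" where
  "normal_subgroups_of_index G n =
     {N. N \<lhd> G \<and> finite (rcosets\<^bsub>G\<^esub> N) \<and> card (rcosets\<^bsub>G\<^esub> N) = n}"

text \<open>These numbers are meaningful only when the sets counted are finite.\<close>

definition subgroup_count :: "('a, 'b) monoid_scheme \<Rightarrow> nat \<Rightarrow> nat" where
  "subgroup_count G n = card (subgroups_of_index G n)"

definition normal_subgroup_count :: "('a, 'b) monoid_scheme \<Rightarrow> nat \<Rightarrow> nat" where
  "normal_subgroup_count G n = card (normal_subgroups_of_index G n)"

text \<open>Functions of a positive integer argument; the value at 0 is irrelevant.\<close>

definition of_growth_type :: "(nat \<Rightarrow> real) \<Rightarrow> (nat \<Rightarrow> real) \<Rightarrow> bool" where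
  "of_growth_type f g \<longleftrightarrow>
     (\<exists>C::real. (\<forall>n\<ge>1. f n < g n powr C) \<and> (\<exists>\<^sub>\<infinity>n. f n powr C > g n))"

text \<open>For \<open>\<epsilon> > 2\<close> the function \<open>p^(k^(2 - \<epsilon>))\<close> tends to 1 from above, and no function with
  values in the natural numbers is of that type.\<close>

lemma not_of_growth_type_if_gt_2:
  fixes f :: "nat \<Rightarrow> nat" and p :: nat and \<epsilon> :: real
  assumes p: "p > 1" and e: "\<epsilon> > 2"
  shows "\<not> of_growth_type (\<lambda>k. real (f k)) (\<lambda>k. real p powr (real k powr (2 - \<epsilon>)))"
proof
  assume "of_growth_type (\<lambda>k. real (f k)) (\<lambda>k. real p powr (real k powr (2 - \<epsilon>)))"
  then obtain C :: real where
    up: "\<And>n. n \<ge> 1 \<Longrightarrow> real (f n) < (real p powr (real n powr (2 - \<epsilon>))) powr C"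
    and lo: "\<exists>\<^sub>\<infinity>n. real (f n) powr C > real p powr (real n powr (2 - \<epsilon>))"
    unfolding of_growth_type_def by blast
  have "(\<lambda>n. real n powr (2 - \<epsilon>)) \<longlonglongrightarrow> 0"
    using e by (intro tendsto_neg_powr filterlim_real_sequentially) auto
  then have "(\<lambda>n. (real p powr (real n powr (2 - \<epsilon>))) powr C) \<longlonglongrightarrow> (real p powr 0) powr C"
    using p by (intro tendsto_intros) auto
  then have "eventually (\<lambda>n. (real p powr (real n powr (2 - \<epsilon>))) powr C < 2) sequentially"
    using p by (intro order_tendstoD(2)[where y = "(real p powr 0) powr C"]) auto
  then have "eventually (\<lambda>n. n \<ge> 1 \<and> (real p powr (real n powr (2 - \<epsilon>))) powr C < 2) sequentially"
    by (intro eventually_conj eventually_ge_at_top)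
  moreover have "\<exists>\<^sub>F n in sequentially. real (f n) powr C > real p powr (real n powr (2 - \<epsilon>))"
    using lo by (simp add: cofinite_eq_sequentially)
  ultimately have "\<exists>\<^sub>F n in sequentially. real (f n) powr C > real p powr (real n powr (2 - \<epsilon>)) \<and>
      n \<ge> 1 \<and> (real p powr (real n powr (2 - \<epsilon>))) powr C < 2"
    by (rule frequently_eventually_frequently[rotated])
  then obtain n where n: "n \<ge> 1" "(real p powr (real n powr (2 - \<epsilon>))) powr C < 2"
      "real (f n) powr C > real p powr (real n powr (2 - \<epsilon>))"
    by (blast dest: frequently_ex)
  from up[OF n(1)] n(2) have "real (f n) < 2" by linarith
  then have "f n = 0 \<or> f n = 1" by linarith
  moreover have "real p powr (real n powr (2 - \<epsilon>)) \<ge> 1"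
    using p by (intro ge_one_powr_ge_zero) auto
  ultimately show False using n(3) by auto
qed

end

theory Submission
  imports Defs "HOL-Algebra.Generated_Groups" "HOL-Computational_Algebra.Computational_Algebra"
    "HOL-Number_Theory.Cong" "HOL-Real_Asymp.Real_Asymp"
begin

text \<open>Let \<open>O = \<F>\<^sub>p[[t]]\<close>, and let \<open>G\<close> be the semidirect product of the first congruence subgroup \<open>Q\<close> of
  \<open>SL\<^sub>2(O)\<close> with the Heisenberg group on \<open>v \<in> (t O)\<^sup>2\<close> whose centre \<open>W\<close> consists of the power series with
  exponents in a set \<open>S\<close>; the commutator form is \<open>\<omega>(v, v')\<close>, truncated to \<open>S\<close>.

  A subgroup \<open>H\<close> of index \<open>p\<^sup>k\<close> meets the torus and every root subgroup in a subgroup that misses at most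
  \<open>k\<close> valuations. Since the torus part of \<open>H\<close> acts on the root subgroups by multiplication, \<open>H\<close> contains a
  congruence subgroup of level \<open>O(k)\<close>. A finite group of order \<open>p\<^sup>T\<close> has at most \<open>p\<close> to the power \<open>O(T\<^sup>2)\<close>
  subgroups, and the elementary abelian sections between levels \<open>n\<close> and \<open>2n\<close> show that this is the right
  order of magnitude.

  A normal subgroup is determined, up to boundedly many choices, by the depths \<open>n\<close> and \<open>b\<close> of its matrix
  and vector parts together with a subspace of \<open>W\<close> modulo depth \<open>b + O(1)\<close>. If \<open>S\<close> has about
  \<open>n\<^sup>\<alpha>\<close> elements below \<open>n\<close>, with \<open>2 \<alpha> = 2 - \<epsilon>\<close>, the central subspaces account for the normal subgroup
  growth. For \<open>\<epsilon> = 2\<close> the group \<open>Q\<close> alone has boundedly many normal subgroups of each index.\<close>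

text \<open>Conjugation spreads a nonzero leading matrix or vector over all directions a few levels
  deeper, so these coordinates have bounded width in a normal subgroup. The centre is fixed by
  conjugation: at exponents below the depth of the vectors every subspace of \<open>W\<close> is
  allowed, and thinning \<open>W\<close> out to \<open>S\<close> tunes the normal growth, while the
  matrix coordinates keep the full subgroup growth. Truncation to \<open>S\<close> is harmless
  because it is additive.

  The obstacle is that all subgroups are counted, not only the open ones, so no limit argument
  applies to a subgroup \<open>H\<close>; every descent to shallower levels starts from a congruence
  ideal or subgroup already known to lie in \<open>H\<close>.

  For \<open>\<epsilon> = 2\<close> the vectors are dropped as well: a count of type
  \<open>p\<close> stays bounded, whereas the choice of the two depths costs a factor polynomial in
  \<open>k\<close>.

  The lower bounds compute no index: a family of \<open>p^(m^2)\<close> subgroups is spread over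
  linearly many indices, one of which receives a large share, and linear rescaling of
  \<open>k\<close> is absorbed in the constant of the growth type.\<close>

unbundle no vec_syntax
unbundle fps_syntax

subsection \<open>Cosets and finite index\<close>

context group
begin

lemma rcos_eq_iff:
  assumes "subgroup H G" "x \<in> carrier G" "y \<in> carrier G"
  shows "H #> x = H #> y \<longleftrightarrow> x \<otimes> inv y \<in> H"
proof -
  interpret subgroup H G by fact
  have "H #> x = H #> y \<longleftrightarrow> x \<in> H #> y"
    using assms repr_independence rcos_self by metis
  then show ?thesis using rcos_module[OF is_group assms(3,2)] by simp
qed

lemma coset_pigeonhole:
  assumes H: "subgroup H G" "finite (rcosets H)"
    and f: "\<And>c. c \<in> C \<Longrightarrow> f c \<in> carrier G" and C: "card (rcosets H) < card C"
  obtains c c' where "c \<in> C" "c' \<in> C" "c \<noteq> c'" "f c \<otimes> inv (f c') \<in> H"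
proof -
  have sub: "(\<lambda>c. H #> f c) ` C \<subseteq> rcosets H"
    using f subgroup.subset[OF H(1)] by (auto intro: rcosetsI)
  then have "card ((\<lambda>c. H #> f c) ` C) < card C"
    using card_mono[OF H(2) sub] C by linarith
  then have "\<not> inj_on (\<lambda>c. H #> f c) C"
    by (rule pigeonhole)
  then obtain c c' where "c \<in> C" "c' \<in> C" "c \<noteq> c'" "H #> f c = H #> f c'"
    unfolding inj_on_def by blast
  then show thesis
    using that rcos_eq_iff[OF H(1)] f by blast
qed

lemma rcosets_eq_image: "rcosets K = (\<lambda>x. K #> x) ` carrier G"
  by (auto simp: RCOSETS_def)

text \<open>Lagrange for infinite groups with finitely many cosets: the cosets of \<open>K\<close>
  inside \<open>H a\<close> are the right translates by \<open>a\<close> of those inside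
  \<open>H\<close>, so all fibres over \<open>rcosets H\<close> have equal size.\<close>

lemma index_tower:
  assumes K: "subgroup K G" and H: "subgroup H G" and KH: "K \<subseteq> H" and fin: "finite (rcosets K)"
  shows "finite (rcosets H)"
    and "card (rcosets K) = card (rcosets H) * card ((\<lambda>x. K #> x) ` H)"
proof -
  have Kc: "K \<subseteq> carrier G" and Hc: "H \<subseteq> carrier G"
    using K H subgroup.subset by auto
  have eqH: "H #> x = H #> y" if "x \<in> carrier G" "y \<in> carrier G" "K #> x = K #> y" for x y
    using that rcos_eq_iff[OF K] rcos_eq_iff[OF H] KH by blast
  \<comment> \<open>A coset of \<open>K\<close> determines the coset of \<open>H\<close> containing
    it, and the union recovers that coset without a choice of representative.\<close>
  have "rcosets H \<subseteq> (\<lambda>S. \<Union>x\<in>S. H #> x) ` (rcosets K)"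
  proof
    fix T assume "T \<in> rcosets H"
    then obtain a where a: "a \<in> carrier G" "T = H #> a" by (auto simp: rcosets_eq_image)
    have "H #> x = H #> a" if "x \<in> K #> a" for x
    proof -
      have "x \<in> carrier G" using that a Kc r_coset_subset_G by blast
      moreover have "K #> x = K #> a" by (rule repr_independence[OF that a(1) K, symmetric])
      ultimately show ?thesis using eqH a by blast
    qed
    moreover have "a \<in> K #> a" using a K rcos_self by blast
    ultimately have "T = (\<Union>x\<in>K #> a. H #> x)" unfolding a(2) by blast
    then show "T \<in> (\<lambda>S. \<Union>x\<in>S. H #> x) ` (rcosets K)"
      using a(1) by (intro image_eqI[of _ _ "K #> a"]) (auto simp: rcosets_eq_image)
  qed
  then show finH: "finite (rcosets H)" using fin finite_surj by blast
  define P where "P T = {S \<in> rcosets K. S \<subseteq> T}" for T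
  have cardP: "card (P T) = card ((\<lambda>x. K #> x) ` H)" if T: "T \<in> rcosets H" for T
  proof -
    obtain a where a: "a \<in> carrier G" "T = H #> a" using T by (auto simp: rcosets_eq_image)
    have "P T = (\<lambda>S. S #> a) ` ((\<lambda>x. K #> x) ` H)"
    proof (intro equalityI subsetI)
      fix S assume "S \<in> P T"
      then obtain x where x: "x \<in> carrier G" "S = K #> x" "S \<subseteq> H #> a"
        using a by (auto simp: P_def rcosets_eq_image)
      then have "x \<in> H #> a" using rcos_self[OF x(1) K] by blast
      then obtain h where "h \<in> H" "x = h \<otimes> a" by (auto simp: r_coset_def)
      then show "S \<in> (\<lambda>S. S #> a) ` ((\<lambda>x. K #> x) ` H)"
        using x a Kc Hc by (auto simp: coset_mult_assoc image_iff intro!: bexI[of _ h])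
    next
      fix S assume "S \<in> (\<lambda>S. S #> a) ` ((\<lambda>x. K #> x) ` H)"
      then obtain h where h: "h \<in> H" "S = K #> (h \<otimes> a)"
        using a Kc Hc by (auto simp: coset_mult_assoc subset_iff)
      moreover have "K #> (h \<otimes> a) \<subseteq> H #> a"
      proof
        fix z assume "z \<in> K #> (h \<otimes> a)"
        then obtain k where "k \<in> K" "z = k \<otimes> (h \<otimes> a)" by (auto simp: r_coset_def)
        then have "z = (k \<otimes> h) \<otimes> a" "k \<otimes> h \<in> H"
          using h a KH Hc subgroup.m_closed[OF H] by (auto simp: m_assoc subset_iff)
        then show "z \<in> H #> a" by (auto simp: r_coset_def)
      qed
      ultimately show "S \<in> P T" using a Hc by (auto simp: P_def rcosets_eq_image subset_iff)
    qed
    moreover have "inj_on (\<lambda>S. S #> a) ((\<lambda>x. K #> x) ` H)"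
    proof (rule inj_onI)
      fix S S' assume "S \<in> (\<lambda>x. K #> x) ` H" "S' \<in> (\<lambda>x. K #> x) ` H" and eq: "S #> a = S' #> a"
      then have "S \<subseteq> carrier G" "S' \<subseteq> carrier G"
        using r_coset_subset_G[OF Kc] Hc by blast+
      moreover have "S #> a #> inv a = S' #> a #> inv a" using eq by simp
      ultimately show "S = S'" using a by (simp add: coset_mult_assoc)
    qed
    ultimately show ?thesis by (simp add: card_image)
  qed
  have un: "rcosets K = (\<Union>T\<in>rcosets H. P T)"
  proof (intro equalityI subsetI)
    fix S assume S: "S \<in> rcosets K"
    then obtain x where x: "x \<in> carrier G" "S = K #> x" by (auto simp: rcosets_eq_image)
    then have "S \<subseteq> H #> x" using KH by (auto simp: r_coset_def)
    then show "S \<in> (\<Union>T\<in>rcosets H. P T)" using S x by (auto simp: P_def rcosets_eq_image)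
  qed (auto simp: P_def)
  have "card (rcosets K) = (\<Sum>T\<in>rcosets H. card (P T))"
    unfolding un
  proof (rule card_UN_disjoint[OF finH])
    show "\<forall>T\<in>rcosets H. finite (P T)" using fin by (auto simp: P_def)
    show "\<forall>T\<in>rcosets H. \<forall>T'\<in>rcosets H. T \<noteq> T' \<longrightarrow> P T \<inter> P T' = {}"
    proof (intro ballI impI, rule ccontr)
      fix T T' assume T: "T \<in> rcosets H" "T' \<in> rcosets H" "T \<noteq> T'" and "P T \<inter> P T' \<noteq> {}"
      then obtain S where "S \<in> rcosets K" "S \<subseteq> T" "S \<subseteq> T'" by (auto simp: P_def)
      moreover from this have "S \<noteq> {}" using subgroup.rcosets_non_empty[OF K] by blast
      ultimately have "T \<inter> T' \<noteq> {}" by blast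
      then show False using rcos_disjoint[OF H] T by (auto simp: pairwise_def disjnt_def)
    qed
  qed
  then show "card (rcosets K) = card (rcosets H) * card ((\<lambda>x. K #> x) ` H)"
    using cardP by simp
qed

text \<open>Each new generator at least doubles the number of cosets of \<open>K\<close>.\<close>

lemma generated_by_few:
  assumes K: "subgroup K G" and H: "subgroup H G" and KH: "K \<subseteq> H"
    and fin: "finite ((\<lambda>x. K #> x) ` H)" and card: "card ((\<lambda>x. K #> x) ` H) \<le> 2 ^ m"
  obtains A where "A \<subseteq> H" "finite A" "card A \<le> m" "generate G (K \<union> A) = H"
proof -
  let ?q = "\<lambda>S. (\<lambda>x. K #> x) ` S"
  have Kc: "K \<subseteq> carrier G" and Hc: "H \<subseteq> carrier G"
    using K H subgroup.subset by auto
  have "\<exists>A\<subseteq>H. finite A \<and> card A \<le> j \<and>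
      (generate G (K \<union> A) = H \<or> 2 ^ j \<le> card (?q (generate G (K \<union> A))))" for j
  proof (induction j)
    case 0
    have "?q (generate G K) \<noteq> {}" using generate.one by blast
    moreover have "generate G K \<subseteq> H" using generate_subgroup_incl[OF KH H] .
    then have "finite (?q (generate G K))" using fin by (meson finite_subset image_mono)
    ultimately have "2 ^ 0 \<le> card (?q (generate G K))"
      by (simp add: card_gt_0_iff Suc_leI)
    then show ?case by (intro exI[of _ "{}"]) auto
  next
    case (Suc j)
    then obtain A where A: "A \<subseteq> H" "finite A" "card A \<le> j"
      and or: "generate G (K \<union> A) = H \<or> 2 ^ j \<le> card (?q (generate G (K \<union> A)))" by blast
    show ?case
    proof (cases "generate G (K \<union> A) = H")
      case True
      then show ?thesis using A by (intro exI[of _ A]) auto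
    next
      case False
      define L where "L = generate G (K \<union> A)"
      have L: "subgroup L G" "L \<subseteq> H"
        unfolding L_def using A KH Kc Hc
        by (auto intro!: generate_is_subgroup generate_subgroup_incl[OF _ H] dest: subsetD)
      then obtain h where h: "h \<in> H" "h \<notin> L" using False L_def by blast
      define L' where "L' = generate G (K \<union> insert h A)"
      have L': "subgroup L' G" "L' \<subseteq> H"
        unfolding L'_def using A KH Kc Hc h
        by (auto intro!: generate_is_subgroup generate_subgroup_incl[OF _ H] dest: subsetD)
      have LL': "L \<subseteq> L'" unfolding L_def L'_def by (rule mono_generate) auto
      have hL': "h \<in> L'" unfolding L'_def by (rule generate.incl) auto
      have KL: "K \<subseteq> L" unfolding L_def by (auto intro: generate.incl)
      have Lc: "L \<subseteq> carrier G" using L Hc by blast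
      have hc: "h \<in> carrier G" using h Hc by blast
      let ?Lh = "(\<lambda>x. x \<otimes> h) ` L"
      have "?q ?Lh = (\<lambda>S. S #> h) ` ?q L"
        using Lc Kc hc by (auto simp: coset_mult_assoc image_image image_iff subset_iff)
      moreover have "inj_on (\<lambda>S. S #> h) (?q L)"
      proof (rule inj_onI)
        fix S S' assume "S \<in> ?q L" "S' \<in> ?q L" and eq: "S #> h = S' #> h"
        then have "S \<subseteq> carrier G" "S' \<subseteq> carrier G"
          using r_coset_subset_G[OF Kc] Lc by blast+
        moreover have "S #> h #> inv h = S' #> h #> inv h" using eq by simp
        ultimately show "S = S'" using hc by (simp add: coset_mult_assoc)
      qed
      ultimately have cardh: "card (?q ?Lh) = card (?q L)" by (simp add: card_image)
      have disj: "?q L \<inter> ?q ?Lh = {}"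
      proof (rule ccontr)
        assume "?q L \<inter> ?q ?Lh \<noteq> {}"
        then obtain x y where xy: "x \<in> L" "y \<in> L" "K #> x = K #> (y \<otimes> h)" by blast
        then have "y \<otimes> h \<otimes> inv x \<in> L"
          using rcos_eq_iff[OF K, of "y \<otimes> h" x] KL Lc hc by (auto simp: subset_iff)
        then have "inv y \<otimes> (y \<otimes> h \<otimes> inv x) \<otimes> x \<in> L"
          using L(1) xy by (simp add: subgroup.m_closed subgroup.m_inv_closed)
        moreover have "inv y \<otimes> (y \<otimes> h \<otimes> inv x) \<otimes> x = h"
        proof -
          have "x \<in> carrier G" "y \<in> carrier G" using xy Lc by auto
          then show ?thesis using hc by (simp add: m_assoc) (simp add: m_assoc[symmetric])
        qed
        ultimately show False using h by simp
      qed
      have sub: "?q L \<union> ?q ?Lh \<subseteq> ?q L'"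
        using LL' hL' subgroup.m_closed[OF L'(1)] by (auto simp: subset_iff)
      have finL': "finite (?q L')" using fin L'(2) by (meson finite_subset image_mono)
      then have "card (?q L) + card (?q ?Lh) \<le> card (?q L')"
        using card_Un_disjoint[OF _ _ disj] card_mono[OF finL' sub] sub finite_subset
        by (metis finite_Un)
      then have "2 ^ Suc j \<le> card (?q L')"
        using or False cardh by (simp add: L_def)
      then show ?thesis using A h unfolding L'_def
        by (intro exI[of _ "insert h A"]) (auto simp: card_insert_if)
    qed
  qed
  from this[of m] obtain A where A: "A \<subseteq> H" "finite A" "card A \<le> m"
    and or: "generate G (K \<union> A) = H \<or> 2 ^ m \<le> card (?q (generate G (K \<union> A)))" by blast
  have "generate G (K \<union> A) = H"
  proof (rule ccontr)
    assume ne: "generate G (K \<union> A) \<noteq> H"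
    let ?L = "generate G (K \<union> A)"
    have L: "subgroup ?L G" "?L \<subseteq> H"
      using A KH Kc Hc by (auto intro!: generate_is_subgroup generate_subgroup_incl[OF _ H])
    have sub: "?q ?L \<subseteq> ?q H" using L by blast
    have le: "card (?q H) \<le> card (?q ?L)" using ne or card by linarith
    have eq: "?q ?L = ?q H" by (rule card_seteq[OF fin sub le])
    have "H \<subseteq> ?L"
    proof
      fix x assume x: "x \<in> H"
      then obtain y where y: "y \<in> ?L" "K #> x = K #> y" using eq by blast
      then have "x \<otimes> inv y \<in> ?L"
        using rcos_eq_iff[OF K, of x y] x Hc L by (auto intro: generate.incl)
      then have "x \<otimes> inv y \<otimes> y \<in> ?L" using subgroup.m_closed[OF L(1)] y by blast
      moreover have "x \<in> carrier G" "y \<in> carrier G" using x y L Hc by auto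
      ultimately show "x \<in> ?L" by (simp add: m_assoc)
    qed
    then show False using L ne by blast
  qed
  then show thesis using that A by blast
qed

text \<open>Such an \<open>H\<close> is generated by \<open>K\<close> and at most \<open>L\<close>
  elements, since each new generator doubles the number of cosets and \<open>M \<le> 2 ^ L\<close>.
  Each generator can be moved within its coset of \<open>K\<close> to one of at most
  \<open>M\<close> fixed representatives, so \<open>H\<close> is named by a list of length
  \<open>L\<close>. For \<open>M = p^T\<close> and \<open>L = p * T\<close> with \<open>p\<close>
  fixed this is \<open>p\<close> to the power \<open>O(T^2)\<close>.\<close>

lemma card_intermediate_subgroups:
  assumes K: "subgroup K G" and B: "B \<subseteq> carrier G"
    and fin: "finite ((\<lambda>x. K #> x) ` B)" and card: "card ((\<lambda>x. K #> x) ` B) \<le> M" and M: "M \<le> 2 ^ L"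
  shows "finite {H. subgroup H G \<and> K \<subseteq> H \<and> H \<subseteq> B}"
    and "card {H. subgroup H G \<and> K \<subseteq> H \<and> H \<subseteq> B} \<le> M ^ L"
proof -
  let ?q = "\<lambda>S. (\<lambda>x. K #> x) ` S"
  have Kc: "K \<subseteq> carrier G" using K subgroup.subset by auto
  define r where "r S = (SOME x. x \<in> B \<and> K #> x = S)" for S
  have r: "r (K #> x) \<in> B" "K #> r (K #> x) = K #> x" if "x \<in> B" for x
    unfolding r_def using someI[of "\<lambda>y. y \<in> B \<and> K #> y = K #> x" x] that by auto
  define R where "R = r ` ?q B"
  have R: "finite R" "card R \<le> M"
    unfolding R_def using fin card card_image_le[OF fin, of r] by auto
  let ?S = "{xs. set xs \<subseteq> R \<and> length xs = L}"
  have sub: "{H. subgroup H G \<and> K \<subseteq> H \<and> H \<subseteq> B} \<subseteq> (\<lambda>xs. generate G (K \<union> set xs)) ` ?S"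
  proof
    fix H assume "H \<in> {H. subgroup H G \<and> K \<subseteq> H \<and> H \<subseteq> B}"
    then have H: "subgroup H G" "K \<subseteq> H" "H \<subseteq> B" by auto
    have Hc: "H \<subseteq> carrier G" using H B by blast
    have "?q H \<subseteq> ?q B" using H by blast
    then have "finite (?q H)" "card (?q H) \<le> 2 ^ L"
      using card_mono[OF fin \<open>?q H \<subseteq> ?q B\<close>] card M finite_subset[OF _ fin] by auto
    from generated_by_few[OF K H(1,2) this]
    obtain A where A: "A \<subseteq> H" "finite A" "card A \<le> L" "generate G (K \<union> A) = H" by blast
    define A' where "A' = (\<lambda>x. r (K #> x)) ` A"
    have rH: "r (K #> x) \<in> H" if "x \<in> H" for x
    proof -
      have "r (K #> x) \<in> K #> x"
        using r[of x] that H B rcos_self[OF _ K, of "r (K #> x)"] by auto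
      then obtain k where "k \<in> K" "r (K #> x) = k \<otimes> x" by (auto simp: r_coset_def)
      then show ?thesis using H that subgroup.m_closed[OF H(1)] by auto
    qed
    have "card A' \<le> card A" unfolding A'_def by (rule card_image_le[OF A(2)])
    then have A': "A' \<subseteq> R" "finite A'" "card A' \<le> L" "A' \<subseteq> H"
      unfolding A'_def R_def using A(1-3) H(3) rH by auto
    obtain ys where ys: "set ys = A'" "length ys = card A'"
      using finite_distinct_list[OF A'(2)] distinct_card by metis
    have one: "\<one> \<in> B" using H subgroup.one_closed by blast
    \<comment> \<open>Lists must have length exactly \<open>L\<close>; the representative of the
      trivial coset lies in \<open>K\<close>, so padding with it does not change the generated
      subgroup.\<close>
    define o' where "o' = r (K #> \<one>)"
    have o': "o' \<in> K" "o' \<in> R"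
    proof -
      have "o' \<in> K #> \<one>" unfolding o'_def
        using r[OF one] one B rcos_self[OF _ K, of "r (K #> \<one>)"] by auto
      then show "o' \<in> K" using Kc by simp
      show "o' \<in> R" unfolding o'_def R_def using one by auto
    qed
    define xs where "xs = ys @ replicate (L - card A') o'"
    have xs: "length xs = L" "set xs \<subseteq> R" using ys A' o' by (auto simp: xs_def)
    have setxs: "K \<union> set xs = K \<union> A'" using ys o' by (auto simp: xs_def)
    have gsub: "subgroup (generate G (K \<union> A')) G"
      using A' Kc Hc by (intro generate_is_subgroup) auto
    have "A \<subseteq> generate G (K \<union> A')"
    proof
      fix a assume a: "a \<in> A"
      then have aB: "a \<in> B" "a \<in> carrier G" using A H B by auto
      then have "K #> a = K #> r (K #> a)" using r by auto
      then have "a \<otimes> inv (r (K #> a)) \<in> K"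
        using rcos_eq_iff[OF K] aB r[OF aB(1)] B by blast
      then have "a \<otimes> inv (r (K #> a)) \<in> generate G (K \<union> A')" by (auto intro: generate.incl)
      moreover have ra: "r (K #> a) \<in> generate G (K \<union> A')"
        using a by (auto simp: A'_def intro: generate.incl)
      ultimately have "a \<otimes> inv (r (K #> a)) \<otimes> r (K #> a) \<in> generate G (K \<union> A')"
        using subgroup.m_closed[OF gsub] by blast
      moreover have "r (K #> a) \<in> carrier G" using r[OF aB(1)] B by auto
      ultimately show "a \<in> generate G (K \<union> A')" using aB by (simp add: m_assoc)
    qed
    then have "generate G (K \<union> A) \<subseteq> generate G (K \<union> A')"
      by (intro generate_subgroup_incl[OF _ gsub]) (auto intro: generate.incl)
    moreover have "generate G (K \<union> A') \<subseteq> H"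
      using A' H by (intro generate_subgroup_incl[OF _ H(1)]) auto
    ultimately have "H = generate G (K \<union> set xs)" using A(4) setxs by auto
    then show "H \<in> (\<lambda>xs. generate G (K \<union> set xs)) ` ?S" using xs by blast
  qed
  have finS: "finite ?S" using finite_lists_length_eq[OF R(1)] .
  show "finite {H. subgroup H G \<and> K \<subseteq> H \<and> H \<subseteq> B}"
    using finite_surj[OF finS sub] .
  have "card {H. subgroup H G \<and> K \<subseteq> H \<and> H \<subseteq> B} \<le> card ?S"
    using surj_card_le[OF finS sub] .
  also have "\<dots> = card R ^ L" using card_lists_length_eq[OF R(1)] .
  also have "\<dots> \<le> M ^ L" using R by (simp add: power_mono)
  finally show "card {H. subgroup H G \<and> K \<subseteq> H \<and> H \<subseteq> B} \<le> M ^ L" .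
qed

end

section \<open>Transport of indices and subgroup counts along isomorphisms\<close>

lemma iso_rcosets:
  assumes h: "h \<in> iso G G'" and H: "H \<subseteq> carrier G"
  shows "rcosets\<^bsub>G'\<^esub> (h ` H) = image h ` (rcosets\<^bsub>G\<^esub> H)"
proof -
  have hom: "h \<in> hom G G'" and surj: "carrier G' = h ` carrier G"
    using h by (auto simp: iso_def bij_betw_def)
  have "rcosets\<^bsub>G'\<^esub> (h ` H) = (\<lambda>a. h ` H #>\<^bsub>G'\<^esub> h a) ` carrier G"
    unfolding RCOSETS_def surj by blast
  also have "\<dots> = (\<lambda>a. h ` (H #>\<^bsub>G\<^esub> a)) ` carrier G"
    using coset_hom(2)[OF hom H] by (intro image_cong) auto
  finally show ?thesis by (auto simp: RCOSETS_def)
qed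

lemma iso_card_rcosets:
  assumes G: "group G" "group G'" and h: "h \<in> iso G G'" and H: "subgroup H G"
  shows "card (rcosets\<^bsub>G'\<^esub> (h ` H)) = card (rcosets\<^bsub>G\<^esub> H)"
    and "finite (rcosets\<^bsub>G'\<^esub> (h ` H)) \<longleftrightarrow> finite (rcosets\<^bsub>G\<^esub> H)"
proof -
  have "inj_on h (carrier G)" using h by (auto simp: iso_def bij_betw_def)
  moreover have "rcosets\<^bsub>G\<^esub> H \<subseteq> Pow (carrier G)"
    using group.rcosets_subset_PowG[OF G(1) H] .
  ultimately have inj: "inj_on (image h) (rcosets\<^bsub>G\<^esub> H)"
    by (meson inj_on_image_Pow inj_on_subset)
  show "card (rcosets\<^bsub>G'\<^esub> (h ` H)) = card (rcosets\<^bsub>G\<^esub> H)"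
       "finite (rcosets\<^bsub>G'\<^esub> (h ` H)) \<longleftrightarrow> finite (rcosets\<^bsub>G\<^esub> H)"
    unfolding iso_rcosets[OF h subgroup.subset[OF H]]
    using card_image[OF inj] finite_image_iff[OF inj] by auto
qed

lemma iso_bij_betw_subgroups:
  assumes G: "group G" "group G'" and h: "h \<in> iso G G'"
  shows "bij_betw (image h) (subgroups_of_index G n) (subgroups_of_index G' n)"
    and "bij_betw (image h) (normal_subgroups_of_index G n) (normal_subgroups_of_index G' n)"
proof -
  define h' where "h' = inv_into (carrier G) h"
  have h': "h' \<in> iso G' G" unfolding h'_def by (rule group.iso_set_sym[OF G(1) h])
  have inj: "inj_on h (carrier G)" and surj: "h ` carrier G = carrier G'"
    using h by (auto simp: iso_def bij_betw_def)
  have ident: "h' ` (h ` S) = S" if "S \<subseteq> carrier G" for S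
    unfolding h'_def by (rule inv_into_image_cancel[OF inj that])
  have ident': "h ` (h' ` S) = S" if "S \<subseteq> carrier G'" for S
    unfolding h'_def using image_inv_into_cancel[OF surj that] .
  have sub: "h ` H \<in> subgroups_of_index G' n" if "H \<in> subgroups_of_index G n" for H
    using that iso_card_rcosets[OF G h] subgroup.iso_subgroup[OF _ G h]
    by (auto simp: subgroups_of_index_def)
  have sub': "h' ` H \<in> subgroups_of_index G n" if "H \<in> subgroups_of_index G' n" for H
    using that iso_card_rcosets[OF G(2,1) h'] subgroup.iso_subgroup[OF _ G(2,1) h']
    by (auto simp: subgroups_of_index_def)
  have nor: "h ` H \<in> normal_subgroups_of_index G' n" if "H \<in> normal_subgroups_of_index G n" for H
    using that iso_card_rcosets[OF G h normal_imp_subgroup] iso_normal_subgroup[OF h G]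
    by (auto simp: normal_subgroups_of_index_def)
  have nor': "h' ` H \<in> normal_subgroups_of_index G n" if "H \<in> normal_subgroups_of_index G' n" for H
    using that iso_card_rcosets[OF G(2,1) h' normal_imp_subgroup] iso_normal_subgroup[OF h' G(2,1)]
    by (auto simp: normal_subgroups_of_index_def)
  have c: "H \<subseteq> carrier G" if "H \<in> subgroups_of_index G n \<or> H \<in> normal_subgroups_of_index G n" for H
    using that subgroup.subset normal_imp_subgroup
    by (force simp: subgroups_of_index_def normal_subgroups_of_index_def)
  have c': "H \<subseteq> carrier G'" if "H \<in> subgroups_of_index G' n \<or> H \<in> normal_subgroups_of_index G' n" for H
    using that subgroup.subset normal_imp_subgroup
    by (force simp: subgroups_of_index_def normal_subgroups_of_index_def)
  show "bij_betw (image h) (subgroups_of_index G n) (subgroups_of_index G' n)"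
    by (rule bij_betw_byWitness[where f' = "image h'"]) (use c c' ident ident' sub sub' in auto)
  show "bij_betw (image h) (normal_subgroups_of_index G n) (normal_subgroups_of_index G' n)"
    by (rule bij_betw_byWitness[where f' = "image h'"]) (use c c' ident ident' nor nor' in auto)
qed

text \<open>An element is encoded by the sequence of its cosets.\<close>

lemma pro_p_group_of_filtration:
  fixes G :: "('a, 'b) monoid_scheme" and K :: "nat \<Rightarrow> 'a set"
  assumes G: "group G" and p: "prime p"
    and K: "\<And>n. K n \<lhd> G" and dec: "\<And>n. K (Suc n) \<subseteq> K n"
    and idx: "\<And>n. \<exists>m. card (rcosets\<^bsub>G\<^esub> (K n)) = p ^ m"
    and sep: "(\<Inter>n. K n) = {\<one>\<^bsub>G\<^esub>}"
    and complete: "\<And>g. (\<And>n. g n \<in> carrier G) \<Longrightarrow> (\<And>n. g (Suc n) \<in> K n #>\<^bsub>G\<^esub> g n) \<Longrightarrow>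
        \<exists>x\<in>carrier G. \<forall>n. x \<in> K n #>\<^bsub>G\<^esub> g n"
  obtains G' :: "(nat \<Rightarrow> nat) monoid" and T h where "group G'" "h \<in> iso G G'" "pro_p_group p G' T"
proof -
  interpret G: group G by (rule G)
  have Ks: "subgroup (K n) G" for n using K normal_imp_subgroup by blast
  have Kc: "K n \<subseteq> carrier G" for n using Ks subgroup.subset by blast
  have antimono: "K m \<subseteq> K n" if "n \<le> m" for n m
    using that by (induction rule: dec_induct) (use dec in blast)+
  have finK: "finite (rcosets\<^bsub>G\<^esub> (K n))" for n
    using idx[of n] p by (intro card_ge_0_finite) (auto simp: prime_gt_0_nat)
  then have "\<forall>n. \<exists>f :: 'a set \<Rightarrow> nat. inj_on f (rcosets\<^bsub>G\<^esub> (K n))"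
    using finite_imp_inj_to_nat_seg by blast
  then obtain c :: "nat \<Rightarrow> 'a set \<Rightarrow> nat" where c: "\<And>n. inj_on (c n) (rcosets\<^bsub>G\<^esub> (K n))"
    by metis
  define \<phi> where "\<phi> x = (\<lambda>n. c n (K n #>\<^bsub>G\<^esub> x))" for x
  define D where "D n = c n ` (rcosets\<^bsub>G\<^esub> (K n))" for n
  define S where "S n i = inv_into (rcosets\<^bsub>G\<^esub> (K n)) (c n) i" for n i
  have rc: "K n #>\<^bsub>G\<^esub> x \<in> rcosets\<^bsub>G\<^esub> (K n)" if "x \<in> carrier G" for x n
    using G.rcosetsI[OF Kc that] .
  have S\<phi>: "S n (\<phi> x n) = K n #>\<^bsub>G\<^esub> x" if "x \<in> carrier G" for x n
    unfolding S_def \<phi>_def using inv_into_f_f[OF c rc[OF that]] .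
  have \<phi>_eq: "\<phi> x n = \<phi> y n \<longleftrightarrow> K n #>\<^bsub>G\<^esub> x = K n #>\<^bsub>G\<^esub> y"
    if "x \<in> carrier G" "y \<in> carrier G" for x y n
    unfolding \<phi>_def using inj_on_eq_iff[OF c rc rc] that by blast
  have \<phi>_one: "\<phi> x n = \<phi> \<one>\<^bsub>G\<^esub> n \<longleftrightarrow> x \<in> K n" if "x \<in> carrier G" for x n
    using \<phi>_eq[OF that G.one_closed] G.rcos_eq_iff[OF Ks that G.one_closed] that by simp
  have \<phi>D: "\<phi> x n \<in> D n" if "x \<in> carrier G" for x n
    unfolding D_def \<phi>_def using rc[OF that] by blast
  have inj\<phi>: "inj_on \<phi> (carrier G)"
  proof (rule inj_onI)
    fix x y assume xy: "x \<in> carrier G" "y \<in> carrier G" "\<phi> x = \<phi> y"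
    have "x \<otimes>\<^bsub>G\<^esub> inv\<^bsub>G\<^esub> y \<in> K n" for n
      using \<phi>_eq[OF xy(1,2), of n] xy(3) G.rcos_eq_iff[OF Ks xy(1,2)] by metis
    then have "x \<otimes>\<^bsub>G\<^esub> inv\<^bsub>G\<^esub> y = \<one>\<^bsub>G\<^esub>" using sep by blast
    then show "x = y" using xy by (metis G.inv_equality G.inv_inv G.inv_closed)
  qed
  define C where "C = \<phi> ` carrier G"
  define \<psi> where "\<psi> = inv_into (carrier G) \<phi>"
  have \<psi>: "\<psi> (\<phi> x) = x" if "x \<in> carrier G" for x
    unfolding \<psi>_def using inv_into_f_f[OF inj\<phi> that] .
  define G' :: "(nat \<Rightarrow> nat) monoid" where
    "G' = \<lparr>carrier = C, monoid.mult = (\<lambda>u v. \<phi> (\<psi> u \<otimes>\<^bsub>G\<^esub> \<psi> v)), one = \<phi> \<one>\<^bsub>G\<^esub>\<rparr>"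
  have carr: "carrier G' = \<phi> ` carrier G" by (simp add: G'_def C_def)
  have mult: "\<phi> x \<otimes>\<^bsub>G'\<^esub> \<phi> y = \<phi> (x \<otimes>\<^bsub>G\<^esub> y)" if "x \<in> carrier G" "y \<in> carrier G" for x y
    using that by (simp add: G'_def \<psi>)
  have one: "\<one>\<^bsub>G'\<^esub> = \<phi> \<one>\<^bsub>G\<^esub>" by (simp add: G'_def)
  have gG': "group G'"
  proof (rule groupI)
    fix u v w assume "u \<in> carrier G'" "v \<in> carrier G'" "w \<in> carrier G'"
    then show "u \<otimes>\<^bsub>G'\<^esub> v \<otimes>\<^bsub>G'\<^esub> w = u \<otimes>\<^bsub>G'\<^esub> (v \<otimes>\<^bsub>G'\<^esub> w)"
      by (auto simp: carr mult G.m_assoc)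
  next
    fix u assume "u \<in> carrier G'"
    then obtain x where x: "x \<in> carrier G" "u = \<phi> x" by (auto simp: carr)
    then show "\<exists>v\<in>carrier G'. v \<otimes>\<^bsub>G'\<^esub> u = \<one>\<^bsub>G'\<^esub>"
      by (intro bexI[of _ "\<phi> (inv\<^bsub>G\<^esub> x)"]) (auto simp: carr mult one)
  qed (auto simp: carr mult one)
  then interpret G': group G' .
  have iso: "\<phi> \<in> iso G G'"
    using inj\<phi> by (auto simp: iso_def hom_def bij_betw_def carr mult)
  have inv': "inv\<^bsub>G'\<^esub> (\<phi> x) = \<phi> (inv\<^bsub>G\<^esub> x)" if "x \<in> carrier G" for x
    using that by (intro G'.inv_equality) (auto simp: carr mult one)
  define X where "X = product_topology (\<lambda>n. discrete_topology (D n)) (UNIV :: nat set)"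
  define T where "T = subtopology X C"
  have topX: "topspace X = {u. \<forall>n. u n \<in> D n}" by (auto simp: X_def PiE_def Pi_def)
  have CX: "C \<subseteq> topspace X" using \<phi>D by (auto simp: C_def topX)
  have topT: "topspace T = C" using CX by (auto simp: T_def)
  have proj: "continuous_map X (discrete_topology (D n)) (\<lambda>u. u n)" for n
    unfolding X_def by (intro continuous_map_product_projection) simp
  have projT: "continuous_map T (discrete_topology (D n)) (\<lambda>u. u n)" for n
    unfolding T_def by (intro continuous_map_from_subtopology proj)
  have closed: "closedin X C"
  proof -
    \<comment> \<open>Membership in the image is a condition on consecutive coordinates: each pair
      must come from one group element. Each such condition is closed, and completeness turns a
      compatible sequence into an element.\<close>
    define E where "E n = {u \<in> topspace X. (u n, u (Suc n)) \<in>
        {(\<phi> x n, \<phi> x (Suc n)) | x. x \<in> carrier G}}" for n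
    have "closedin X (E n)" for n
      unfolding E_def
    proof (rule closedin_continuous_map_preimage)
      show "continuous_map X (discrete_topology (D n \<times> D (Suc n))) (\<lambda>u. (u n, u (Suc n)))"
        unfolding prod_topology_discrete_topology by (intro continuous_map_pairedI proj)
    qed (use \<phi>D in auto)
    then have cl: "closedin X (\<Inter>n. E n)" by (intro closedin_Inter) auto
    have "(\<Inter>n. E n) = C"
    proof (intro equalityI subsetI)
      fix u assume "u \<in> (\<Inter>n. E n)"
      then have "\<forall>n. \<exists>x\<in>carrier G. u n = \<phi> x n \<and> u (Suc n) = \<phi> x (Suc n)"
        by (force simp: E_def)
      then obtain g where g: "\<And>n. g n \<in> carrier G" "\<And>n. u n = \<phi> (g n) n"
          "\<And>n. u (Suc n) = \<phi> (g n) (Suc n)" by metis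
      have "g (Suc n) \<in> K n #>\<^bsub>G\<^esub> g n" for n
      proof -
        have "\<phi> (g (Suc n)) (Suc n) = \<phi> (g n) (Suc n)" using g by metis
        then have "g (Suc n) \<otimes>\<^bsub>G\<^esub> inv\<^bsub>G\<^esub> (g n) \<in> K (Suc n)"
          using \<phi>_eq[OF g(1) g(1)] G.rcos_eq_iff[OF Ks g(1) g(1)] by metis
        then show ?thesis
          using dec subgroup.rcos_module[OF Ks G g(1) g(1)] by blast
      qed
      then obtain x where x: "x \<in> carrier G" "\<And>n. x \<in> K n #>\<^bsub>G\<^esub> g n" using complete g(1) by metis
      have "K n #>\<^bsub>G\<^esub> g n = K n #>\<^bsub>G\<^esub> x" for n by (rule G.repr_independence[OF x(2) g(1) Ks])
      then have "u = \<phi> x" using \<phi>_eq[OF g(1) x(1)] g(2) by (intro ext) metis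
      then show "u \<in> C" using x by (simp add: C_def)
    next
      fix u assume "u \<in> C"
      then show "u \<in> (\<Inter>n. E n)" using CX by (auto simp: E_def C_def)
    qed
    with cl show ?thesis by simp
  qed
  have compX: "compact_space X"
    unfolding X_def compact_space_product_topology
    using finK by (auto simp: D_def compact_space_discrete_topology)
  have compT: "compact_space T"
    unfolding T_def using closedin_compact_space[OF compX closed]
    by (simp add: compact_space_subtopology)
  have hausT: "Hausdorff_space T"
    unfolding T_def X_def
    by (intro Hausdorff_space_subtopology) (simp add: Hausdorff_space_product_topology)
  have into: "continuous_map Y T f"
    if "\<And>n. continuous_map Y (discrete_topology (D n)) (\<lambda>z. f z n)" "f ` topspace Y \<subseteq> C" for Y f
    unfolding T_def using that
    by (simp add: continuous_map_in_subtopology X_def continuous_map_componentwise_UNIV image_subset_iff_funcset)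
  have contm: "continuous_map (prod_topology T T) T (\<lambda>(x, y). x \<otimes>\<^bsub>G'\<^esub> y)"
  proof (rule into)
    fix n
    define M where "M = (\<lambda>(i, j). c n (S n i <#>\<^bsub>G\<^esub> S n j))"
    have "continuous_map (prod_topology T T) (discrete_topology (D n \<times> D n)) (\<lambda>z. (fst z n, snd z n))"
      unfolding prod_topology_discrete_topology
      by (intro continuous_map_pairedI)
        (use continuous_map_compose[OF continuous_map_fst projT] 
             continuous_map_compose[OF continuous_map_snd projT] in \<open>auto simp: o_def\<close>)
    moreover have "continuous_map (discrete_topology (D n \<times> D n)) (discrete_topology (D n)) M"
    proof -
      have "M (i, j) \<in> D n" if ij: "i \<in> D n" "j \<in> D n" for i j
      proof -
        obtain x y where "x \<in> carrier G" "y \<in> carrier G" "i = \<phi> x n" "j = \<phi> y n"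
          using ij by (auto simp: D_def \<phi>_def G.rcosets_eq_image)
        then have "M (i, j) = \<phi> (x \<otimes>\<^bsub>G\<^esub> y) n"
          by (simp add: M_def S\<phi> normal.rcos_sum[OF K]) (simp add: \<phi>_def)
        then show ?thesis using \<phi>D \<open>x \<in> carrier G\<close> \<open>y \<in> carrier G\<close> by simp
      qed
      then show ?thesis by auto
    qed
    ultimately have "continuous_map (prod_topology T T) (discrete_topology (D n)) (M \<circ> (\<lambda>z. (fst z n, snd z n)))"
      by (rule continuous_map_compose)
    then show "continuous_map (prod_topology T T) (discrete_topology (D n)) (\<lambda>z. (case z of (x, y) \<Rightarrow> x \<otimes>\<^bsub>G'\<^esub> y) n)"
    proof (rule continuous_map_eq)
      fix z assume "z \<in> topspace (prod_topology T T)"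
      then obtain x y where "x \<in> carrier G" "y \<in> carrier G" "z = (\<phi> x, \<phi> y)"
        by (auto simp: topT C_def)
      then show "(M \<circ> (\<lambda>z. (fst z n, snd z n))) z = (case z of (x, y) \<Rightarrow> x \<otimes>\<^bsub>G'\<^esub> y) n"
        by (simp add: mult M_def S\<phi> normal.rcos_sum[OF K]) (simp add: \<phi>_def)
    qed
  next
    show "(\<lambda>(x, y). x \<otimes>\<^bsub>G'\<^esub> y) ` topspace (prod_topology T T) \<subseteq> C"
      by (auto simp: topT C_def mult)
  qed
  have conti: "continuous_map T T (\<lambda>x. inv\<^bsub>G'\<^esub> x)"
  proof (rule into)
    fix n
    define M where "M = (\<lambda>i. c n (set_inv\<^bsub>G\<^esub> (S n i)))"
    have "continuous_map (discrete_topology (D n)) (discrete_topology (D n)) M"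
    proof -
      have "M i \<in> D n" if i: "i \<in> D n" for i
      proof -
        obtain x where "x \<in> carrier G" "i = \<phi> x n"
          using i by (auto simp: D_def \<phi>_def G.rcosets_eq_image)
        then have "M i = \<phi> (inv\<^bsub>G\<^esub> x) n"
          by (simp add: M_def S\<phi> normal.rcos_inv[OF K]) (simp add: \<phi>_def)
        then show ?thesis using \<phi>D \<open>x \<in> carrier G\<close> by simp
      qed
      then show ?thesis by auto
    qed
    from continuous_map_compose[OF projT this]
    show "continuous_map T (discrete_topology (D n)) (\<lambda>z. (inv\<^bsub>G'\<^esub> z) n)"
    proof (rule continuous_map_eq)
      fix z assume "z \<in> topspace T"
      then obtain x where "x \<in> carrier G" "z = \<phi> x" by (auto simp: topT C_def)
      then show "(M \<circ> (\<lambda>u. u n)) z = (inv\<^bsub>G'\<^esub> z) n"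
        by (simp add: inv' M_def S\<phi> normal.rcos_inv[OF K]) (simp add: \<phi>_def)
    qed
  next
    show "m_inv G' ` topspace T \<subseteq> C" by (auto simp: topT C_def inv')
  qed
  have opK: "openin T (\<phi> ` K n)" for n
  proof -
    have "\<phi> ` K n = {u \<in> topspace T. u n \<in> {\<phi> \<one>\<^bsub>G\<^esub> n}}"
      using \<phi>_one subsetD[OF Kc] by (auto simp: topT C_def)
    moreover have "openin T {u \<in> topspace T. u n \<in> {\<phi> \<one>\<^bsub>G\<^esub> n}}"
      using \<phi>D by (intro openin_continuous_map_preimage[OF projT]) auto
    ultimately show ?thesis by simp
  qed
  have base: "\<exists>n. \<phi> ` K n \<subseteq> U" if U: "openin T U" "\<one>\<^bsub>G'\<^esub> \<in> U" for U
  proof -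
    obtain V where V: "openin X V" "U = V \<inter> C" using U by (auto simp: T_def openin_subtopology)
    then have "\<phi> \<one>\<^bsub>G\<^esub> \<in> V" using U one by auto
    then obtain W where W: "finite {i. W i \<noteq> D i}" "\<phi> \<one>\<^bsub>G\<^esub> \<in> Pi\<^sub>E UNIV W" "Pi\<^sub>E UNIV W \<subseteq> V"
      using V(1) unfolding X_def openin_product_topology_alt by auto
    define n where "n = Max (insert 0 {i. W i \<noteq> D i})"
    have "\<phi> x \<in> U" if x: "x \<in> K n" for x
    proof -
      have xc: "x \<in> carrier G" using x Kc by blast
      have "\<phi> x i \<in> W i" for i
      proof (cases "W i = D i")
        case True
        then show ?thesis using \<phi>D[OF xc] by simp
      next
        case False
        then have "i \<le> n" unfolding n_def using W(1) by (intro Max_ge) auto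
        then have "x \<in> K i" using antimono x by blast
        then have "\<phi> x i = \<phi> \<one>\<^bsub>G\<^esub> i" using \<phi>_one[OF xc] by blast
          then show ?thesis using W(2) by (auto simp: PiE_def Pi_def)
      qed
      then show ?thesis using W(3) xc V(2) by (auto simp: C_def PiE_def Pi_def)
    qed
    then show ?thesis by blast
  qed
  have sub': "subgroup (\<phi> ` K n) G'" for n
    by (rule subgroup.iso_subgroup[OF Ks G gG' iso])
  have "pro_p_group p G' T"
    unfolding pro_p_group_def profinite_group_def topological_group_def
  proof (intro conjI allI impI)
    show "topspace T = carrier G'" by (simp add: topT carr C_def)
    show "\<exists>H. subgroup H G' \<and> openin T H \<and> H \<subseteq> U" if U: "openin T U \<and> \<one>\<^bsub>G'\<^esub> \<in> U" for U
    proof -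
      obtain n where "\<phi> ` K n \<subseteq> U" using base[of U] U by auto
      then show ?thesis using opK[of n] sub'[of n] by (intro exI[of _ "\<phi> ` K n"] conjI)
    qed
    show "\<exists>k. card (rcosets\<^bsub>G'\<^esub> N) = p ^ k" if N: "N \<lhd> G' \<and> openin T N" for N
    proof -
      have Ns: "subgroup N G'" using N normal_imp_subgroup by blast
      obtain n where n: "\<phi> ` K n \<subseteq> N" using base[of N] N subgroup.one_closed[OF Ns] by blast
      obtain m where m: "card (rcosets\<^bsub>G\<^esub> (K n)) = p ^ m" using idx by blast
      have "finite (rcosets\<^bsub>G'\<^esub> (\<phi> ` K n))" "card (rcosets\<^bsub>G'\<^esub> (\<phi> ` K n)) = p ^ m"
        using iso_card_rcosets[OF G gG' iso Ks] finK m by auto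
      then have "card (rcosets\<^bsub>G'\<^esub> N) dvd p ^ m"
        using G'.index_tower(2)[OF sub' Ns n] by (metis dvd_triv_left)
      then show ?thesis using divides_primepow_nat[OF p, of _ m] by blast
    qed
  qed (use gG' compT hausT contm conti in auto)
  then show thesis using that gG' iso by blast
qed

subsection \<open>A ring containing all prime fields\<close>

text \<open>The product of all rings \<open>\<int>/m\<close>. It hosts \<open>\<F>\<^sub>p\<close> for every \<open>p\<close> simultaneously, as the ideal
  generated by an idempotent, because no type can depend on the variable \<open>p\<close>.\<close>

typedef residues_prod = "{f :: nat \<Rightarrow> int. \<forall>m. f m mod int m = f m}"
  by (rule exI[of _ "\<lambda>_. 0"]) simp

setup_lifting type_definition_residues_prod

instantiation residues_prod :: comm_ring_1
begin

lift_definition zero_residues_prod :: residues_prod is "\<lambda>_. 0" by simp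
lift_definition one_residues_prod :: residues_prod is "\<lambda>m. 1 mod int m" by simp
lift_definition plus_residues_prod :: "residues_prod \<Rightarrow> residues_prod \<Rightarrow> residues_prod"
  is "\<lambda>f g m. (f m + g m) mod int m" by simp
lift_definition minus_residues_prod :: "residues_prod \<Rightarrow> residues_prod \<Rightarrow> residues_prod"
  is "\<lambda>f g m. (f m - g m) mod int m" by simp
lift_definition uminus_residues_prod :: "residues_prod \<Rightarrow> residues_prod"
  is "\<lambda>f m. (- f m) mod int m" by simp
lift_definition times_residues_prod :: "residues_prod \<Rightarrow> residues_prod \<Rightarrow> residues_prod"
  is "\<lambda>f g m. (f m * g m) mod int m" by simp

instance
proof
  fix a b c :: residues_prod
  show "a * b * c = a * (b * c)" by transfer (auto simp: fun_eq_iff mod_simps mult.assoc)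
  show "a * b = b * a" by transfer (auto simp: fun_eq_iff mult.commute)
  show "1 * a = a" by transfer (auto simp: fun_eq_iff mod_simps)
  show "(a + b) * c = a * c + b * c" by transfer (auto simp: fun_eq_iff mod_simps distrib_right)
  show "a + b + c = a + (b + c)" by transfer (auto simp: fun_eq_iff mod_simps add.assoc)
  show "a + b = b + a" by transfer (auto simp: fun_eq_iff add.commute)
  show "0 + a = a" by transfer (auto simp: fun_eq_iff)
  show "- a + a = 0" by transfer (auto simp: fun_eq_iff mod_simps)
  show "a - b = a + - b" by transfer (auto simp: fun_eq_iff mod_simps)
  \<comment> \<open>The witness is component 0, which is the ring of integers because reduction
    modulo 0 is the identity.\<close>
  show "(0 :: residues_prod) \<noteq> 1" by transfer (auto simp: fun_eq_iff intro!: exI[of _ 0])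
qed

end

lift_definition residue_idem :: "nat \<Rightarrow> residues_prod" is "\<lambda>p m. if m = p then 1 mod int m else 0"
  by simp

text \<open>The ideal generated by \<open>e\<close> is a field with \<open>p\<close> elements and
  unit \<open>e\<close>. Only these properties of the ambient ring enter the group theory, in
  particular that every scalar of the field is an integer multiple of \<open>e\<close>.\<close>

locale prime_idem =
  fixes p :: nat and e :: "'r :: comm_ring_1"
  assumes prime: "prime p" and p_gt_2: "p > 2"
    and idem: "e * e = e" and e_nz: "e \<noteq> 0" and char: "of_nat p * e = 0"
    and cyclic: "e * x = x \<Longrightarrow> \<exists>j::nat. x = of_nat j * e"

lemma of_nat_residues_prod: "Rep_residues_prod (of_nat j) = (\<lambda>m. int j mod int m)"
  by (induction j)
    (auto simp: zero_residues_prod.rep_eq plus_residues_prod.rep_eq one_residues_prod.rep_eq mod_simps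
      add.commute)

lemma prime_idem_residue:
  assumes "prime p" "p > 2"
  shows "prime_idem p (residue_idem p)"
proof
  show "residue_idem p * residue_idem p = residue_idem p"
    by transfer (auto simp: fun_eq_iff mod_simps)
  show "residue_idem p \<noteq> 0"
    using assms by transfer (auto simp: fun_eq_iff)
  show "of_nat p * residue_idem p = 0"
    by (simp add: Rep_residues_prod_inject[symmetric] times_residues_prod.rep_eq residue_idem.rep_eq
        of_nat_residues_prod zero_residues_prod.rep_eq fun_eq_iff mod_simps)
  fix x assume x: "residue_idem p * x = x"
  let ?f = "Rep_residues_prod x"
  have f: "?f m mod int m = ?f m" for m using Rep_residues_prod[of x] by simp
  have x': "?f m = (if m = p then ?f p else 0)" for m
    using arg_cong[OF x, of "\<lambda>x. Rep_residues_prod x m"] f[of m]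
    by (auto simp: times_residues_prod.rep_eq residue_idem.rep_eq mod_simps split: if_splits)
  have pos: "?f p \<ge> 0" using f[of p] assms by (metis pos_mod_sign of_nat_0_less_iff prime_gt_0_nat)
  have "?f = Rep_residues_prod (of_nat (nat (?f p)) * residue_idem p)"
  proof
    fix m
    show "?f m = Rep_residues_prod (of_nat (nat (?f p)) * residue_idem p) m"
      using x'[of m] f[of p] pos
      by (auto simp: times_residues_prod.rep_eq residue_idem.rep_eq of_nat_residues_prod mod_simps
          simp del: of_nat_nat of_int_of_nat_eq)
  qed
  then show "\<exists>j::nat. x = of_nat j * residue_idem p"
    by (metis Rep_residues_prod_inject)
qed (use assms in auto)

subsection \<open>Power series over the prime field\<close>

context prime_idem
begin

definition F :: "'r set" where "F = {x. e * x = x}"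

lemma F_zero [simp]: "0 \<in> F" and e_in_F [simp]: "e \<in> F"
  by (auto simp: F_def idem)

lemma F_add: "x \<in> F \<Longrightarrow> y \<in> F \<Longrightarrow> x + y \<in> F"
  and F_diff: "x \<in> F \<Longrightarrow> y \<in> F \<Longrightarrow> x - y \<in> F"
  and F_uminus: "x \<in> F \<Longrightarrow> - x \<in> F"
  by (auto simp: F_def algebra_simps)

lemma F_mult: "x \<in> F \<Longrightarrow> x * y \<in> F" and F_mult': "x \<in> F \<Longrightarrow> y * x \<in> F"
  by (auto simp: F_def) (metis mult.assoc, metis mult.assoc mult.commute)

lemma F_sum: "(\<And>i. i \<in> A \<Longrightarrow> f i \<in> F) \<Longrightarrow> sum f A \<in> F"
  by (induction A rule: infinite_finite_induct) (auto intro: F_add)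

lemma F_e: "x \<in> F \<Longrightarrow> e * x = x" and F_e': "x \<in> F \<Longrightarrow> x * e = x"
  by (auto simp: F_def mult.commute)

lemma of_nat_e_eq_0_iff: "of_nat j * e = 0 \<longleftrightarrow> p dvd j"
proof
  assume "p dvd j"
  then obtain k where "j = k * p" by (metis dvd_def mult.commute)
  then have "of_nat j * e = of_nat k * (of_nat p * e)" by (simp add: mult.assoc)
  then show "of_nat j * e = 0" by (simp add: char)
next
  assume j: "of_nat j * e = 0"
  show "p dvd j"
  proof (rule ccontr)
    assume "\<not> p dvd j"
    then have "coprime j p" using prime by (metis coprime_commute prime_imp_coprime)
    then obtain i where i: "[j * i = 1] (mod p)" using cong_solve_coprime_nat[of j p] by auto
    have "1 \<le> j * i"
    proof (rule ccontr)
      assume "\<not> 1 \<le> j * i"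
      then have "j * i = 0" by linarith
      then have "[0 = 1] (mod p)" using i by (simp only:)
      then show False using prime p_gt_2 by (simp add: cong_def)
    qed
    have "p dvd j * i - 1" using cong_to_1_nat[OF i] .
    then obtain k where "j * i - 1 = p * k" by (auto simp: dvd_def)
    then have "j * i = 1 + p * k" using \<open>1 \<le> j * i\<close> by linarith
    then have "of_nat (j * i) * e = of_nat (1 + p * k) * e" by simp
    then have "of_nat i * (of_nat j * e) = e + of_nat k * (of_nat p * e)" by (simp add: algebra_simps)
    then show False using j char e_nz by simp
  qed
qed

lemma F_eq: "F = (\<lambda>j. of_nat j * e) ` {..<p}"
proof (intro equalityI subsetI)
  fix x assume "x \<in> F"
  then obtain j where j: "x = of_nat j * e" using cyclic by (auto simp: F_def)
  have "of_nat (p * (j div p)) * e = 0" by (simp only: of_nat_e_eq_0_iff dvd_triv_left)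
  then have "of_nat (p * (j div p) + j mod p) * e = of_nat (j mod p) * e"
    by (simp only: of_nat_add distrib_right)  simp
  then have "x = of_nat (j mod p) * e" using j by simp
  then show "x \<in> (\<lambda>j. of_nat j * e) ` {..<p}" using prime p_gt_2 by auto
qed (auto intro: F_mult')

lemma finite_F [simp]: "finite F" and card_F: "card F = p"
proof -
  have "inj_on (\<lambda>j. of_nat j * e) {..<p}"
  proof (rule linorder_inj_onI)
    fix i j assume "i < j" "i \<in> {..<p}" "j \<in> {..<p}"
    then have "\<not> p dvd (j - i)" by (simp add: nat_dvd_not_less)
    then have "of_nat (j - i) * e \<noteq> 0" by (simp add: of_nat_e_eq_0_iff)
    then show "of_nat i * e \<noteq> of_nat j * e" using \<open>i < j\<close>
      by (auto simp: of_nat_diff left_diff_distrib)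
  qed auto
  then show "finite F" "card F = p" by (auto simp: F_eq card_image)
qed

text \<open>Multiplication by a nonzero element is injective on the finite set \<open>F\<close> by
  Euclid's lemma, hence onto, so \<open>e\<close> is hit.\<close>

lemma F_inverse:
  assumes "x \<in> F" "x \<noteq> 0"
  obtains y where "y \<in> F" "x * y = e"
proof -
  have "inj_on (\<lambda>y. x * y) F"
  proof (rule inj_onI)
    fix y z assume yz: "y \<in> F" "z \<in> F" "x * y = x * z"
    obtain i where i: "x = of_nat i * e" using assms cyclic by (auto simp: F_def)
    obtain j where j: "y - z = of_nat j * e" using F_diff[OF yz(1,2)] cyclic by (auto simp: F_def)
    have "x * (y - z) = 0" using yz by (simp add: algebra_simps)
    then have "of_nat i * of_nat j * (e * e) = 0" unfolding i j by (simp only: ac_simps)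
    then have "of_nat (i * j) * e = 0" by (simp add: idem)
    then have "p dvd i \<or> p dvd j" using of_nat_e_eq_0_iff prime by (metis prime_dvd_mult_nat)
    moreover have "\<not> p dvd i" using i assms of_nat_e_eq_0_iff by blast
    ultimately have "of_nat j * e = 0" using of_nat_e_eq_0_iff[of j] by blast
    then have "y - z = 0" using j by simp
    then show "y = z" by simp
  qed
  then have "(\<lambda>y. x * y) ` F = F"
    using endo_inj_surj[OF finite_F, of "\<lambda>y. x * y"] assms F_mult by blast
  then have "e \<in> (\<lambda>y. x * y) ` F" by simp
  then show thesis using that by blast
qed

lemma F_no_zero_div: "x \<in> F \<Longrightarrow> y \<in> F \<Longrightarrow> x * y = 0 \<Longrightarrow> x = 0 \<or> y = 0"
  by (metis F_inverse F_e mult.assoc mult.commute mult_zero_left)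

text \<open>Oddness of \<open>p\<close> enters the algebra here: the brackets of
  \<open>sl_2\<close>, the torus weights on root subgroups and the Heisenberg commutators all carry
  a factor 2.\<close>

lemma F_two: "x \<in> F \<Longrightarrow> 2 * x = 0 \<Longrightarrow> x = 0"
proof (rule ccontr)
  assume x: "x \<in> F" "2 * x = 0" "x \<noteq> 0"
  have "2 * e \<noteq> 0" using of_nat_e_eq_0_iff[of 2] p_gt_2 by (auto dest: dvd_imp_le)
  moreover have "(2 * e) * x = 0" using x by (metis F_e mult.assoc mult.left_commute)
  moreover have "2 * e \<in> F" by (simp add: F_mult')
  ultimately show False using x F_no_zero_div by blast
qed

text \<open>This is \<open>t^n F[[t]]\<close>, but inside the power series over the ambient ring.
  Since \<open>F\<close> is an ideal there, \<open>P n\<close> absorbs arbitrary factors, including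
  units such as \<open>1 + f\<close> whose coefficients need not lie in \<open>F\<close>.\<close>

definition P :: "nat \<Rightarrow> 'r fps set" where
  "P n = {f. (\<forall>i. f $ i \<in> F) \<and> (\<forall>i<n. f $ i = 0)}"

lemma P_coeff: "f \<in> P n \<Longrightarrow> f $ i \<in> F" and P_coeff_0: "f \<in> P n \<Longrightarrow> i < n \<Longrightarrow> f $ i = 0"
  by (auto simp: P_def)

lemma P_zero [simp]: "0 \<in> P n"
  and P_add: "f \<in> P n \<Longrightarrow> g \<in> P n \<Longrightarrow> f + g \<in> P n"
  and P_diff: "f \<in> P n \<Longrightarrow> g \<in> P n \<Longrightarrow> f - g \<in> P n"
  and P_uminus: "f \<in> P n \<Longrightarrow> - f \<in> P n"
  by (auto simp: P_def intro: F_add F_diff F_uminus)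

lemma P_mono: "m \<le> n \<Longrightarrow> f \<in> P n \<Longrightarrow> f \<in> P m"
  by (auto simp: P_def)

lemma P_mult_right: "f \<in> P n \<Longrightarrow> f * g \<in> P n"
  by (auto simp: P_def fps_mult_nth intro!: F_sum F_mult sum.neutral)

lemma P_mult_left: "f \<in> P n \<Longrightarrow> g * f \<in> P n"
  using P_mult_right[of f n g] by (simp add: mult.commute)

lemma P_mult: "f \<in> P m \<Longrightarrow> g \<in> P n \<Longrightarrow> f * g \<in> P (m + n)"
proof -
  assume f: "f \<in> P m" and g: "g \<in> P n"
  have "f $ i * g $ (k - i) = 0" if "k < m + n" "i \<le> k" for i k
    using that P_coeff_0[OF f, of i] P_coeff_0[OF g, of "k - i"]
    by (cases "i < m") auto
  then show ?thesis using P_mult_right[OF f] by (auto simp: P_def fps_mult_nth intro!: sum.neutral)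
qed

lemma P_mult_nth: "f \<in> P m \<Longrightarrow> g \<in> P n \<Longrightarrow> (f * g) $ (m + n) = f $ m * g $ n"
proof -
  assume f: "f \<in> P m" and g: "g \<in> P n"
  have "(f * g) $ (m + n) = (\<Sum>i\<in>{0..m + n}. if i = m then f $ m * g $ n else 0)"
    unfolding fps_mult_nth
  proof (rule sum.cong)
    fix i assume "i \<in> {0..m + n}"
    then show "f $ i * g $ (m + n - i) = (if i = m then f $ m * g $ n else 0)"
      using P_coeff_0[OF f, of i] P_coeff_0[OF g, of "m + n - i"] by (cases i m rule: linorder_cases) auto
  qed simp
  also have "\<dots> = f $ m * g $ n" by (simp add: sum.delta)
  finally show ?thesis .
qed

lemma P_Suc_iff: "f \<in> P (Suc n) \<longleftrightarrow> f \<in> P n \<and> f $ n = 0"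
  by (auto simp: P_def less_Suc_eq)

lemma P_val:
  assumes "f \<in> P m" "f \<notin> P k"
  obtains n where "m \<le> n" "n < k" "f \<in> P n" "f $ n \<noteq> 0"
proof -
  have ex: "\<exists>i. f $ i \<noteq> 0" "\<exists>i<k. f $ i \<noteq> 0" using assms by (auto simp: P_def)
  define n where "n = (LEAST i. f $ i \<noteq> 0)"
  have n: "f $ n \<noteq> 0" unfolding n_def by (rule LeastI_ex[OF ex(1)])
  have below: "f $ i = 0" if "i < n" for i using not_less_Least[OF that[unfolded n_def]] by simp
  have "f \<in> P n" using assms(1) below by (auto simp: P_def)
  moreover have "n < k" using ex(2) below by (meson linorder_le_less_linear order_le_less_trans)
  moreover have "m \<le> n" using n P_coeff_0[OF assms(1), of n] by (meson not_le)
  ultimately show thesis using n that by blast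
qed

lemma P_monom: "x \<in> F \<Longrightarrow> fps_const x * fps_X ^ n \<in> P n"
  and P_monom_nth: "(fps_const x * fps_X ^ n) $ i = (if i = n then x else 0)"
  by (auto simp: P_def fps_X_power_nth)

lemma fps_const_e: "f \<in> P n \<Longrightarrow> fps_const e * f = f"
  by (auto simp: fps_eq_iff P_def F_e)

lemma P_unit_inverse:
  assumes "u - 1 \<in> P n" "n \<ge> 1"
  obtains v where "u * v = 1" "v - 1 \<in> P n"
proof -
  have "(u - 1) $ 0 = 0" using assms by (intro P_coeff_0) auto
  then have "u $ 0 = 1" by simp
  then have uv: "u * fps_right_inverse u 1 = 1" by (intro fps_right_inverse) auto
  let ?v = "fps_right_inverse u 1"
  have "?v - 1 = - ((u - 1) * ?v)" using uv by (simp add: algebra_simps)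
  then have "?v - 1 \<in> P n" using assms by (metis P_mult_right P_uminus)
  then show thesis using uv that by blast
qed

text \<open>Division in a valuation ring. The quotient of \<open>f\<close> by \<open>t^n\<close> has
  a constant term that is a unit of \<open>F\<close> only; adding the complementary idempotent
  \<open>1 - e\<close> gives a unit of the ambient ring without changing products with series over
  \<open>F\<close>.\<close>

lemma P_divide:
  assumes f: "f \<in> P n" "f $ n \<noteq> 0" and g: "g \<in> P (n + m)"
  obtains h where "h \<in> P m" "g = f * h"
proof -
  obtain y where y: "y \<in> F" "f $ n * y = e" using F_inverse P_coeff[OF f(1)] f(2) by metis
  define f' where "f' = fps_shift n f"
  define g' where "g' = fps_shift n g"
  have f': "f = fps_X ^ n * f'" and g': "g = fps_X ^ n * g'"
    using P_coeff_0[OF f(1)] P_coeff_0[OF g]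
    by (auto simp: f'_def g'_def fps_eq_iff fps_X_power_mult_nth)
  have g'P: "g' \<in> P m" using g by (auto simp: g'_def P_def)
  define u where "u = fps_const (1 - e) + f'"
  have "u $ 0 * (1 - e + y) = (1 - e + f $ n) * (1 - e + y)" by (simp add: u_def f'_def)
  also have "\<dots> = 1 - e - e + e * e + (y - e * y) + (f $ n - f $ n * e) + f $ n * y"
    by (simp add: algebra_simps)
  also have "\<dots> = 1" using y idem F_e[OF y(1)] F_e'[OF P_coeff[OF f(1)], of n] by simp
  finally have uv: "u * fps_right_inverse u (1 - e + y) = 1" by (intro fps_right_inverse)
  define h where "h = fps_right_inverse u (1 - e + y) * g'"
  have "fps_const (1 - e) * g' = 0"
    using g'P by (auto simp: fps_eq_iff P_def F_def algebra_simps)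
  then have "fps_right_inverse u (1 - e + y) * (fps_const (1 - e) * g') = 0" by simp
  then have "fps_const (1 - e) * h = 0" unfolding h_def by (simp only: ac_simps)
  then have "f' * h = u * h" by (simp add: u_def distrib_right)
  also have "\<dots> = g'" unfolding h_def using uv by (simp add: mult.assoc[symmetric])
  finally have "g = f * h" using f' g' by (simp add: mult.assoc)
  moreover have "h \<in> P m" unfolding h_def by (rule P_mult_left[OF g'P])
  ultimately show thesis using that by blast
qed

text \<open>Scalars of a prime field are integers, so a leading term can be cancelled inside any
  additive group that contains \<open>f\<close> and \<open>g\<close>.\<close>

lemma P_reduce:
  assumes f: "f \<in> P n" and g: "g \<in> P n" "g $ n \<noteq> 0"
  obtains j :: nat where "f - of_nat j * g \<in> P (Suc n)"
proof -
  obtain y where y: "y \<in> F" "g $ n * y = e" using F_inverse P_coeff[OF g(1)] g(2) by metis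
  obtain j where j: "f $ n * y = of_nat j * e" using cyclic F_mult[OF P_coeff[OF f]] unfolding F_def by blast
  have "of_nat j * g $ n = (of_nat j * e) * g $ n" using F_e P_coeff[OF g(1)] by (simp add: mult.assoc)
  also have "\<dots> = (f $ n * y) * g $ n" by (simp only: j)
  also have "\<dots> = f $ n * (g $ n * y)" by (simp only: ac_simps)
  also have "\<dots> = f $ n" using y F_e' P_coeff[OF f] by simp
  finally have eq: "of_nat j * g $ n = f $ n" .
  have "(f - of_nat j * g) $ n = 0" using eq by (simp add: fps_of_nat[symmetric])
  moreover have "f - of_nat j * g \<in> P n" using f g P_diff P_mult_left by blast
  ultimately have "f - of_nat j * g \<in> P (Suc n)" by (simp add: P_Suc_iff)
  then show thesis using that by blast
qed

lemma P_half:
  assumes "f \<in> P n"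
  obtains g where "g \<in> P n" "f = 2 * g"
proof -
  have "2 * e \<noteq> 0" using F_two e_nz by auto
  then have "(fps_const (2 * e)) $ 0 \<noteq> 0" by simp
  moreover have "fps_const (2 * e) \<in> P 0" by (auto simp: P_def F_mult')
  ultimately obtain h where h: "h \<in> P n" "f = fps_const (2 * e) * h"
    using P_divide[of "fps_const (2 * e)" 0 f n] assms by auto
  have "fps_const (2 * e) * h = 2 * (fps_const e * h)"
    by (simp only: fps_const_mult[symmetric] fps_numeral_fps_const[symmetric] mult.assoc)
  then show thesis using that h fps_const_e[OF h(1)] by simp
qed

definition restr :: "nat set \<Rightarrow> 'r fps \<Rightarrow> 'r fps" where
  "restr S f = Abs_fps (\<lambda>n. if n \<in> S then f $ n else 0)"

lemma restr_nth [simp]: "restr S f $ n = (if n \<in> S then f $ n else 0)"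
  by (simp add: restr_def)

lemma restr_add: "restr S (f + g) = restr S f + restr S g"
  and restr_diff: "restr S (f - g) = restr S f - restr S g"
  and restr_uminus: "restr S (- f) = - restr S f"
  and restr_zero [simp]: "restr S 0 = 0"
  by (auto simp: fps_eq_iff)

lemma restr_restr [simp]: "restr S (restr S f) = restr S f"
  by (auto simp: fps_eq_iff)

lemma restr_P: "f \<in> P n \<Longrightarrow> restr S f \<in> P n"
  by (auto simp: P_def)

end

lemma card_image_same_kernel:
  assumes "\<And>x y. x \<in> A \<Longrightarrow> y \<in> A \<Longrightarrow> f x = f y \<longleftrightarrow> g x = g y"
  shows "card (f ` A) = card (g ` A)"
proof -
  have s: "g (inv_into A f (f x)) = g x" if "x \<in> A" for x
    using assms[OF inv_into_into that] f_inv_into_f that by (metis imageI)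
  have "inj_on (\<lambda>z. g (inv_into A f z)) (f ` A)"
    using s assms by (intro inj_onI) (metis imageE)
  moreover have "(\<lambda>z. g (inv_into A f z)) ` f ` A = g ` A"
    using s by (auto simp: image_image)
  ultimately show ?thesis using card_image by metis
qed

subsection \<open>The group\<close>

text \<open>The element \<open>El a b c d x y w\<close> stands for a matrix \<open>A\<close> with rows \<open>(a, b)\<close>, \<open>(c, d)\<close>, a row vector
  \<open>v = (x, y)\<close> and a central coordinate \<open>w\<close>. The product is \<open>(A, v, w) (A', v', w') =
  (A A', v A' + v', w + w' + \<pi> (\<omega> (v A', v')))\<close> with \<open>\<omega>\<close> the determinant form and \<open>\<pi>\<close> the projection onto
  the coefficients with index in \<open>S\<close>.\<close>

datatype 'r elt = El (ea: "'r fps") (eb: "'r fps") (ec: "'r fps") (ed: "'r fps")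
  (ex: "'r fps") (ey: "'r fps") (ew: "'r fps")

text \<open>With \<open>V\<close> false the group is just the first congruence subgroup of \<open>SL\<^sub>2\<close>.\<close>

locale jacobi = prime_idem p e for p and e :: "'r :: comm_ring_1" +
  fixes V :: bool and S :: "nat set"
  assumes S_empty: "\<not> V \<Longrightarrow> S = {}"
begin

text \<open>The matrices are \<open>1 + A\<close> with \<open>A\<close> over
  \<open>t F[[t]]\<close>, where \<open>1\<close> is the unit of the ambient ring rather than
  \<open>e\<close>. Replacing \<open>e\<close> by \<open>1\<close> on the diagonal identifies them
  with the first congruence subgroup of \<open>SL_2(F[[t]])\<close>. The central coordinate may
  start at exponent 0.\<close>

definition JC :: "'r elt set" where
  "JC = {g. ea g - 1 \<in> P 1 \<and> eb g \<in> P 1 \<and> ec g \<in> P 1 \<and> ed g - 1 \<in> P 1 \<and>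
      ea g * ed g - eb g * ec g = 1 \<and> ex g \<in> P 1 \<and> ey g \<in> P 1 \<and> ew g \<in> P 0 \<and>
      restr S (ew g) = ew g \<and> (V \<or> ex g = 0 \<and> ey g = 0)}"

definition jmult :: "'r elt \<Rightarrow> 'r elt \<Rightarrow> 'r elt" where
  "jmult g h = El (ea g * ea h + eb g * ec h) (ea g * eb h + eb g * ed h)
      (ec g * ea h + ed g * ec h) (ec g * eb h + ed g * ed h)
      (ex g * ea h + ey g * ec h + ex h) (ex g * eb h + ey g * ed h + ey h)
      (ew g + ew h + restr S ((ex g * ea h + ey g * ec h) * ey h - (ex g * eb h + ey g * ed h) * ex h))"

definition J :: "'r elt monoid" where
  "J = \<lparr>carrier = JC, monoid.mult = jmult, one = El 1 0 0 1 0 0 0\<rparr>"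

lemma carrier_J: "carrier J = JC"
  and mult_J: "g \<otimes>\<^bsub>J\<^esub> h = jmult g h"
  and one_J: "\<one>\<^bsub>J\<^esub> = El 1 0 0 1 0 0 0"
  by (simp_all add: J_def)

lemma jmult_sel [simp]:
  "ea (jmult g h) = ea g * ea h + eb g * ec h" "eb (jmult g h) = ea g * eb h + eb g * ed h"
  "ec (jmult g h) = ec g * ea h + ed g * ec h" "ed (jmult g h) = ec g * eb h + ed g * ed h"
  "ex (jmult g h) = ex g * ea h + ey g * ec h + ex h" "ey (jmult g h) = ex g * eb h + ey g * ed h + ey h"
  "ew (jmult g h) = ew g + ew h +
     restr S ((ex g * ea h + ey g * ec h) * ey h - (ex g * eb h + ey g * ed h) * ex h)"
  by (simp_all add: jmult_def)

lemma restr_nonV: "\<not> V \<Longrightarrow> restr S f = 0"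
  using S_empty by (auto simp: fps_eq_iff)

lemma unit_mult_P: "f - 1 \<in> P n \<Longrightarrow> g - 1 \<in> P n \<Longrightarrow> f * g - 1 \<in> P n"
proof -
  assume "f - 1 \<in> P n" "g - 1 \<in> P n"
  then have "(f - 1) * g + (g - 1) \<in> P n" by (intro P_add P_mult_right)
  then show ?thesis by (simp add: algebra_simps)
qed

lemma unit_add_P: "f - 1 \<in> P n \<Longrightarrow> g \<in> P n \<Longrightarrow> f + g - 1 \<in> P n"
  using P_add[of "f - 1" n g] by (simp add: algebra_simps)

lemma unit_add_P': "f \<in> P n \<Longrightarrow> g - 1 \<in> P n \<Longrightarrow> f + g - 1 \<in> P n"
  using P_add[of f n "g - 1"] by (simp add: algebra_simps)

lemmas P_intros = P_add P_diff P_uminus P_mult_left P_mult_right unit_mult_P unit_add_P unit_add_P' restr_P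

lemma jmult_closed:
  assumes g: "g \<in> JC" and h: "h \<in> JC"
  shows "jmult g h \<in> JC"
proof -
  have "ea (jmult g h) * ed (jmult g h) - eb (jmult g h) * ec (jmult g h)
      = (ea g * ed g - eb g * ec g) * (ea h * ed h - eb h * ec h)"
    by (simp add: algebra_simps)
  moreover have "restr S (ew (jmult g h)) = ew (jmult g h)"
    using g h by (simp add: JC_def restr_add)
  moreover have "V \<or> ex (jmult g h) = 0 \<and> ey (jmult g h) = 0"
    using g h by (auto simp: JC_def)
  moreover have "(ex g * ea h + ey g * ec h) * ey h - (ex g * eb h + ey g * ed h) * ex h \<in> P 0"
    using g h P_mono[of 0 1] by (intro P_intros) (auto simp: JC_def)
  ultimately show ?thesis
    using g h unfolding JC_def by (auto intro: P_intros)
qed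

text \<open>The associativity of the last coordinate is the invariance of \<open>\<omega>\<close> under \<open>SL\<^sub>2\<close>.\<close>

lemma jmult_assoc:
  assumes "h'' \<in> JC"
  shows "jmult (jmult g h) h'' = jmult g (jmult h h'')"
proof (rule elt.expand, intro conjI)
  have det: "ea h'' * ed h'' - eb h'' * ec h'' = 1" using assms by (simp add: JC_def)
  define u1 where "u1 = ex g * ea h + ey g * ec h"
  define u2 where "u2 = ex g * eb h + ey g * ed h"
  define a b c d where "a = ea h''" "b = eb h''" "c = ec h''" "d = ed h''"
  have "(u1 * a + u2 * c) * (ex h * b + ey h * d) - (u1 * b + u2 * d) * (ex h * a + ey h * c)
     = (a * d - b * c) * (u1 * ey h - u2 * ex h)"
    by (simp add: algebra_simps)
  then have "(u1 * a + u2 * c) * (ex h * b + ey h * d) - (u1 * b + u2 * d) * (ex h * a + ey h * c)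
     = u1 * ey h - u2 * ex h" using det by (simp add: a_b_c_d_def)
  then have "u1 * ey h - u2 * ex h + (((u1 + ex h) * a + (u2 + ey h) * c) * ey h'' -
        ((u1 + ex h) * b + (u2 + ey h) * d) * ex h'') =
     ((ex h * a + ey h * c) * ey h'' - (ex h * b + ey h * d) * ex h'') +
     ((u1 * a + u2 * c) * (ex h * b + ey h * d + ey h'') - (u1 * b + u2 * d) * (ex h * a + ey h * c + ex h''))"
    by (simp add: algebra_simps)
  moreover have "ex g * (ea h * a + eb h * c) + ey g * (ec h * a + ed h * c) = u1 * a + u2 * c"
    "ex g * (ea h * b + eb h * d) + ey g * (ec h * b + ed h * d) = u1 * b + u2 * d"
    by (simp_all add: u1_def u2_def algebra_simps)
  ultimately have "restr S (u1 * ey h - u2 * ex h) + restr S (((u1 + ex h) * a + (u2 + ey h) * c) * ey h'' -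
        ((u1 + ex h) * b + (u2 + ey h) * d) * ex h'') =
     restr S ((ex h * a + ey h * c) * ey h'' - (ex h * b + ey h * d) * ex h'') +
     restr S ((ex g * (ea h * a + eb h * c) + ey g * (ec h * a + ed h * c)) * (ex h * b + ey h * d + ey h'') -
       (ex g * (ea h * b + eb h * d) + ey g * (ec h * b + ed h * d)) * (ex h * a + ey h * c + ex h''))"
    by (simp only: restr_add[symmetric])
  then show "ew (jmult (jmult g h) h'') = ew (jmult g (jmult h h''))"
    by (simp add: u1_def[symmetric] u2_def[symmetric] a_b_c_d_def[symmetric] add.assoc add.left_commute)
qed (simp_all add: algebra_simps)

text \<open>The adjugate inverts the matrix and the vector becomes \<open>- v A^-1\<close>. The form
  vanishes on parallel vectors, so the central coordinate just changes sign.\<close>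

definition jinv :: "'r elt \<Rightarrow> 'r elt" where
  "jinv g = El (ed g) (- eb g) (- ec g) (ea g) (ey g * ec g - ex g * ed g) (ex g * eb g - ey g * ea g) (- ew g)"

lemma jinv_sel [simp]:
  "ea (jinv g) = ed g" "eb (jinv g) = - eb g" "ec (jinv g) = - ec g" "ed (jinv g) = ea g"
  "ex (jinv g) = ey g * ec g - ex g * ed g" "ey (jinv g) = ex g * eb g - ey g * ea g" "ew (jinv g) = - ew g"
  by (simp_all add: jinv_def)

lemma jinv_closed: "g \<in> JC \<Longrightarrow> jinv g \<in> JC"
  by (auto simp: JC_def restr_uminus algebra_simps intro: P_intros)

lemma jinv_left:
  assumes "g \<in> JC"
  shows "jmult (jinv g) g = El 1 0 0 1 0 0 0"
proof (rule elt.expand, intro conjI)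
  have det: "ea g * ed g - eb g * ec g = 1" using assms by (simp add: JC_def)
  have x: "(ey g * ec g - ex g * ed g) * ea g + (ex g * eb g - ey g * ea g) * ec g = - ex g * (ea g * ed g - eb g * ec g)"
    and y: "(ey g * ec g - ex g * ed g) * eb g + (ex g * eb g - ey g * ea g) * ed g = - ey g * (ea g * ed g - eb g * ec g)"
    by (simp_all add: algebra_simps)
  have x': "(ey g * ec g - ex g * ed g) * ea g + (ex g * eb g - ey g * ea g) * ec g = - ex g"
    and y': "(ey g * ec g - ex g * ed g) * eb g + (ex g * eb g - ey g * ea g) * ed g = - ey g"
    unfolding x y det by simp_all
  have "ey g * ex g = ex g * ey g" by (rule mult.commute)
  then show "ex (jmult (jinv g) g) = ex (El 1 0 0 1 0 0 0)" "ey (jmult (jinv g) g) = ey (El 1 0 0 1 0 0 0)"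
       "ew (jmult (jinv g) g) = ew (El 1 0 0 1 0 0 0)"
    by (simp_all add: x' y')
qed (use assms in \<open>simp_all add: JC_def algebra_simps\<close>)

lemma one_in_JC: "El 1 0 0 1 0 0 0 \<in> JC"
  by (simp add: JC_def)

lemma group_J: "group J"
proof (rule groupI)
  fix g assume "g \<in> carrier J"
  then show "\<exists>h\<in>carrier J. h \<otimes>\<^bsub>J\<^esub> g = \<one>\<^bsub>J\<^esub>"
    by (intro bexI[of _ "jinv g"]) (simp_all add: carrier_J mult_J one_J jinv_left jinv_closed)
qed (simp_all add: carrier_J mult_J one_J jmult_closed jmult_assoc one_in_JC elt.expand)

sublocale J: group J by (rule group_J)

lemma inv_J: "g \<in> JC \<Longrightarrow> inv\<^bsub>J\<^esub> g = jinv g"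
  by (rule J.inv_equality) (auto simp: carrier_J mult_J one_J jinv_left jinv_closed)

subsection \<open>Congruence subgroups\<close>

text \<open>Every coordinate of a product is built from sums, products and \<open>restr\<close>, all
  compatible with congruence modulo \<open>t^n\<close>; hence the class of the identity is normal
  and its cosets are the congruence classes.\<close>

definition jcong :: "nat \<Rightarrow> 'r elt \<Rightarrow> 'r elt \<Rightarrow> bool" where
  "jcong n g h \<longleftrightarrow> ea g - ea h \<in> P n \<and> eb g - eb h \<in> P n \<and> ec g - ec h \<in> P n \<and> ed g - ed h \<in> P n \<and>
     ex g - ex h \<in> P n \<and> ey g - ey h \<in> P n \<and> ew g - ew h \<in> P n"

lemma jcong_refl [simp]: "jcong n g g"
  by (simp add: jcong_def)

lemma P_diff_swap: "f - g \<in> P n \<Longrightarrow> g - f \<in> P n"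
  using P_uminus[of "f - g" n] by simp

lemma P_diff_trans: "f - g \<in> P n \<Longrightarrow> g - h \<in> P n \<Longrightarrow> f - h \<in> P n"
  using P_add[of "f - g" n "g - h"] by simp

lemma P_diff_mult: "f - f' \<in> P n \<Longrightarrow> g - g' \<in> P n \<Longrightarrow> f * g - f' * g' \<in> P n"
proof -
  assume "f - f' \<in> P n" "g - g' \<in> P n"
  then have "(f - f') * g + f' * (g - g') \<in> P n" by (intro P_add P_mult_right[of "f - f'"] P_mult_left[of "g - g'"])
  then show ?thesis by (simp add: algebra_simps)
qed

lemma P_diff_add: "f - f' \<in> P n \<Longrightarrow> g - g' \<in> P n \<Longrightarrow> f + g - (f' + g') \<in> P n"
  using P_add[of "f - f'" n "g - g'"] by (simp add: algebra_simps)

lemma P_diff_diff: "f - f' \<in> P n \<Longrightarrow> g - g' \<in> P n \<Longrightarrow> f - g - (f' - g') \<in> P n"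
  using P_diff[of "f - f'" n "g - g'"] by (simp add: algebra_simps)

lemma P_diff_restr: "f - f' \<in> P n \<Longrightarrow> restr S f - restr S f' \<in> P n"
  using restr_P[of "f - f'" n S] by (simp add: restr_diff)

lemma jcong_sym: "jcong n g h \<Longrightarrow> jcong n h g"
  by (auto simp: jcong_def intro: P_diff_swap)

lemma jcong_mult: "jcong n g g' \<Longrightarrow> jcong n h h' \<Longrightarrow> jcong n (jmult g h) (jmult g' h')"
  unfolding jcong_def jmult_sel by (intro conjI P_diff_add P_diff_diff P_diff_restr P_diff_mult) auto

definition GK :: "nat \<Rightarrow> 'r elt set" where
  "GK n = {g \<in> JC. jcong n g (El 1 0 0 1 0 0 0)}"

lemma jcong_iff_GK:
  assumes "g \<in> JC" "h \<in> JC"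
  shows "jcong n g h \<longleftrightarrow> g \<otimes>\<^bsub>J\<^esub> inv\<^bsub>J\<^esub> h \<in> GK n"
proof
  assume "jcong n g h"
  then have "jcong n (g \<otimes>\<^bsub>J\<^esub> inv\<^bsub>J\<^esub> h) (h \<otimes>\<^bsub>J\<^esub> inv\<^bsub>J\<^esub> h)"
    unfolding mult_J by (intro jcong_mult) auto
  moreover have "h \<otimes>\<^bsub>J\<^esub> inv\<^bsub>J\<^esub> h = \<one>\<^bsub>J\<^esub>" using assms by (simp add: carrier_J)
  moreover have "g \<otimes>\<^bsub>J\<^esub> inv\<^bsub>J\<^esub> h \<in> JC" using assms J.m_closed J.inv_closed by (metis carrier_J)
  ultimately show "g \<otimes>\<^bsub>J\<^esub> inv\<^bsub>J\<^esub> h \<in> GK n" by (simp add: GK_def one_J)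
next
  assume "g \<otimes>\<^bsub>J\<^esub> inv\<^bsub>J\<^esub> h \<in> GK n"
  then have "jcong n (g \<otimes>\<^bsub>J\<^esub> inv\<^bsub>J\<^esub> h \<otimes>\<^bsub>J\<^esub> h) (\<one>\<^bsub>J\<^esub> \<otimes>\<^bsub>J\<^esub> h)"
    unfolding mult_J GK_def one_J by (intro jcong_mult) auto
  then show "jcong n g h" using assms by (simp add: carrier_J[symmetric] J.m_assoc)
qed

lemma GK_normal: "GK n \<lhd> J"
  unfolding J.normal_inv_iff
proof (intro conjI ballI)
  show sub: "subgroup (GK n) J"
  proof (rule J.subgroupI)
    fix g h assume g: "g \<in> GK n" and h: "h \<in> GK n"
    have "jcong n (jmult g h) (jmult (El 1 0 0 1 0 0 0) (El 1 0 0 1 0 0 0))"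
      using g h by (intro jcong_mult) (auto simp: GK_def)
    moreover have "jmult (El 1 0 0 1 0 0 0) (El 1 0 0 1 0 0 0) = El 1 0 0 1 0 0 0"
      by (simp add: jmult_def)
    ultimately show "g \<otimes>\<^bsub>J\<^esub> h \<in> GK n" using g h by (auto simp: GK_def mult_J jmult_closed)
  next
    fix g assume g: "g \<in> GK n"
    then have "jcong n (El 1 0 0 1 0 0 0) g" by (auto simp: GK_def intro: jcong_sym)
    then have "El 1 0 0 1 0 0 0 \<otimes>\<^bsub>J\<^esub> inv\<^bsub>J\<^esub> g \<in> GK n"
      using jcong_iff_GK[of "El 1 0 0 1 0 0 0" g n] g one_in_JC by (auto simp: GK_def)
    moreover have "El 1 0 0 1 0 0 0 \<otimes>\<^bsub>J\<^esub> inv\<^bsub>J\<^esub> g = inv\<^bsub>J\<^esub> g"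
      using g J.l_one[OF J.inv_closed, of g] by (simp add: one_J GK_def carrier_J)
    ultimately show "inv\<^bsub>J\<^esub> g \<in> GK n" by simp
  qed (use one_in_JC in \<open>auto simp: GK_def carrier_J\<close>)
  fix x h assume x: "x \<in> carrier J" and h: "h \<in> GK n"
  have "jcong n (x \<otimes>\<^bsub>J\<^esub> h \<otimes>\<^bsub>J\<^esub> inv\<^bsub>J\<^esub> x) (x \<otimes>\<^bsub>J\<^esub> \<one>\<^bsub>J\<^esub> \<otimes>\<^bsub>J\<^esub> inv\<^bsub>J\<^esub> x)"
    using h unfolding mult_J one_J GK_def by (intro jcong_mult) auto
  then have "jcong n (x \<otimes>\<^bsub>J\<^esub> h \<otimes>\<^bsub>J\<^esub> inv\<^bsub>J\<^esub> x) \<one>\<^bsub>J\<^esub>" using x by simp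
  moreover have "x \<otimes>\<^bsub>J\<^esub> h \<otimes>\<^bsub>J\<^esub> inv\<^bsub>J\<^esub> x \<in> carrier J" using x h by (auto simp: GK_def carrier_J[symmetric])
  ultimately show "x \<otimes>\<^bsub>J\<^esub> h \<otimes>\<^bsub>J\<^esub> inv\<^bsub>J\<^esub> x \<in> GK n" by (simp add: GK_def one_J carrier_J)
qed

lemma GK_subgroup: "subgroup (GK n) J"
  using GK_normal normal_imp_subgroup by blast

lemma GK_Suc: "GK (Suc n) \<subseteq> GK n"
  by (auto simp: GK_def jcong_def P_Suc_iff)

lemma GK_mono: "m \<le> n \<Longrightarrow> GK n \<subseteq> GK m"
  by (induction rule: dec_induct) (use GK_Suc in blast)+

lemma P_all_imp_zero: "(\<And>n. f \<in> P n) \<Longrightarrow> f = 0"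
  using P_coeff_0 by (metis fps_ext fps_zero_nth lessI)

lemma GK_Inter: "(\<Inter>n. GK (Suc n)) = {\<one>\<^bsub>J\<^esub>}"
proof (intro equalityI subsetI)
  fix g assume "g \<in> (\<Inter>n. GK (Suc n))"
  then have "g \<in> GK n" for n using GK_Suc[of n] by blast
  then have all: "jcong n g (El 1 0 0 1 0 0 0)" for n by (simp add: GK_def)
  have "ea g - 1 = 0" "eb g - 0 = 0" "ec g - 0 = 0" "ed g - 1 = 0" "ex g - 0 = 0" "ey g - 0 = 0" "ew g - 0 = 0"
    by (rule P_all_imp_zero, use all in \<open>simp add: jcong_def\<close>)+
  then show "g \<in> {\<one>\<^bsub>J\<^esub>}" by (simp add: one_J elt.expand)
qed (auto simp: GK_def one_J one_in_JC)

text \<open>Coefficient \<open>i\<close> is stable from the \<open>i\<close>-th term on, so the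
  diagonal of the sequence is its \<open>t\<close>-adic limit.\<close>

lemma diagonal_limit:
  assumes "\<And>n. f (Suc n) - f n \<in> P (Suc n)"
  shows "Abs_fps (\<lambda>i. f i $ i) - f n \<in> P (Suc n)"
proof -
  have step: "f (m + k) - f m \<in> P (Suc m)" for m k
  proof (induction k)
    case (Suc k)
    have "f (Suc (m + k)) - f (m + k) \<in> P (Suc m)"
      using assms by (rule P_mono[rotated]) simp
    with Suc show ?case using P_diff_trans by simp
  qed simp
  have st: "f i - f m \<in> P (Suc m)" if "m \<le> i" for i m using step[of m "i - m"] that by simp
  show ?thesis
    unfolding P_def
  proof (intro CollectI conjI allI impI)
    fix i
    show "(Abs_fps (\<lambda>i. f i $ i) - f n) $ i \<in> F"
      using P_coeff[OF st[of n i], of i] P_coeff[OF P_diff_swap[OF st[of i n]], of i] by (cases "n \<le> i") auto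
    assume "i < Suc n"
    then show "(Abs_fps (\<lambda>i. f i $ i) - f n) $ i = 0"
      using P_coeff_0[OF st[of i n], of i] by simp
  qed
qed

lemma GK_complete:
  assumes g: "\<And>n. g n \<in> carrier J" and step: "\<And>n. g (Suc n) \<in> GK (Suc n) #>\<^bsub>J\<^esub> g n"
  shows "\<exists>x\<in>carrier J. \<forall>n. x \<in> GK (Suc n) #>\<^bsub>J\<^esub> g n"
proof -
  have gJ: "g n \<in> JC" for n using g by (simp add: carrier_J)
  have co: "jcong (Suc n) (g (Suc n)) (g n)" for n
    using step[of n] subgroup.rcos_module[OF GK_subgroup group_J g g] jcong_iff_GK[OF gJ gJ] by blast
  define L where "L s = Abs_fps (\<lambda>i. s (g i) $ i)" for s :: "'r elt \<Rightarrow> 'r fps"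
  define x where "x = El (L ea) (L eb) (L ec) (L ed) (L ex) (L ey) (L ew)"
  have xc: "jcong (Suc n) x (g n)" for n
    using co unfolding jcong_def x_def L_def by (auto intro!: diagonal_limit[where f = "\<lambda>n. _ (g n)"])
  have "ea x * ed x - eb x * ec x - 1 = 0"
  proof (rule P_all_imp_zero)
    fix n
    have "ea x * ed x - eb x * ec x - (ea (g n) * ed (g n) - eb (g n) * ec (g n)) \<in> P (Suc n)"
      using xc[of n] by (intro P_diff_diff P_diff_mult) (auto simp: jcong_def)
    then show "ea x * ed x - eb x * ec x - 1 \<in> P n" using gJ[of n] by (simp add: JC_def P_Suc_iff)
  qed
  moreover have "restr S (ew x) = ew x"
  proof -
    have "restr S (ew (g n)) = ew (g n)" for n using gJ by (simp add: JC_def)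
    then have "ew (g n) $ n = 0" if "n \<notin> S" for n using that by (metis restr_nth)
    then show ?thesis by (auto simp: fps_eq_iff x_def L_def)
  qed
  moreover have "V \<or> ex x = 0 \<and> ey x = 0"
    using gJ by (auto simp: x_def L_def JC_def fps_eq_iff)
  moreover have "ea x - 1 \<in> P 1" "eb x - 0 \<in> P 1" "ec x - 0 \<in> P 1" "ed x - 1 \<in> P 1"
      "ex x - 0 \<in> P 1" "ey x - 0 \<in> P 1" "ew x - 0 \<in> P 0"
  proof -
    have c: "ea x - ea (g 0) \<in> P 1" "eb x - eb (g 0) \<in> P 1" "ec x - ec (g 0) \<in> P 1"
        "ed x - ed (g 0) \<in> P 1" "ex x - ex (g 0) \<in> P 1" "ey x - ey (g 0) \<in> P 1" "ew x - ew (g 0) \<in> P 0"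
      using xc[of 0] by (simp_all add: jcong_def P_Suc_iff)
    have b: "ea (g 0) - 1 \<in> P 1" "eb (g 0) - 0 \<in> P 1" "ec (g 0) - 0 \<in> P 1" "ed (g 0) - 1 \<in> P 1"
        "ex (g 0) - 0 \<in> P 1" "ey (g 0) - 0 \<in> P 1" "ew (g 0) - 0 \<in> P 0"
      using gJ[of 0] by (simp_all add: JC_def)
    show "ea x - 1 \<in> P 1" "eb x - 0 \<in> P 1" "ec x - 0 \<in> P 1" "ed x - 1 \<in> P 1"
        "ex x - 0 \<in> P 1" "ey x - 0 \<in> P 1" "ew x - 0 \<in> P 0"
      using P_diff_trans[OF c(1) b(1)] P_diff_trans[OF c(2) b(2)] P_diff_trans[OF c(3) b(3)]
        P_diff_trans[OF c(4) b(4)] P_diff_trans[OF c(5) b(5)] P_diff_trans[OF c(6) b(6)]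
        P_diff_trans[OF c(7) b(7)] by blast+
  qed
  ultimately have xJ: "x \<in> JC" by (auto simp: JC_def)
  then have "x \<in> GK (Suc n) #>\<^bsub>J\<^esub> g n" for n
    using subgroup.rcos_module[OF GK_subgroup group_J g, of x] jcong_iff_GK[OF xJ gJ] xc carrier_J by blast
  then show ?thesis using xJ by (auto simp: carrier_J)
qed

section \<open>Index of the congruence subgroups\<close>

definition trunc :: "nat \<Rightarrow> 'r fps \<Rightarrow> nat \<Rightarrow> 'r" where
  "trunc n f i = (if i < n then f $ i else 0)"

definition supported :: "nat set \<Rightarrow> (nat \<Rightarrow> 'r) set" where
  "supported I = {f. (\<forall>i\<in>I. f i \<in> F) \<and> (\<forall>i. i \<notin> I \<longrightarrow> f i = 0)}"

lemma card_supported: 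
  assumes "finite I" shows "card (supported I) = p ^ card I" and "finite (supported I)"
proof -
  let ?h = "\<lambda>f i. if i \<in> I then f i else 0"
  have "supported I = ?h ` (I \<rightarrow>\<^sub>E F)"
  proof (intro equalityI subsetI)
    fix f assume f: "f \<in> supported I"
    then have "f = ?h (restrict f I)" "restrict f I \<in> I \<rightarrow>\<^sub>E F" by (auto simp: supported_def)
    then show "f \<in> ?h ` (I \<rightarrow>\<^sub>E F)" by blast
  qed (auto simp: supported_def PiE_def Pi_def)
  moreover have "inj_on ?h (I \<rightarrow>\<^sub>E F)"
    by (rule inj_onI) (metis (mono_tags, lifting) PiE_ext)
  ultimately have "card (supported I) = card (I \<rightarrow>\<^sub>E F)" "finite (supported I) \<longleftrightarrow> finite (I \<rightarrow>\<^sub>E F)"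
    by (simp_all add: card_image finite_image_iff)
  then show "card (supported I) = p ^ card I" "finite (supported I)"
    using assms by (simp_all add: card_PiE card_F finite_PiE)
qed

lemma trunc_eq_iff: "f - g \<in> P 0 \<Longrightarrow> trunc n f = trunc n g \<longleftrightarrow> f - g \<in> P n"
  by (auto simp: trunc_def P_def fun_eq_iff)

text \<open>Matrix and vector coefficients start at exponent 1, hence \<open>n - 1\<close>; the
  central ones start at 0. The determinant fixes the lower right matrix entry, because the upper
  left one is a unit, which leaves three.\<close>

definition index_exp :: "nat \<Rightarrow> nat" where
  "index_exp n = 3 * (n - 1) + (if V then 2 * (n - 1) else 0) + card (S \<inter> {..<n})"

lemma GK_index:
  assumes n: "n \<ge> 1"
  shows "card (rcosets\<^bsub>J\<^esub> (GK n)) = p ^ index_exp n"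
proof -
  define \<tau> where "\<tau> g = (trunc n (ea g - 1), trunc n (eb g), trunc n (ec g), trunc n (ex g), trunc n (ey g), trunc n (ew g))" for g
  define I1 where "I1 = {1..<n}"
  define I2 where "I2 = (if V then {1..<n} else {})"
  define I3 where "I3 = S \<inter> {..<n}"
  have P0: "f \<in> P 0" if "f \<in> P m" for f m using that by (rule P_mono[rotated]) simp
  have \<tau>: "\<tau> g = \<tau> h \<longleftrightarrow> jcong n g h" if gh: "g \<in> JC" "h \<in> JC" for g h
  proof -
    have 1: "(ea g - 1) - (ea h - 1) \<in> P 1" "eb g - eb h \<in> P 1" "ec g - ec h \<in> P 1"
        "ex g - ex h \<in> P 1" "ey g - ey h \<in> P 1"
      by (rule P_diff; use gh in \<open>simp add: JC_def\<close>)+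
    have "ew g - ew h \<in> P 0" by (rule P_diff; use gh in \<open>simp add: JC_def\<close>)
    note 0 = 1[THEN P0] this
    have d: "ed g - ed h \<in> P n" if "ea g - ea h \<in> P n" "eb g - eb h \<in> P n" "ec g - ec h \<in> P n"
    proof -
      have det: "ea g * ed g = 1 + eb g * ec g" "ea h * ed h = 1 + eb h * ec h"
        using gh by (auto simp: JC_def algebra_simps)
      have "(eb g * ec g - eb h * ec h) - (ea g - ea h) * ed h \<in> P n"
        by (rule P_diff[OF P_diff_mult[OF that(2,3)] P_mult_right[OF that(1)]])
      moreover have "(eb g * ec g - eb h * ec h) - (ea g - ea h) * ed h = ea g * (ed g - ed h)"
        using det by (simp add: algebra_simps)
      ultimately have k: "ea g * (ed g - ed h) \<in> P n" by simp
      have "ea g - 1 \<in> P 1" using gh by (simp add: JC_def)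
      then obtain v where "ea g * v = 1" by (rule P_unit_inverse) auto
      then have "ed g - ed h = v * (ea g * (ed g - ed h))" by (metis mult.assoc mult.commute mult_1)
      then show ?thesis using k P_mult_left by metis
    qed
    have "\<tau> g = \<tau> h \<longleftrightarrow> (ea g - 1) - (ea h - 1) \<in> P n \<and> eb g - eb h \<in> P n \<and> ec g - ec h \<in> P n \<and>
        ex g - ex h \<in> P n \<and> ey g - ey h \<in> P n \<and> ew g - ew h \<in> P n"
      unfolding \<tau>_def using 0 by (simp add: trunc_eq_iff)
    then show ?thesis using d by (auto simp: jcong_def)
  qed
  have "\<tau> ` JC = supported I1 \<times> supported I1 \<times> supported I1 \<times> supported I2 \<times> supported I2 \<times> supported I3"
  proof (intro equalityI subsetI)
    fix t assume "t \<in> \<tau> ` JC"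
    then obtain g where g: "g \<in> JC" "t = \<tau> g" by blast
    have s1: "trunc n f \<in> supported I1" if "f \<in> P 1" for f
      using that by (auto simp: trunc_def supported_def I1_def P_def Suc_le_eq)
    have s2: "trunc n f \<in> supported I2" if "f \<in> P 1" "V \<or> f = 0" for f
      using that by (auto simp: trunc_def supported_def I2_def P_def Suc_le_eq)
    have s3: "trunc n f \<in> supported I3" if "f \<in> P 0" "restr S f = f" for f
    proof -
      have "f $ i = 0" if "i \<notin> S" for i using that \<open>restr S f = f\<close> by (metis restr_nth)
      then show ?thesis using that by (auto simp: trunc_def supported_def I3_def P_def)
    qed
    show "t \<in> supported I1 \<times> supported I1 \<times> supported I1 \<times> supported I2 \<times> supported I2 \<times> supported I3"
      using g s1 s2 s3 by (auto simp: \<tau>_def JC_def)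
  next
    fix t assume "t \<in> supported I1 \<times> supported I1 \<times> supported I1 \<times> supported I2 \<times> supported I2 \<times> supported I3"
    then obtain f1 f2 f3 f4 f5 f6 where t: "t = (f1, f2, f3, f4, f5, f6)"
      and f: "f1 \<in> supported I1" "f2 \<in> supported I1" "f3 \<in> supported I1" "f4 \<in> supported I2"
        "f5 \<in> supported I2" "f6 \<in> supported I3" by auto
    have fP1: "Abs_fps f \<in> P 1" if "f \<in> supported I1 \<or> f \<in> supported I2" for f
      using that by (auto simp: supported_def P_def I1_def I2_def)
    have fP0: "Abs_fps f6 \<in> P 0" using f(6) by (auto simp: supported_def P_def)
    have r6: "restr S (Abs_fps f6) = Abs_fps f6" using f(6) by (auto simp: fps_eq_iff supported_def I3_def)
    have V0: "V \<or> Abs_fps f4 = 0 \<and> Abs_fps f5 = 0"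
      using f by (auto simp: I2_def supported_def fps_eq_iff)
    define a where "a = 1 + Abs_fps f1"
    have a: "a - 1 \<in> P 1" using fP1 f by (simp add: a_def)
    then obtain v where v: "a * v = 1" "v - 1 \<in> P 1" by (rule P_unit_inverse) auto
    define g where "g = El a (Abs_fps f2) (Abs_fps f3) ((1 + Abs_fps f2 * Abs_fps f3) * v) (Abs_fps f4) (Abs_fps f5) (Abs_fps f6)"
    have "a * ((1 + Abs_fps f2 * Abs_fps f3) * v) = 1 + Abs_fps f2 * Abs_fps f3"
      using v(1) by (metis mult.assoc mult.commute mult_1)
    moreover have "(1 + Abs_fps f2 * Abs_fps f3) * v - 1 \<in> P 1"
      using f fP1 by (intro unit_mult_P v) (auto intro: P_mult_right)
    ultimately have "g \<in> JC" using a f fP1 fP0 r6 V0 by (auto simp: g_def JC_def)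
    moreover have "trunc n (Abs_fps f) = f" if "f \<in> supported I1 \<or> f \<in> supported I2 \<or> f \<in> supported I3" for f
      using that by (auto simp: trunc_def supported_def I1_def I2_def I3_def fun_eq_iff split: if_splits)
    then have "\<tau> g = t" using f by (simp add: \<tau>_def g_def t a_def)
    ultimately show "t \<in> \<tau> ` JC" by blast
  qed
  then have "card (\<tau> ` JC) = p ^ card I1 * (p ^ card I1 * (p ^ card I1 * (p ^ card I2 * (p ^ card I2 * p ^ card I3))))"
    by (simp add: card_cartesian_product card_supported I1_def I2_def I3_def)
  also have "\<dots> = p ^ index_exp n"
    unfolding power_add[symmetric]
    by (rule arg_cong[of _ _ "\<lambda>k. p ^ k"]) (simp add: index_exp_def I1_def I2_def I3_def)
  finally have card: "card (\<tau> ` JC) = p ^ index_exp n" .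
  define q where "q x = GK n #>\<^bsub>J\<^esub> x" for x
  have q: "q g = q h \<longleftrightarrow> \<tau> g = \<tau> h" if "g \<in> JC" "h \<in> JC" for g h
    unfolding q_def using J.rcos_eq_iff[OF GK_subgroup] jcong_iff_GK \<tau> that by (simp add: carrier_J)
  have "card (q ` JC) = card (\<tau> ` JC)" using q by (rule card_image_same_kernel)
  then show ?thesis using card by (simp add: J.rcosets_eq_image q_def carrier_J)
qed

lemma GK_finite_index: "n \<ge> 1 \<Longrightarrow> finite (rcosets\<^bsub>J\<^esub> (GK n))"
  using GK_index[of n] prime p_gt_2 by (intro card_ge_0_finite) simp

end

subsection \<open>Subgroups of index \<open>p\<^sup>k\<close> contain a congruence subgroup of level \<open>O(k)\<close>\<close>

context prime_idem
begin

lemma P_pow_nth: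
  assumes "f \<in> P n"
  shows "f ^ Suc i \<in> P (n * Suc i)" and "(f ^ Suc i) $ (n * Suc i) = (f $ n) ^ Suc i"
proof -
  have "f ^ Suc i \<in> P (n * Suc i) \<and> (f ^ Suc i) $ (n * Suc i) = (f $ n) ^ Suc i"
  proof (induction i)
    case (Suc i)
    then show ?case
      using P_mult[OF assms, of "f ^ Suc i" "n * Suc i"] P_mult_nth[OF assms, of "f ^ Suc i" "n * Suc i"]
      by simp
  qed (use assms in simp)
  then show "f ^ Suc i \<in> P (n * Suc i)" and "(f ^ Suc i) $ (n * Suc i) = (f $ n) ^ Suc i" by auto
qed

lemma F_pow_nz: "x \<in> F \<Longrightarrow> x \<noteq> 0 \<Longrightarrow> x ^ Suc i \<noteq> 0"
proof (induction i)
  case (Suc i)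
  then have "x ^ Suc i \<noteq> 0" "x ^ Suc i \<in> F" by (auto intro: F_mult)
  then show ?case using Suc(2,3) F_no_zero_div[of x "x ^ Suc i"] by auto
qed simp

text \<open>The ring of multipliers of \<open>E\<close> need not be closed. A power of one multiplier acts on the finite
  quotient like a higher power, which produces an open ideal inside \<open>E\<close>.\<close>

lemma few_gaps_imp_ideal:
  assumes E: "E \<subseteq> P 1" and diff: "\<And>f g. f \<in> E \<Longrightarrow> g \<in> E \<Longrightarrow> f - g \<in> E"
    and Y: "finite Y" "Y \<subseteq> P 1" "\<And>f. f \<in> P 1 \<Longrightarrow> \<exists>y\<in>Y. f - y \<in> E"
    and gapE: "finite {n. n \<ge> 1 \<and> \<not> (\<exists>f\<in>E. f \<in> P n \<and> f $ n \<noteq> 0)}"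
      "card {n. n \<ge> 1 \<and> \<not> (\<exists>f\<in>E. f \<in> P n \<and> f $ n \<noteq> 0)} \<le> k"
    and gapR: "finite {n. n \<ge> 1 \<and> \<not> (\<exists>r\<in>P n. r $ n \<noteq> 0 \<and> (\<forall>f\<in>E. r * f \<in> E))}"
      "card {n. n \<ge> 1 \<and> \<not> (\<exists>r\<in>P n. r $ n \<noteq> 0 \<and> (\<forall>f\<in>E. r * f \<in> E))} \<le> k"
  shows "P (2 * k + 2) \<subseteq> E"
proof -
  define GE where "GE = {n. n \<ge> 1 \<and> \<not> (\<exists>f\<in>E. f \<in> P n \<and> f $ n \<noteq> 0)}"
  define GR where "GR = {n. n \<ge> 1 \<and> \<not> (\<exists>r\<in>P n. r $ n \<noteq> 0 \<and> (\<forall>f\<in>E. r * f \<in> E))}"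
  have GE: "finite GE" "card GE \<le> k" and GR: "finite GR" "card GR \<le> k"
    using gapE gapR by (auto simp: GE_def GR_def)
  obtain y0 where "y0 \<in> Y" "0 - y0 \<in> E" using Y(3)[of 0] by auto
  then have zero: "0 \<in> E" using diff[of "0 - y0" "0 - y0"] by simp
  have uminus: "- f \<in> E" if "f \<in> E" for f using diff[OF zero that] by simp
  have add: "f + g \<in> E" if "f \<in> E" "g \<in> E" for f g using diff[OF that(1) uminus[OF that(2)]] by simp
  have smult: "of_nat j * f \<in> E" if "f \<in> E" for j f
    using that by (induction j) (auto simp: zero algebra_simps intro: add)
  \<comment> \<open>Of the \<open>n - 1 \<ge> 2 * k + 1\<close> splittings
    \<open>n = i + (n - i)\<close>, at most \<open>2 * k\<close> hit a gap of the multipliers at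
    \<open>i\<close> or of \<open>E\<close> at \<open>n - i\<close>. A remaining one gives a
    multiplier and an element of \<open>E\<close> whose product has valuation exactly
    \<open>n\<close>.\<close>
  have val: "\<exists>f\<in>E. f \<in> P n \<and> f $ n \<noteq> 0" if n: "n \<ge> 2 * k + 2" for n
  proof -
    define B where "B = (GR \<inter> {1..<n}) \<union> ((\<lambda>i. n - i) ` (GE \<inter> {1..<n}))"
    have "card B \<le> card (GR \<inter> {1..<n}) + card ((\<lambda>i. n - i) ` (GE \<inter> {1..<n}))"
      unfolding B_def by (rule card_Un_le)
    also have "\<dots> \<le> card GR + card GE"
      using GE GR by (intro add_mono order.trans[OF card_image_le] card_mono) auto
    also have "\<dots> < card {1..<n}" using GE GR n by simp
    finally have "\<not> {1..<n} \<subseteq> B" using card_mono[of B "{1..<n}"] by (auto simp: B_def)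
    then obtain i where "i \<in> {1..<n}" "i \<notin> B" by (meson subsetI)
    then have i: "1 \<le> i" "i < n" "i \<notin> B" by auto
    have "i \<notin> GR" using i by (auto simp: B_def)
    moreover have "n - i \<notin> GE"
    proof
      assume "n - i \<in> GE"
      moreover have "i = n - (n - i)" "n - i \<in> {1..<n}" using i by auto
      ultimately have "i \<in> B" unfolding B_def by blast
      then show False using i by simp
    qed
    ultimately obtain r f where rf: "r \<in> P i" "r $ i \<noteq> 0" "\<forall>f\<in>E. r * f \<in> E"
        "f \<in> E" "f \<in> P (n - i)" "f $ (n - i) \<noteq> 0"
      using i by (auto simp: GR_def GE_def)
    have "r * f \<in> P n" "(r * f) $ n = r $ i * f $ (n - i)"
      using P_mult[OF rf(1,5)] P_mult_nth[OF rf(1,5)] i by auto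
    moreover have "r $ i * f $ (n - i) \<noteq> 0" using F_no_zero_div P_coeff rf by metis
    ultimately show ?thesis using rf by (intro bexI[of _ "r * f"]) auto
  qed
  obtain a where a: "a \<ge> 1" "a \<notin> GR"
  proof -
    have "\<not> {1..} \<subseteq> GR" using GR(1) infinite_Ici[of "1::nat"] finite_subset by blast
    then show thesis using that by auto
  qed
  then obtain r where r: "r \<in> P a" "r $ a \<noteq> 0" "\<forall>f\<in>E. r * f \<in> E" by (auto simp: GR_def)
  have pow: "r ^ i * f \<in> E" if "f \<in> E" for i f
    using that by (induction i) (auto simp: mult.assoc r(3))
  \<comment> \<open>Multiplication by a power of \<open>r\<close> preserves \<open>E\<close>, so it
    is recorded by a self-map of the finite set \<open>Y\<close> of representatives of
    \<open>P 1\<close> modulo \<open>E\<close>. Two powers give the same map, and their difference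
    \<open>s\<close> sends all of \<open>P 1\<close> into \<open>E\<close>.\<close>
  define c where "c i y = (SOME y'. y' \<in> Y \<and> r ^ Suc i * y - y' \<in> E)" for i y
  have c: "c i y \<in> Y" "r ^ Suc i * y - c i y \<in> E" if "y \<in> Y" for i y
  proof -
    have "y \<in> P 1" using that Y(2) by blast
    then have "r ^ Suc i * y \<in> P 1" by (rule P_mult_left)
    then have "\<exists>y'. y' \<in> Y \<and> r ^ Suc i * y - y' \<in> E" using Y(3) by blast
    then have "c i y \<in> Y \<and> r ^ Suc i * y - c i y \<in> E" unfolding c_def by (rule someI_ex)
    then show "c i y \<in> Y" "r ^ Suc i * y - c i y \<in> E" by auto
  qed
  have "range (\<lambda>i. restrict (c i) Y) \<subseteq> Y \<rightarrow>\<^sub>E Y" using c by auto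
  then have "finite (range (\<lambda>i. restrict (c i) Y))"
    using finite_PiE[OF Y(1), of "\<lambda>_. Y"] Y(1) finite_subset by blast
  then have "\<not> inj (\<lambda>i. restrict (c i) Y)" using finite_imageD infinite_UNIV_nat by blast
  then obtain i j where ij: "i < j" "restrict (c i) Y = restrict (c j) Y"
    unfolding inj_on_def by (metis linorder_neqE_nat)
  define s where "s = r ^ Suc i - r ^ Suc j"
  have sE: "s * f \<in> E" if f: "f \<in> P 1" for f
  proof -
    obtain y where y: "y \<in> Y" "f - y \<in> E" using Y(3)[OF f] by blast
    have cc: "c i y = c j y" using ij(2) y(1) by (metis restrict_apply')
    have "(r ^ Suc i * y - c i y) - (r ^ Suc j * y - c j y) \<in> E" using c y diff by blast
    moreover have "r ^ Suc i * (f - y) - r ^ Suc j * (f - y) \<in> E" using pow[OF y(2)] diff by blast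
    ultimately have "(r ^ Suc i * y - c i y) - (r ^ Suc j * y - c j y) +
        (r ^ Suc i * (f - y) - r ^ Suc j * (f - y)) \<in> E" by (rule add)
    moreover have "(r ^ Suc i * y - c i y) - (r ^ Suc j * y - c j y) +
        (r ^ Suc i * (f - y) - r ^ Suc j * (f - y)) = s * f"
      unfolding s_def cc by (simp only: left_diff_distrib right_diff_distrib) simp
    ultimately show ?thesis by simp
  qed
  \<comment> \<open>The lower power decides the valuation of \<open>s\<close>, so the multiples of
    \<open>s\<close> by series in \<open>P 1\<close> fill the ideal
    \<open>P (M + 1)\<close>.\<close>
  define M where "M = a * Suc i"
  have lt: "M < a * Suc j" using ij a by (simp add: M_def)
  have "r ^ Suc j \<in> P (Suc M)" using P_pow_nth(1)[OF r(1), of j] lt by (intro P_mono[of "Suc M" "a * Suc j"]) auto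
  then have rj: "r ^ Suc j \<in> P M" "(r ^ Suc j) $ M = 0" by (auto simp: P_Suc_iff)
  have ri: "r ^ Suc i \<in> P M" "(r ^ Suc i) $ M \<noteq> 0"
    unfolding M_def P_pow_nth(2)[OF r(1)]
    using P_pow_nth(1)[OF r(1)] F_pow_nz[OF P_coeff[OF r(1)] r(2)] by blast+
  have s: "s \<in> P M" "s $ M \<noteq> 0"
    unfolding s_def fps_sub_nth rj(2) using P_diff[OF ri(1) rj(1)] ri(2) by simp_all
  have top: "P (M + 1) \<subseteq> E"
  proof
    fix f assume "f \<in> P (M + 1)"
    then obtain h where "h \<in> P 1" "f = s * h" by (rule P_divide[OF s])
    then show "f \<in> E" using sE by simp
  qed
  \<comment> \<open>No bound on \<open>M\<close> in terms of \<open>k\<close> is at hand. Descending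
    from it, elements of \<open>E\<close> with prescribed valuation cancel leading terms down to
    level \<open>2 * k + 2\<close>.\<close>
  have "P (2 * k + 2) \<subseteq> E" if le: "2 * k + 2 \<le> M + 1"
    using le
  proof (induction rule: inc_induct)
    case base
    show ?case by (rule top)
  next
    case (step n)
    show ?case
    proof
      fix f assume f: "f \<in> P n"
      obtain g where g: "g \<in> E" "g \<in> P n" "g $ n \<noteq> 0" using val step by auto
      obtain j :: nat where "f - of_nat j * g \<in> P (Suc n)" by (rule P_reduce[OF f g(2,3)])
      then have "f - of_nat j * g \<in> E" using step by blast
      then have "f - of_nat j * g + of_nat j * g \<in> E" using smult g(1) add by blast
      then show "f \<in> E" by simp
    qed
  qed
  moreover have "P (2 * k + 2) \<subseteq> E" if "\<not> 2 * k + 2 \<le> M + 1"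
    using that top P_mono[of "M + 1" "2 * k + 2"] by auto
  ultimately show ?thesis by blast
qed

end

context jacobi
begin

lemma JC_carrier: "g \<in> JC \<Longrightarrow> g \<in> carrier J"
  by (simp add: carrier_J)

text \<open>A set of \<open>k + 1\<close> gaps carries \<open>p^(k + 1)\<close> series, more than
  there are cosets of \<open>H\<close>. Two series whose values share a coset have a difference
  whose valuation is a gap, and \<open>quot\<close> then contradicts the choice of gaps. The
  hypothesis \<open>quot\<close> controls only leading terms, which lets the torus be treated like
  the additive one-parameter subgroups.\<close>

lemma few_gaps:
  assumes H: "subgroup H J" "finite (rcosets\<^bsub>J\<^esub> H)" "card (rcosets\<^bsub>J\<^esub> H) \<le> p ^ k"
    and \<theta>: "\<And>f. f \<in> P 1 \<Longrightarrow> \<theta> f \<in> JC"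
    and quot: "\<And>f g n. f \<in> P 1 \<Longrightarrow> g \<in> P 1 \<Longrightarrow> f - g \<in> P n \<Longrightarrow> (f - g) $ n \<noteq> 0 \<Longrightarrow>
        \<exists>h\<in>P n. h $ n \<noteq> 0 \<and> \<theta> f \<otimes>\<^bsub>J\<^esub> inv\<^bsub>J\<^esub> (\<theta> g) = \<theta> h"
  shows "finite {n. n \<ge> 1 \<and> \<not> (\<exists>f\<in>P n. f $ n \<noteq> 0 \<and> \<theta> f \<in> H)}"
    and "card {n. n \<ge> 1 \<and> \<not> (\<exists>f\<in>P n. f $ n \<noteq> 0 \<and> \<theta> f \<in> H)} \<le> k"
proof -
  let ?G = "{n. n \<ge> 1 \<and> \<not> (\<exists>f\<in>P n. f $ n \<noteq> 0 \<and> \<theta> f \<in> H)}"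
  have "card N \<le> k" if N: "N \<subseteq> ?G" "finite N" for N
  proof (rule ccontr)
    assume "\<not> card N \<le> k"
    then have "p ^ k < p ^ card N" using p_gt_2 by (intro power_strict_increasing) auto
    then have "card (rcosets\<^bsub>J\<^esub> H) < card (supported N)" using H(3) card_supported[OF N(2)] by simp
    moreover have NP: "Abs_fps c \<in> P 1" if "c \<in> supported N" for c
      using that N(1) by (force simp: supported_def P_def)
    ultimately obtain c c' where c: "c \<in> supported N" "c' \<in> supported N" "c \<noteq> c'"
      and mem: "\<theta> (Abs_fps c) \<otimes>\<^bsub>J\<^esub> inv\<^bsub>J\<^esub> (\<theta> (Abs_fps c')) \<in> H"
      using J.coset_pigeonhole[OF H(1,2), of "supported N" "\<lambda>c. \<theta> (Abs_fps c)"] \<theta> JC_carrier by metis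
    define d where "d = Abs_fps c - Abs_fps c'"
    obtain i where "c i \<noteq> c' i" using c by blast
    then have dn: "d \<notin> P (Suc i)" by (auto simp: d_def P_def)
    have dP: "d \<in> P 1" unfolding d_def using NP c by (intro P_diff)
    obtain n where n: "1 \<le> n" "n < Suc i" "d \<in> P n" "d $ n \<noteq> 0" by (rule P_val[OF dP dn])
    then have "n \<in> N" using c by (auto simp: d_def supported_def)
    moreover obtain h where "h \<in> P n" "h $ n \<noteq> 0" "\<theta> h \<in> H"
      using quot[OF NP[OF c(1)] NP[OF c(2)] n(3,4)[unfolded d_def]] mem by metis
    ultimately show False using N(1) by blast
  qed
  then have "finite ?G \<and> card ?G \<le> k" by (intro finite_if_finite_subsets_card_bdd)
  then show "finite ?G" "card ?G \<le> k" by auto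
qed

section \<open>The torus and the one-parameter subgroups\<close>

definition tor :: "'r fps \<Rightarrow> 'r elt" where
  "tor f = El (1 + f) 0 0 (fps_right_inverse (1 + f) 1) 0 0 0"

lemma inverse_unique:
  assumes "(u :: 'r fps) * v = 1" "u * v' = 1"
  shows "v = v'"
proof -
  have "v = (u * v') * v" using assms by simp
  also have "\<dots> = v' * (u * v)" by (simp only: ac_simps)
  finally show ?thesis using assms by simp
qed

lemma tor_inverse:
  assumes "f \<in> P n" "n \<ge> 1"
  shows "(1 + f) * fps_right_inverse (1 + f) 1 = 1" and "fps_right_inverse (1 + f) 1 - 1 \<in> P n"
proof -
  have "f $ 0 = 0" using P_coeff_0[OF assms(1)] assms(2) by simp
  then show 1: "(1 + f) * fps_right_inverse (1 + f) 1 = 1" by (intro fps_right_inverse) simp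
  have "1 + f - 1 \<in> P n" using assms(1) by simp
  then obtain v where v: "(1 + f) * v = 1" "v - 1 \<in> P n" using assms(2) by (rule P_unit_inverse)
  have "v = fps_right_inverse (1 + f) 1" by (rule inverse_unique[OF v(1) 1])
  then show "fps_right_inverse (1 + f) 1 - 1 \<in> P n" using v by simp
qed

lemma tor_JC: "f \<in> P 1 \<Longrightarrow> tor f \<in> JC"
  using tor_inverse[of f 1] by (simp add: tor_def JC_def)

lemma tor_eqI: "(1 + f) * v = 1 \<Longrightarrow> f \<in> P 1 \<Longrightarrow> El (1 + f) 0 0 v 0 0 0 = tor f"
  using tor_inverse[of f 1] inverse_unique by (simp add: tor_def)

text \<open>\<open>(1 + f) / (1 + g) = 1 + (f - g) / (1 + g)\<close>, and division by
  \<open>1 + g\<close> does not change the leading term of \<open>f - g\<close>.\<close>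

lemma tor_quot:
  assumes "f \<in> P 1" "g \<in> P 1" "f - g \<in> P n" "(f - g) $ n \<noteq> 0"
  shows "\<exists>h\<in>P n. h $ n \<noteq> 0 \<and> tor f \<otimes>\<^bsub>J\<^esub> inv\<^bsub>J\<^esub> (tor g) = tor h"
proof -
  define vf where "vf = fps_right_inverse (1 + f) 1"
  define vg where "vg = fps_right_inverse (1 + g) 1"
  have vf: "(1 + f) * vf = 1" and vg: "(1 + g) * vg = 1" "vg - 1 \<in> P 1"
    using tor_inverse[of f 1] tor_inverse[of g 1] assms by (auto simp: vf_def vg_def)
  define h where "h = (f - g) * vg"
  have hn: "h = (f - g) + (f - g) * (vg - 1)" by (simp add: h_def algebra_simps)
  have "(f - g) * (vg - 1) \<in> P (Suc n)" using P_mult[OF assms(3) vg(2)] by simp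
  then have h: "h \<in> P n" "h $ n \<noteq> 0" using assms by (auto simp: hn P_Suc_iff intro: P_add)
  have n1: "n \<ge> 1"
    using assms(4) P_coeff_0[OF P_diff[OF assms(1,2)], of n] by (cases "n = 0") auto
  have h1: "h \<in> P 1" by (rule P_mono[OF n1 h(1)])
  have "1 + h = (1 + g) * vg + (f - g) * vg" by (simp add: vg h_def)
  also have "\<dots> = (1 + f) * vg" by (simp add: algebra_simps)
  finally have 1: "1 + h = (1 + f) * vg" .
  then have "(1 + h) * (vf * (1 + g)) = ((1 + f) * vf) * ((1 + g) * vg)" by (simp only: ac_simps)
  then have "(1 + h) * (vf * (1 + g)) = 1" by (simp add: vf vg)
  from tor_eqI[OF this h1]
  have "tor f \<otimes>\<^bsub>J\<^esub> inv\<^bsub>J\<^esub> (tor g) = tor h"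
    using inv_J[OF tor_JC[OF assms(2)]] 1
    by (simp add: mult_J jmult_def jinv_def tor_def[of f] tor_def[of g] vf_def vg_def)
  then show ?thesis using h by blast
qed

text \<open>The torus part of \<open>H\<close> acts on an additive one-parameter subgroup by the multipliers \<open>1 + \<mu> t\<close>.\<close>

lemma one_parameter_level:
  assumes H: "subgroup H J" "finite (rcosets\<^bsub>J\<^esub> H)" "card (rcosets\<^bsub>J\<^esub> H) \<le> p ^ k"
    and \<theta>: "\<And>f. f \<in> P 1 \<Longrightarrow> \<theta> f \<in> JC"
    and quot: "\<And>f g. f \<in> P 1 \<Longrightarrow> g \<in> P 1 \<Longrightarrow> \<theta> f \<otimes>\<^bsub>J\<^esub> inv\<^bsub>J\<^esub> (\<theta> g) = \<theta> (f - g)"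
    and \<mu>: "\<And>t n. t \<in> P n \<Longrightarrow> n \<ge> 1 \<Longrightarrow> t $ n \<noteq> 0 \<Longrightarrow> \<mu> t \<in> P n \<and> \<mu> t $ n \<noteq> 0"
    and act: "\<And>t f. t \<in> P 1 \<Longrightarrow> f \<in> P 1 \<Longrightarrow> tor t \<in> H \<Longrightarrow> \<theta> f \<in> H \<Longrightarrow> \<theta> (f + \<mu> t * f) \<in> H"
    and f: "f \<in> P (2 * k + 2)"
  shows "\<theta> f \<in> H"
proof -
  define E where "E = {f \<in> P 1. \<theta> f \<in> H}"
  have diff: "f - g \<in> E" if "f \<in> E" "g \<in> E" for f g
  proof -
    have "\<theta> f \<otimes>\<^bsub>J\<^esub> inv\<^bsub>J\<^esub> (\<theta> g) \<in> H"
      using that subgroup.m_closed[OF H(1)] subgroup.m_inv_closed[OF H(1)] by (auto simp: E_def)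
    then show ?thesis using that quot P_diff by (auto simp: E_def)
  qed
  have P0: "P n \<subseteq> P 1" if "n \<ge> 1" for n using P_mono[OF that] by blast
  have gap1: "{n. n \<ge> 1 \<and> \<not> (\<exists>f\<in>E. f \<in> P n \<and> f $ n \<noteq> 0)}
     = {n. n \<ge> 1 \<and> \<not> (\<exists>f\<in>P n. f $ n \<noteq> 0 \<and> \<theta> f \<in> H)}"
    using P0 by (auto simp: E_def)
  have q: "\<exists>h\<in>P n. h $ n \<noteq> 0 \<and> \<theta> f \<otimes>\<^bsub>J\<^esub> inv\<^bsub>J\<^esub> (\<theta> g) = \<theta> h"
    if "f \<in> P 1" "g \<in> P 1" "f - g \<in> P n" "(f - g) $ n \<noteq> 0" for f g n
    using quot[OF that(1,2)] that(3,4) by blast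
  note gE = few_gaps[OF H \<theta> q, folded gap1]
  note gT = few_gaps[OF H tor_JC tor_quot]
  \<comment> \<open>If \<open>tor t\<close> is in \<open>H\<close>, subtracting \<open>f\<close>
    from \<open>f + \<mu> t * f\<close> shows that \<open>\<mu> t\<close> is a multiplier of
    \<open>E\<close>; so every gap of the multipliers is a gap of the torus.\<close>
  have sub: "{n. n \<ge> 1 \<and> \<not> (\<exists>r\<in>P n. r $ n \<noteq> 0 \<and> (\<forall>f\<in>E. r * f \<in> E))}
      \<subseteq> {n. n \<ge> 1 \<and> \<not> (\<exists>f\<in>P n. f $ n \<noteq> 0 \<and> tor f \<in> H)}"
  proof clarify
    fix n t assume n: "1 \<le> n" and t: "t \<in> P n" "t $ n \<noteq> 0" "tor t \<in> H"
      and none: "\<not> (\<exists>r\<in>P n. r $ n \<noteq> 0 \<and> (\<forall>f\<in>E. r * f \<in> E))"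
    have "\<mu> t * f \<in> E" if fE: "f \<in> E" for f
    proof -
      have "f \<in> P 1" using fE by (simp add: E_def)
      moreover from this have "f + \<mu> t * f \<in> P 1" by (intro P_add P_mult_left)
      ultimately have "f + \<mu> t * f \<in> E" using act[of t f] t P0[OF n] fE by (auto simp: E_def)
      then show ?thesis using diff[OF _ fE] by fastforce
    qed
    then show False using \<mu>[OF t(1) n t(2)] none by blast
  qed
  obtain Y where Y: "finite Y" "Y \<subseteq> P 1" "\<And>f. f \<in> P 1 \<Longrightarrow> \<exists>y\<in>Y. f - y \<in> E"
  proof -
    let ?q = "\<lambda>f. H #>\<^bsub>J\<^esub> \<theta> f"
    have "?q ` P 1 \<subseteq> rcosets\<^bsub>J\<^esub> H"
      using \<theta> by (auto simp: J.rcosets_eq_image carrier_J)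
    then have fin: "finite (?q ` P 1)" using H(2) finite_subset by blast
    define Y where "Y = inv_into (P 1) ?q ` (?q ` P 1)"
    have "\<exists>y\<in>Y. f - y \<in> E" if fP: "f \<in> P 1" for f
    proof -
      define y where "y = inv_into (P 1) ?q (?q f)"
      have y: "y \<in> P 1" "?q y = ?q f"
        unfolding y_def using inv_into_into[of "?q f" ?q "P 1"] f_inv_into_f[of "?q f" ?q "P 1"] fP by blast+
      then have "\<theta> f \<otimes>\<^bsub>J\<^esub> inv\<^bsub>J\<^esub> (\<theta> y) \<in> H"
        using J.rcos_eq_iff[OF H(1), of "\<theta> f" "\<theta> y"] \<theta> fP by (auto simp: carrier_J)
      then have "f - y \<in> E" using quot[OF fP y(1)] P_diff[OF fP y(1)] by (simp add: E_def)
      moreover have "y \<in> Y" unfolding y_def Y_def using fP by blast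
      ultimately show ?thesis by blast
    qed
    moreover have "Y \<subseteq> P 1" unfolding Y_def by (auto intro: inv_into_into)
    moreover have "finite Y" unfolding Y_def using fin by (rule finite_imageI)
    ultimately show thesis using that by blast
  qed
  have "P (2 * k + 2) \<subseteq> E"
  proof (rule few_gaps_imp_ideal[OF _ diff Y gE])
    show "finite {n. n \<ge> 1 \<and> \<not> (\<exists>r\<in>P n. r $ n \<noteq> 0 \<and> (\<forall>f\<in>E. r * f \<in> E))}"
      using finite_subset[OF sub gT(1)] .
    show "card {n. n \<ge> 1 \<and> \<not> (\<exists>r\<in>P n. r $ n \<noteq> 0 \<and> (\<forall>f\<in>E. r * f \<in> E))} \<le> k"
      using card_mono[OF gT(1) sub] gT(2) by simp
  qed (auto simp: E_def)
  then show ?thesis using f by (auto simp: E_def)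
qed

definition "upp f = El 1 f 0 1 0 0 (0 :: 'r fps)"
definition "low f = El 1 0 f 1 0 0 (0 :: 'r fps)"
definition "vec1 f = El 1 0 0 1 f 0 (0 :: 'r fps)"
definition "vec2 f = El 1 0 0 1 0 f (0 :: 'r fps)"
definition "cen f = El 1 0 0 1 0 0 (f :: 'r fps)"

lemma upp_JC: "f \<in> P 1 \<Longrightarrow> upp f \<in> JC" and low_JC: "f \<in> P 1 \<Longrightarrow> low f \<in> JC"
  and vec1_JC: "f \<in> P 1 \<Longrightarrow> V \<Longrightarrow> vec1 f \<in> JC" and vec2_JC: "f \<in> P 1 \<Longrightarrow> V \<Longrightarrow> vec2 f \<in> JC"
  and cen_JC: "f \<in> P 0 \<Longrightarrow> restr S f = f \<Longrightarrow> cen f \<in> JC"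
  unfolding JC_def upp_def low_def vec1_def vec2_def cen_def by simp_all

lemma upp_quot: "g \<in> P 1 \<Longrightarrow> upp f \<otimes>\<^bsub>J\<^esub> inv\<^bsub>J\<^esub> (upp g) = upp (f - g)"
  and low_quot: "g \<in> P 1 \<Longrightarrow> low f \<otimes>\<^bsub>J\<^esub> inv\<^bsub>J\<^esub> (low g) = low (f - g)"
  by (simp_all only: mult_J inv_J[OF upp_JC] inv_J[OF low_JC])
    (simp_all add: upp_def low_def jmult_def jinv_def)

lemma vec_quot:
  assumes "g \<in> P 1" V
  shows "vec1 f \<otimes>\<^bsub>J\<^esub> inv\<^bsub>J\<^esub> (vec1 g) = vec1 (f - g)" "vec2 f \<otimes>\<^bsub>J\<^esub> inv\<^bsub>J\<^esub> (vec2 g) = vec2 (f - g)"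
  unfolding mult_J inv_J[OF vec1_JC[OF assms]] inv_J[OF vec2_JC[OF assms]]
  by (simp_all add: vec1_def vec2_def jmult_def jinv_def)

text \<open>The torus acts on the two root subgroups and the two vector axes, which gives level
  \<open>m = 2 * k + 2\<close> there. It acts trivially on itself and on the centre; these are
  reached by factoring a series in \<open>P (2 * m)\<close> into two series in \<open>P m\<close>
  and combining elements already found. Hence the level \<open>2 * m = 4 * k + 4\<close>.\<close>

lemma finite_index_contains_GK:
  assumes H: "subgroup H J" "finite (rcosets\<^bsub>J\<^esub> H)" "card (rcosets\<^bsub>J\<^esub> H) \<le> p ^ k"
  shows "GK (4 * k + 4) \<subseteq> H"
proof -
  define m where "m = 2 * k + 2"
  have m1: "m \<ge> 1" and m2: "4 * k + 4 = 2 * m" by (simp_all add: m_def)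
  have Pm1: "f \<in> P 1" if "f \<in> P m" for f using P_mono[OF m1 that] .
  note mH = subgroup.m_closed[OF H(1), unfolded mult_J] and iH = subgroup.m_inv_closed[OF H(1)]
  \<comment> \<open>Conjugation by \<open>diag(u, 1/u)\<close>, in one direction or the other,
    scales a root subgroup by \<open>u^2\<close>, so with \<open>u = 1 + t\<close> the multiplier is
    \<open>u^2 - 1\<close>, whose leading term is that of \<open>2 t\<close>. Vectors are scaled by
    \<open>u\<close>, with multiplier \<open>t\<close> itself.\<close>
  define \<mu> where "\<mu> t = (1 + t) * (1 + t) - 1" for t :: "'r fps"
  have \<mu>: "\<mu> t \<in> P n \<and> \<mu> t $ n \<noteq> 0" if t: "t \<in> P n" "n \<ge> 1" "t $ n \<noteq> 0" for t n
  proof -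
    have "t * t \<in> P (Suc n)" using P_mono[OF _ P_mult[OF t(1,1)], of "Suc n"] t(2) by simp
    moreover have "2 * t \<in> P n" by (rule P_mult_left[OF t(1)])
    moreover have "\<mu> t = 2 * t + t * t" by (simp add: \<mu>_def algebra_simps)
    moreover have "(2 * t) $ n = 2 * t $ n" by (simp only: mult_2 fps_add_nth)
    moreover have "2 * t $ n \<noteq> 0" using F_two P_coeff[OF t(1)] t(3) by blast
    ultimately show ?thesis using P_add by (auto simp: P_Suc_iff)
  qed
  have conj: "jmult (jmult g h) (jinv g) \<in> H" "jmult (jmult (jinv g) h) g \<in> H"
    if "g \<in> JC" "g \<in> H" "h \<in> H" for g h
    using mH iH[OF that(2)] that inv_J[OF that(1)] by auto
  have torv: "(1 + t) * fps_right_inverse (1 + t) 1 = 1" if "t \<in> P 1" for t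
    using tor_inverse[OF that] by simp
  have upp: "upp f \<in> H" if f: "f \<in> P m" for f
  proof (rule one_parameter_level[OF H, where \<theta> = upp and \<mu> = \<mu>])
    fix t f assume t: "t \<in> P 1" "f \<in> P 1" "tor t \<in> H" "upp f \<in> H"
    have "jmult (jmult (tor t) (upp f)) (jinv (tor t)) = upp (f + \<mu> t * f)"
      using torv[OF t(1)] by (simp add: jmult_def tor_def upp_def jinv_def \<mu>_def algebra_simps)
    then show "upp (f + \<mu> t * f) \<in> H" using conj(1)[OF tor_JC[OF t(1)] t(3,4)] by simp
  qed (use \<mu> f in \<open>simp_all add: m_def upp_JC upp_quot\<close>)
  have low: "low f \<in> H" if f: "f \<in> P m" for f
  proof (rule one_parameter_level[OF H, where \<theta> = low and \<mu> = \<mu>])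
    fix t f assume t: "t \<in> P 1" "f \<in> P 1" "tor t \<in> H" "low f \<in> H"
    have "jmult (jmult (jinv (tor t)) (low f)) (tor t) = low (f + \<mu> t * f)"
      using torv[OF t(1)] by (simp add: jmult_def tor_def low_def jinv_def \<mu>_def algebra_simps)
    then show "low (f + \<mu> t * f) \<in> H" using conj(2)[OF tor_JC[OF t(1)] t(3,4)] by simp
  qed (use \<mu> f in \<open>simp_all add: m_def low_JC low_quot\<close>)
  have vec1: "vec1 f \<in> H" if V and f: "f \<in> P m" for f
  proof (rule one_parameter_level[OF H, where \<theta> = vec1 and \<mu> = "\<lambda>t. t"])
    fix t f assume t: "t \<in> P 1" "f \<in> P 1" "tor t \<in> H" "vec1 f \<in> H"
    have "jmult (jmult (jinv (tor t)) (vec1 f)) (tor t) = vec1 (f + t * f)"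
      using torv[OF t(1)] by (simp add: jmult_def tor_def vec1_def jinv_def algebra_simps)
    then show "vec1 (f + t * f) \<in> H" using conj(2)[OF tor_JC[OF t(1)] t(3,4)] by simp
  qed (use f vec1_JC[OF _ \<open>V\<close>] vec_quot(1)[OF _ \<open>V\<close>] in \<open>simp_all add: m_def\<close>)
  have vec2: "vec2 f \<in> H" if V and f: "f \<in> P m" for f
  proof (rule one_parameter_level[OF H, where \<theta> = vec2 and \<mu> = "\<lambda>t. t"])
    fix t f assume t: "t \<in> P 1" "f \<in> P 1" "tor t \<in> H" "vec2 f \<in> H"
    have "jmult (jmult (tor t) (vec2 f)) (jinv (tor t)) = vec2 (f + t * f)"
      using torv[OF t(1)] by (simp add: jmult_def tor_def vec2_def jinv_def algebra_simps)
    then show "vec2 (f + t * f) \<in> H" using conj(1)[OF tor_JC[OF t(1)] t(3,4)] by simp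
  qed (use f vec2_JC[OF _ \<open>V\<close>] vec_quot(2)[OF _ \<open>V\<close>] in \<open>simp_all add: m_def\<close>)
  define x where "x = fps_const e * fps_X ^ m"
  have x: "x \<in> P m" "x $ m \<noteq> 0" using P_monom[OF e_in_F] P_monom_nth[of e m m] e_nz by (auto simp: x_def)
  have cen: "cen w \<in> H" if w: "w \<in> P (2 * m)" "restr S w = w" for w
  proof (cases V)
    case False
    then have "w = 0" using w restr_nonV by metis
    then show ?thesis using subgroup.one_closed[OF H(1)] by (simp add: cen_def one_J)
  next
    case True
    \<comment> \<open>Commutators of vectors give twice the form, hence the halving.\<close>
    obtain w' where w': "w' \<in> P (m + m)" "w = 2 * w'" by (rule P_half[OF w(1)[unfolded mult_2]])
    obtain y where y: "y \<in> P m" "w' = x * y" by (rule P_divide[OF x w'(1)])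
    have xy: "vec1 x \<in> H" "vec2 y \<in> H" using vec1 vec2 x y True by auto
    define g where "g = jmult (vec2 y) (vec1 x)"
    have gJ: "g \<in> JC" "g \<in> H"
      unfolding g_def
      using jmult_closed[OF vec2_JC[OF Pm1[OF y(1)] True] vec1_JC[OF Pm1[OF x(1)] True]] mH[OF xy(2,1)] .
    have "restr S (x * y) - restr S (- (y * x)) = w"
      unfolding restr_diff[symmetric] using w(2) w'(2) y(2) by (simp add: mult.commute)
    then have "jmult (jinv g) (jmult (vec1 x) (vec2 y)) = cen w"
      by (simp add: g_def jmult_def vec1_def vec2_def jinv_def cen_def algebra_simps)
    then show ?thesis using mH[OF iH[OF gJ(2)] mH[OF xy]] inv_J[OF gJ(1)] by simp
  qed
  have tor: "tor t \<in> H" if t: "t \<in> P (2 * m)" for t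
  proof -
    have t1: "t \<in> P 1" using P_mono[OF _ t, of 1] m1 by simp
    define v where "v = fps_right_inverse (1 + t) 1"
    have v: "(1 + t) * v = 1" unfolding v_def by (rule torv[OF t1])
    obtain y where y: "y \<in> P m" "t = x * y" by (rule P_divide[OF x t[unfolded mult_2]])
    \<comment> \<open>A diagonal matrix as a product of four elementary ones, which needs
      \<open>t = x * y\<close>.\<close>
    have "jmult (jmult (jmult (low (- (y * v))) (upp x)) (low y)) (upp (- (x * v))) = tor t"
    proof -
      have "(1 + x * y) * (- (x * v)) + x = x * (1 - (1 + x * y) * v)"
        "- (y * v) * (1 + x * y) + y = y * (1 - (1 + x * y) * v)"
        "1 - y * v * x - v = 1 - (1 + x * y) * v"
        by (simp_all add: algebra_simps)
      moreover have "1 - (1 + x * y) * v = 0" using v y by simp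
      ultimately have b: "(1 + x * y) * (- (x * v)) + x = 0" and c: "- (y * v) * (1 + x * y) + y = 0"
        and d: "1 - y * v * x = v"
        by (simp_all only: mult_zero_right eq_iff_diff_eq_0[of _ v])
      have c': "- (y * v) + (- (y * v) * x + 1) * y = - (y * v) * (1 + x * y) + y"
        by (simp add: algebra_simps)
      show ?thesis
        unfolding tor_def v_def[symmetric] jmult_def low_def upp_def
        using b c d c' y by simp
    qed
    moreover have "low (- (y * v)) \<in> H" "upp x \<in> H" "low y \<in> H" "upp (- (x * v)) \<in> H"
      using low upp x y by (auto intro: P_uminus P_mult_right)
    ultimately show ?thesis using mH by metis
  qed
  show ?thesis
  proof
    fix g assume g: "g \<in> GK (4 * k + 4)"
    then have gJ: "g \<in> JC" and gc: "ea g - 1 \<in> P (2 * m)" "eb g \<in> P (2 * m)" "ec g \<in> P (2 * m)"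
        "ex g \<in> P (2 * m)" "ey g \<in> P (2 * m)" "ew g \<in> P (2 * m)"
      by (auto simp: GK_def jcong_def m2)
    have le: "f \<in> P m" if "f \<in> P (2 * m)" for f using P_mono[OF _ that, of m] by simp
    define v where "v = fps_right_inverse (ea g) 1"
    have v: "ea g * v = 1" using torv[of "ea g - 1"] gc(1) P_mono[of 1 "2 * m"] m1 by (simp add: v_def)
    have det: "ea g * ed g - eb g * ec g = 1" using gJ by (simp add: JC_def)
    have tg: "tor (ea g - 1) = El (ea g) 0 0 v 0 0 0" by (simp add: tor_def v_def)
    have "ed g = (ea g * v) * ed g" by (simp add: v)
    also have "\<dots> = v * (ea g * ed g)" by (simp only: ac_simps)
    also have "\<dots> = v * (1 + eb g * ec g)" using det by (simp add: algebra_simps)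
    finally have d: "ed g = v + v * eb g * ec g" by (simp add: algebra_simps)
    have b: "ea g * (eb g * v) = eb g" and c: "ec g * v * ea g = ec g"
      using v by (metis mult.left_commute mult.right_neutral, metis mult.assoc mult.commute mult.right_neutral)
    have A: "jmult (jmult (low (ec g * v)) (tor (ea g - 1))) (upp (eb g * v)) = El (ea g) (eb g) (ec g) (ed g) 0 0 0"
      using b c d by (simp add: jmult_def low_def upp_def tg algebra_simps)
    have 1: "El (ea g) (eb g) (ec g) (ed g) 0 0 0 \<in> H"
      unfolding A[symmetric] using gc le by (intro mH low upp tor) (auto intro: P_mult_right)
    show "g \<in> H"
    proof (cases V)
      case True
      \<comment> \<open>Multiplying the two axis vectors adds \<open>restr S (ex g * ey g)\<close>
        to the central coordinate; \<open>w\<close> compensates for it.\<close>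
      define w where "w = ew g - restr S (ex g * ey g)"
      have w: "w \<in> P (2 * m)" "restr S w = w"
        using gJ gc by (auto simp: w_def restr_diff JC_def intro!: P_diff restr_P P_mult_right)
      have eq: "g = jmult (jmult (jmult (El (ea g) (eb g) (ec g) (ed g) 0 0 0) (vec1 (ex g))) (vec2 (ey g))) (cen w)"
        by (rule elt.expand) (simp add: vec1_def vec2_def cen_def w_def)
      show ?thesis
        using mH[OF mH[OF mH[OF 1 vec1[OF True le[OF gc(4)]]] vec2[OF True le[OF gc(5)]]] cen[OF w]]
        by (simp only: eq[symmetric])
    next
      case False
      have "V \<or> ex g = 0 \<and> ey g = 0" "restr S (ew g) = ew g" using gJ unfolding JC_def by blast+
      then have "ex g = 0" "ey g = 0" "ew g = 0" using False restr_nonV[OF False, of "ew g"] by simp_all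
      then show ?thesis using 1 by (metis elt.collapse)
    qed
  qed
qed

end

subsection \<open>Normal subgroups\<close>

context jacobi
begin

definition lev :: "nat \<Rightarrow> 'r elt \<Rightarrow> bool" where
  "lev j g \<longleftrightarrow> ea g - 1 \<in> P j \<and> eb g \<in> P j \<and> ec g \<in> P j \<and> ed g - 1 \<in> P j"

definition MM :: "nat \<Rightarrow> nat \<Rightarrow> nat \<Rightarrow> 'r elt set" where
  "MM i j l = {g \<in> JC. lev i g \<and> ex g \<in> P j \<and> ey g \<in> P j \<and> ew g \<in> P l}"

lemma JC_lev: "g \<in> JC \<Longrightarrow> lev 1 g" and JC_det: "g \<in> JC \<Longrightarrow> ea g * ed g - eb g * ec g = 1"
  by (simp_all add: JC_def lev_def)

lemma lev_jmult: "lev j g \<Longrightarrow> lev j h \<Longrightarrow> lev j (jmult g h)"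
  unfolding lev_def by (auto intro: P_intros)

lemma lev_jinv: "lev j g \<Longrightarrow> lev j (jinv g)"
  unfolding lev_def by (auto intro: P_uminus)

lemma omega_P:
  "x \<in> P j \<Longrightarrow> y \<in> P j \<Longrightarrow> x' \<in> P j \<Longrightarrow> y' \<in> P j \<Longrightarrow> x * y' - y * x' \<in> P (2 * j)"
  using P_diff[OF P_mult[of x j y' j] P_mult[of y j x' j]] by (simp add: mult_2)

text \<open>The form sends two vectors of depth \<open>j\<close> to depth \<open>2 * j\<close>,
  which must not be shallower than the central depth \<open>l\<close>.\<close>

lemma MM_subgroup:
  assumes "l \<le> 2 * j"
  shows "subgroup (MM i j l) J"
proof (rule J.subgroupI)
  fix g h assume g: "g \<in> MM i j l" and h: "h \<in> MM i j l"
  have v: "ex g * ea h + ey g * ec h \<in> P j" "ex g * eb h + ey g * ed h \<in> P j"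
    using g by (auto simp: MM_def intro: P_add P_mult_right)
  have "(ex g * ea h + ey g * ec h) * ey h - (ex g * eb h + ey g * ed h) * ex h \<in> P l"
    by (rule P_mono[OF assms omega_P[OF v]]) (use h in \<open>simp_all add: MM_def\<close>)
  then show "g \<otimes>\<^bsub>J\<^esub> h \<in> MM i j l"
    using g h v by (auto simp: MM_def mult_J jmult_closed intro: lev_jmult P_add restr_P)
next
  fix g assume g: "g \<in> MM i j l"
  then have "inv\<^bsub>J\<^esub> g = jinv g" by (simp add: MM_def inv_J)
  then show "inv\<^bsub>J\<^esub> g \<in> MM i j l"
    using g by (auto simp: MM_def jinv_closed intro: lev_jinv P_diff P_uminus P_mult_right)
next
  have "\<one>\<^bsub>J\<^esub> \<in> MM i j l" using one_in_JC by (simp add: MM_def one_J lev_def)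
  then show "MM i j l \<noteq> {}" by blast
qed (auto simp: MM_def carrier_J)

lemma GK_eq_MM: "GK n = MM n n n"
  by (auto simp: GK_def MM_def lev_def jcong_def)

subsubsection \<open>Commutators\<close>

definition jcomm :: "'r elt \<Rightarrow> 'r elt \<Rightarrow> 'r elt" where
  "jcomm g c = jmult (jinv (jmult c g)) (jmult g c)"

lemma jcomm_JC: "g \<in> JC \<Longrightarrow> c \<in> JC \<Longrightarrow> jcomm g c \<in> JC"
  unfolding jcomm_def by (intro jmult_closed jinv_closed)

lemma jcomm_normal:
  assumes N: "N \<lhd> J" and g: "g \<in> N" and c: "c \<in> JC"
  shows "jcomm g c \<in> N"
proof -
  interpret N: normal N J by (rule N)
  have gJ: "g \<in> JC" using g N.subset by (auto simp: carrier_J)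
  have gc: "g \<in> carrier J" "c \<in> carrier J" using gJ c by (auto simp: carrier_J)
  have "jcomm g c = inv\<^bsub>J\<^esub> (c \<otimes>\<^bsub>J\<^esub> g) \<otimes>\<^bsub>J\<^esub> (g \<otimes>\<^bsub>J\<^esub> c)"
    using inv_J[OF jmult_closed[OF c gJ]] by (simp add: jcomm_def mult_J)
  also have "\<dots> = inv\<^bsub>J\<^esub> g \<otimes>\<^bsub>J\<^esub> (inv\<^bsub>J\<^esub> c \<otimes>\<^bsub>J\<^esub> g \<otimes>\<^bsub>J\<^esub> c)"
    using gc by (simp add: J.inv_mult_group J.m_assoc)
  also have "\<dots> \<in> N"
    by (rule N.m_closed[OF N.m_inv_closed[OF g] N.inv_op_closed1[OF gc(2) g]])
  finally show ?thesis .
qed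

text \<open>\<open>A' - 1 = (C A)\<inverse> (A C - C A)\<close>, so the leading terms of a commutator are those of \<open>A C - C A\<close>.\<close>

lemma jcomm_lead:
  assumes g: "g \<in> JC" and c: "c \<in> JC"
    and D: "ea (jmult g c) - ea (jmult c g) \<in> P m" "eb (jmult g c) - eb (jmult c g) \<in> P m"
      "ec (jmult g c) - ec (jmult c g) \<in> P m" "ed (jmult g c) - ed (jmult c g) \<in> P m"
  shows "ea (jcomm g c) - 1 - (ea (jmult g c) - ea (jmult c g)) \<in> P (Suc m)"
    and "eb (jcomm g c) - (eb (jmult g c) - eb (jmult c g)) \<in> P (Suc m)"
    and "ec (jcomm g c) - (ec (jmult g c) - ec (jmult c g)) \<in> P (Suc m)"
    and "ed (jcomm g c) - 1 - (ed (jmult g c) - ed (jmult c g)) \<in> P (Suc m)"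
    and "lev m (jcomm g c)"
proof -
  define h where "h = jmult c g"
  define k where "k = jmult g c"
  have hJ: "h \<in> JC" unfolding h_def by (rule jmult_closed[OF c g])
  have det: "ea h * ed h - eb h * ec h = 1" by (rule JC_det[OF hJ])
  note D' = D[folded h_def k_def]
  have lev: "ed h - 1 \<in> P 1" "eb h \<in> P 1" "ec h \<in> P 1" "ea h - 1 \<in> P 1"
    using JC_lev[OF hJ] by (auto simp: lev_def)
  have eqs: "ea (jcomm g c) - 1 - (ea k - ea h) = (ed h - 1) * (ea k - ea h) - eb h * (ec k - ec h)
        + ((ea h * ed h - eb h * ec h) - 1)"
    "eb (jcomm g c) - (eb k - eb h) = (ed h - 1) * (eb k - eb h) - eb h * (ed k - ed h)"
    "ec (jcomm g c) - (ec k - ec h) = (ea h - 1) * (ec k - ec h) - ec h * (ea k - ea h)"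
    "ed (jcomm g c) - 1 - (ed k - ed h) = (ea h - 1) * (ed k - ed h) - ec h * (eb k - eb h)
        + ((ea h * ed h - eb h * ec h) - 1)"
    by (simp_all add: jcomm_def h_def[symmetric] k_def[symmetric] algebra_simps)
  have Q: "f * d - f' * d' \<in> P (Suc m)" if "f \<in> P 1" "f' \<in> P 1" "d \<in> P m" "d' \<in> P m" for f f' d d'
    using P_diff[OF P_mult[OF that(1,3)] P_mult[OF that(2,4)]] by simp
  show r: "ea (jcomm g c) - 1 - (ea (jmult g c) - ea (jmult c g)) \<in> P (Suc m)"
    "eb (jcomm g c) - (eb (jmult g c) - eb (jmult c g)) \<in> P (Suc m)"
    "ec (jcomm g c) - (ec (jmult g c) - ec (jmult c g)) \<in> P (Suc m)"
    "ed (jcomm g c) - 1 - (ed (jmult g c) - ed (jmult c g)) \<in> P (Suc m)"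
    unfolding h_def[symmetric] k_def[symmetric] eqs using Q lev D' det by simp_all
  have "f \<in> P m" if "f - d \<in> P (Suc m)" "d \<in> P m" for f d
    using P_add[OF P_mono[OF _ that(1), of m] that(2)] by simp
  then show "lev m (jcomm g c)" unfolding lev_def using r D by blast
qed

definition inQ :: "'r elt \<Rightarrow> bool" where
  "inQ c \<longleftrightarrow> c \<in> JC \<and> ex c = 0 \<and> ey c = 0 \<and> ew c = 0"

lemma inQ_upp: "f \<in> P 1 \<Longrightarrow> inQ (upp f)" and inQ_low: "f \<in> P 1 \<Longrightarrow> inQ (low f)"
  and inQ_tor: "f \<in> P 1 \<Longrightarrow> inQ (tor f)"
  using upp_JC[of f] low_JC[of f] tor_JC[of f] by (simp_all add: inQ_def upp_def low_def tor_def)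

text \<open>The commutator \<open>k\<close> satisfies \<open>(c g) k = g c\<close>. As
  \<open>c\<close> is a pure matrix, comparing vector parts gives \<open>v K + v_k = v C\<close>,
  and comparing central coordinates gives the third formula.\<close>

lemma jcomm_vec:
  assumes g: "g \<in> JC" and c: "inQ c"
  shows "ex (jcomm g c) = ex g * (ea c - ea (jcomm g c)) + ey g * (ec c - ec (jcomm g c))"
    and "ey (jcomm g c) = ex g * (eb c - eb (jcomm g c)) + ey g * (ed c - ed (jcomm g c))"
    and "ew (jcomm g c) = restr S (ex (jcomm g c) * (ex g * eb c + ey g * ed c) -
        ey (jcomm g c) * (ex g * ea c + ey g * ec c))"
proof -
  define h where "h = jmult c g"
  define k where "k = jmult g c"
  have q: "ex c = 0" "ey c = 0" "ew c = 0" "c \<in> JC" using c by (auto simp: inQ_def)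
  have hv: "ex h = ex g" "ey h = ey g" "ew h = ew g" by (simp_all add: h_def q)
  have kv: "ex k = ex g * ea c + ey g * ec c" "ey k = ex g * eb c + ey g * ed c" "ew k = ew g"
    by (simp_all add: k_def q)
  have eq: "ex (jcomm g c) - ex k = - (ex g * ea (jcomm g c) + ey g * ec (jcomm g c))"
    "ey (jcomm g c) - ey k = - (ex g * eb (jcomm g c) + ey g * ed (jcomm g c))"
    by (simp_all add: jcomm_def h_def[symmetric] k_def[symmetric] hv algebra_simps)
  show 1: "ex (jcomm g c) = ex g * (ea c - ea (jcomm g c)) + ey g * (ec c - ec (jcomm g c))"
    "ey (jcomm g c) = ex g * (eb c - eb (jcomm g c)) + ey g * (ed c - ed (jcomm g c))"
    using eq by (simp_all add: kv algebra_simps)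
  have "ew (jcomm g c) = restr S ((ex (jcomm g c) - ex k) * ey k - (ey (jcomm g c) - ey k) * ex k)"
    by (simp add: jcomm_def h_def[symmetric] k_def[symmetric] hv kv(3))
  also have "(ex (jcomm g c) - ex k) * ey k - (ey (jcomm g c) - ey k) * ex k =
      ex (jcomm g c) * ey k - ey (jcomm g c) * ex k"
    by (simp add: algebra_simps)
  finally show "ew (jcomm g c) = restr S (ex (jcomm g c) * (ex g * eb c + ey g * ed c) -
        ey (jcomm g c) * (ex g * ea c + ey g * ec c))" by (simp add: kv)
qed

lemma jcomm_vec_P:
  assumes g: "g \<in> JC" and c: "inQ c" and v: "ex g \<in> P m" "ey g \<in> P m"
  shows "ex (jcomm g c) \<in> P (Suc m)" "ey (jcomm g c) \<in> P (Suc m)" "ew (jcomm g c) \<in> P (Suc m)"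
proof -
  have k: "lev 1 (jcomm g c)" "lev 1 c" using JC_lev jcomm_JC[OF g] c by (auto simp: inQ_def)
  have d: "ea c - ea (jcomm g c) \<in> P 1" "eb c - eb (jcomm g c) \<in> P 1"
    "ec c - ec (jcomm g c) \<in> P 1" "ed c - ed (jcomm g c) \<in> P 1"
  proof -
    have "(ea c - 1) - (ea (jcomm g c) - 1) \<in> P 1" "(ed c - 1) - (ed (jcomm g c) - 1) \<in> P 1"
      by (rule P_diff; use k in \<open>simp add: lev_def\<close>)+
    then show "ea c - ea (jcomm g c) \<in> P 1" "ed c - ed (jcomm g c) \<in> P 1" by simp_all
    show "eb c - eb (jcomm g c) \<in> P 1" "ec c - ec (jcomm g c) \<in> P 1"
      by (rule P_diff; use k in \<open>simp add: lev_def\<close>)+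
  qed
  show 1: "ex (jcomm g c) \<in> P (Suc m)" "ey (jcomm g c) \<in> P (Suc m)"
    unfolding jcomm_vec(1,2)[OF g c]
    using P_add[OF P_mult[OF v(1) d(1)] P_mult[OF v(2) d(3)]]
      P_add[OF P_mult[OF v(1) d(2)] P_mult[OF v(2) d(4)]] by simp_all
  show "ew (jcomm g c) \<in> P (Suc m)"
    unfolding jcomm_vec(3)[OF g c] by (intro restr_P P_diff P_mult_right 1)
qed

subsubsection \<open>Leading matrices\<close>

text \<open>The lower right entry is missing because the leading matrix has trace zero (\<open>lev_trace\<close>).\<close>

definition lead :: "'r elt set \<Rightarrow> nat \<Rightarrow> 'r \<Rightarrow> 'r \<Rightarrow> 'r \<Rightarrow> bool" where
  "lead N j \<alpha> \<beta> \<gamma> \<longleftrightarrow> (\<exists>g\<in>N. lev j g \<and> (ea g - 1) $ j = \<alpha> \<and> eb g $ j = \<beta> \<and> ec g $ j = \<gamma>)"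

lemma P_diff_Suc_nth: "f - g \<in> P (Suc n) \<Longrightarrow> f $ n = g $ n"
  using P_coeff_0[of "f - g" "Suc n" n] by simp

text \<open>\<open>det A = 1\<close> expresses the trace of \<open>A - 1\<close> by products of two
  entries of \<open>A - 1\<close>, which lie in \<open>P (j + j)\<close>.\<close>

lemma lev_trace:
  assumes g: "g \<in> JC" "lev j g" "j \<ge> 1"
  shows "(ed g - 1) $ j = - ((ea g - 1) $ j)"
proof -
  have "(ea g - 1) + (ed g - 1) = eb g * ec g - (ea g - 1) * (ed g - 1)"
    using JC_det[OF g(1)] by (simp add: algebra_simps)
  also have "\<dots> \<in> P (j + j)"
    using g(2) by (auto simp: lev_def intro!: P_diff P_mult)
  finally have mem: "(ea g - 1) + (ed g - 1) \<in> P (j + j)" .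
  have lt: "j < j + j" using g(3) by simp
  show ?thesis using minus_unique[OF P_coeff_0[OF mem lt, unfolded fps_add_nth], symmetric] .
qed

definition Ap :: "'r elt \<Rightarrow> 'r elt" where
  "Ap g = El (ea g) (eb g) (ec g) (ed g) 0 0 0"

lemma Ap_jmult: "Ap (jmult g h) = jmult (Ap g) (Ap h)"
  by (simp add: Ap_def jmult_def)

text \<open>Weaker than normality: it will be applied to those elements of a normal subgroup whose
  vector and central coordinates are deep. Commutators with pure matrices preserve such depth,
  whereas conjugation by vectors need not.\<close>

definition Qclosed :: "'r elt set \<Rightarrow> bool" where
  "Qclosed N \<longleftrightarrow> N \<subseteq> JC \<and> El 1 0 0 1 0 0 0 \<in> N \<and> (\<forall>g\<in>N. \<forall>h\<in>N. jmult g h \<in> N) \<and>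
     (\<forall>g\<in>N. \<forall>c. inQ c \<longrightarrow> jcomm g c \<in> N)"

context
  fixes N assumes N: "Qclosed N"
begin

lemma lead_add:
  assumes "lead N j \<alpha> \<beta> \<gamma>" "lead N j \<alpha>' \<beta>' \<gamma>'" "j \<ge> 1"
  shows "lead N j (\<alpha> + \<alpha>') (\<beta> + \<beta>') (\<gamma> + \<gamma>')"
proof -
  obtain g h where g: "g \<in> N" "lev j g" "(ea g - 1) $ j = \<alpha>" "eb g $ j = \<beta>" "ec g $ j = \<gamma>"
    and h: "h \<in> N" "lev j h" "(ea h - 1) $ j = \<alpha>'" "eb h $ j = \<beta>'" "ec h $ j = \<gamma>'"
    using assms by (auto simp: lead_def)
  have Q: "x * y \<in> P (Suc j)" if "x \<in> P j" "y \<in> P j" for x y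
    using P_mono[OF _ P_mult[OF that], of "Suc j"] assms(3) by simp
  have P: "ea g - 1 \<in> P j" "eb g \<in> P j" "ec g \<in> P j" "ed g - 1 \<in> P j"
    "ea h - 1 \<in> P j" "eb h \<in> P j" "ec h \<in> P j" "ed h - 1 \<in> P j"
    using g(2) h(2) by (auto simp: lev_def)
  have eqs: "(ea (jmult g h) - 1) - ((ea g - 1) + (ea h - 1)) = (ea g - 1) * (ea h - 1) + eb g * ec h"
    "eb (jmult g h) - (eb g + eb h) = (ea g - 1) * eb h + eb g * (ed h - 1)"
    "ec (jmult g h) - (ec g + ec h) = ec g * (ea h - 1) + (ed g - 1) * ec h"
    by (simp_all add: algebra_simps)
  have d: "(ea (jmult g h) - 1) - ((ea g - 1) + (ea h - 1)) \<in> P (Suc j)"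
    "eb (jmult g h) - (eb g + eb h) \<in> P (Suc j)" "ec (jmult g h) - (ec g + ec h) \<in> P (Suc j)"
    unfolding eqs by (intro P_add Q P)+
  have "(ea (jmult g h) - 1) $ j = \<alpha> + \<alpha>'" "eb (jmult g h) $ j = \<beta> + \<beta>'" "ec (jmult g h) $ j = \<gamma> + \<gamma>'"
    unfolding d[THEN P_diff_Suc_nth] unfolding fps_add_nth g(3-5) h(3-5) by (rule refl)+
  moreover have "jmult g h \<in> N" using N g h by (auto simp: Qclosed_def)
  ultimately show ?thesis unfolding lead_def using lev_jmult[OF g(2) h(2)] by blast
qed

lemma lead_of_nat:
  assumes "lead N j \<alpha> \<beta> \<gamma>" "j \<ge> 1"
  shows "lead N j (of_nat m * \<alpha>) (of_nat m * \<beta>) (of_nat m * \<gamma>)"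
proof (induction m)
  case 0
  then show ?case using N by (auto simp: lead_def Qclosed_def lev_def intro!: bexI[of _ "El 1 0 0 1 0 0 0"])
next
  case (Suc m)
  then show ?case using lead_add[OF assms(1) Suc assms(2)] by (simp add: distrib_right)
qed

lemma lead_F:
  assumes "lead N j \<alpha> \<beta> \<gamma>" "j \<ge> 1"
  shows "\<alpha> \<in> F" "\<beta> \<in> F" "\<gamma> \<in> F"
  using assms unfolding lead_def lev_def using P_coeff by blast+

text \<open>Powers of an element give the integer multiples of its leading matrix, and over a prime
  field these are all its multiples.\<close>

lemma lead_scale:
  assumes l: "lead N j \<alpha> \<beta> \<gamma>" "j \<ge> 1" and z: "z \<in> F"
  shows "lead N j (z * \<alpha>) (z * \<beta>) (z * \<gamma>)"
proof -
  obtain m :: nat where m: "z = of_nat m * e" using z cyclic by (auto simp: F_def)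
  have "z * x = of_nat m * x" if "x \<in> F" for x using that m by (simp add: F_e mult.assoc)
  then show ?thesis using lead_of_nat[OF l, of m] lead_F[OF l] by simp
qed

lemma lead_diff:
  assumes "lead N j \<alpha> \<beta> \<gamma>" "lead N j \<alpha>' \<beta>' \<gamma>'" "j \<ge> 1"
  shows "lead N j (\<alpha> - \<alpha>') (\<beta> - \<beta>') (\<gamma> - \<gamma>')"
  using lead_add[OF assms(1) lead_scale[OF assms(2,3) F_uminus[OF e_in_F]] assms(3)]
    lead_F[OF assms(2,3)] by (simp add: F_e)

text \<open>The three brackets with the standard basis of \<open>\<ss>\<ll>\<^sub>2\<close>.\<close>

lemma lead_bracket:
  assumes l: "lead N j \<alpha> \<beta> \<gamma>" and j: "j \<ge> 1" and i: "i \<ge> 1" and z: "z \<in> F"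
  shows "lead N (j + i) (- (z * \<gamma>)) (2 * (z * \<alpha>)) 0"
    and "lead N (j + i) (z * \<beta>) 0 (- (2 * (z * \<alpha>)))"
    and "lead N (j + i) 0 (- (2 * (z * \<beta>))) (2 * (z * \<gamma>))"
proof -
  obtain g where g: "g \<in> N" "lev j g" "(ea g - 1) $ j = \<alpha>" "eb g $ j = \<beta>" "ec g $ j = \<gamma>"
    using l by (auto simp: lead_def)
  have gJ: "g \<in> JC" using N g by (auto simp: Qclosed_def)
  define t where "t = fps_const z * fps_X ^ i"
  have t: "t \<in> P i" "t $ i = z" using P_monom[OF z] P_monom_nth[of z i i] by (auto simp: t_def)
  have t1: "t \<in> P 1" by (rule P_mono[OF i t(1)])
  have gP: "eb g \<in> P j" "ec g \<in> P j" "ea g - 1 \<in> P j" "ed g - 1 \<in> P j" using g by (auto simp: lev_def)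
  have ad: "ea g - ed g \<in> P j" "(ea g - ed g) $ j = 2 * \<alpha>"
  proof -
    have "(ea g - 1) - (ed g - 1) \<in> P j" by (rule P_diff[OF gP(3,4)])
    then show "ea g - ed g \<in> P j" by simp
    have "(ea g - ed g) $ j = (ea g - 1) $ j - (ed g - 1) $ j" by simp
    then show "(ea g - ed g) $ j = 2 * \<alpha>"
      by (simp only: lev_trace[OF gJ g(2) j] g(3) diff_minus_eq_add mult_2)
  qed
  have key: "lead N (j + i) (a $ (j + i)) (b $ (j + i)) (c $ (j + i))"
    if c: "inQ c0" and D: "ea (jmult g c0) - ea (jmult c0 g) = a" "eb (jmult g c0) - eb (jmult c0 g) = b"
      "ec (jmult g c0) - ec (jmult c0 g) = c" "ed (jmult g c0) - ed (jmult c0 g) = d"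
      and P: "a \<in> P (j + i)" "b \<in> P (j + i)" "c \<in> P (j + i)" "d \<in> P (j + i)" for c0 a b c d
  proof -
    have cJ: "c0 \<in> JC" using c by (simp add: inQ_def)
    note L = jcomm_lead[OF gJ cJ, of "j + i", unfolded D, OF P]
    have "jcomm g c0 \<in> N" using N g(1) c by (auto simp: Qclosed_def)
    moreover have "(ea (jcomm g c0) - 1) $ (j + i) = a $ (j + i)" by (rule P_diff_Suc_nth[OF L(1)])
    moreover have "eb (jcomm g c0) $ (j + i) = b $ (j + i)" by (rule P_diff_Suc_nth[OF L(2)])
    moreover have "ec (jcomm g c0) $ (j + i) = c $ (j + i)" by (rule P_diff_Suc_nth[OF L(3)])
    ultimately show ?thesis unfolding lead_def using L(5) by blast
  qed
  have tc: "t * f \<in> P (j + i)" "(t * f) $ (j + i) = z * f $ j" if "f \<in> P j" for f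
    using P_mult[OF t(1) that] P_mult_nth[OF t(1) that] t(2) by (simp_all add: add.commute)
  have "lead N (j + i) ((- (t * ec g)) $ (j + i)) ((t * (ea g - ed g)) $ (j + i)) (0 $ (j + i))"
    by (rule key[OF inQ_upp[OF t1], of _ _ _ "t * ec g"];
        (intro P_uminus tc(1) gP(1,2) ad(1) P_zero | simp add: upp_def algebra_simps))
  then show "lead N (j + i) (- (z * \<gamma>)) (2 * (z * \<alpha>)) 0"
    using tc(2)[OF gP(2)] tc(2)[OF ad(1)] ad(2) g(5) by (simp add: mult.left_commute)
  have "lead N (j + i) ((t * eb g) $ (j + i)) (0 $ (j + i)) ((- (t * (ea g - ed g))) $ (j + i))"
    by (rule key[OF inQ_low[OF t1], of _ _ _ "- (t * eb g)"];
        (intro P_uminus tc(1) gP(1,2) ad(1) P_zero | simp add: low_def algebra_simps))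
  then show "lead N (j + i) (z * \<beta>) 0 (- (2 * (z * \<alpha>)))"
    using tc(2)[OF gP(1)] tc(2)[OF ad(1)] ad(2) g(4) by (simp add: mult.left_commute)
  define v where "v = fps_right_inverse (1 + t) 1"
  have v: "(1 + t) * v = 1" "v - 1 \<in> P i" using tor_inverse[OF t(1) i] by (auto simp: v_def)
  have vt: "1 + t - v \<in> P i" "(1 + t - v) $ i = 2 * z"
  proof -
    have eq: "1 + t - v = 2 * t + t * (v - 1)" using v(1) by (simp add: algebra_simps)
    have tv: "t * (v - 1) \<in> P (Suc i)" using P_mono[OF _ P_mult[OF t(1) v(2)], of "Suc i"] i by simp
    then show "1 + t - v \<in> P i" unfolding eq using P_mult_left[OF t(1)] P_mono[of i "Suc i"] by (intro P_add) auto
    have "(1 + t - v) $ i = (2 * t) $ i + (t * (v - 1)) $ i" unfolding eq by simp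
    also have "(t * (v - 1)) $ i = 0" by (rule P_coeff_0[OF tv]) simp
    also have "(2 * t) $ i = 2 * z" by (simp only: mult_2 fps_add_nth t(2))
    finally show "(1 + t - v) $ i = 2 * z" by simp
  qed
  have vc: "(1 + t - v) * f \<in> P (j + i)" "((1 + t - v) * f) $ (j + i) = 2 * z * f $ j" if "f \<in> P j" for f
    using P_mult[OF vt(1) that] P_mult_nth[OF vt(1) that] vt(2) by (simp_all add: add.commute)
  have "lead N (j + i) (0 $ (j + i)) ((- ((1 + t - v) * eb g)) $ (j + i)) (((1 + t - v) * ec g) $ (j + i))"
    by (rule key[OF inQ_tor[OF t1], of _ _ _ 0];
        (intro P_uminus vc(1) gP(1,2) P_zero | simp add: tor_def v_def[symmetric] algebra_simps))
  then show "lead N (j + i) 0 (- (2 * (z * \<beta>))) (2 * (z * \<gamma>))"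
    using vc(2)[OF gP(1)] vc(2)[OF gP(2)] g(4,5) by (simp add: mult.assoc)
qed

text \<open>Two brackets turn any nonzero element into all of \<open>\<ss>\<ll>\<^sub>2\<close>.\<close>

lemma lead_all:
  assumes l: "lead N j \<alpha> \<beta> \<gamma>" and nz: "\<alpha> \<noteq> 0 \<or> \<beta> \<noteq> 0 \<or> \<gamma> \<noteq> 0" and j: "j \<ge> 1" and k: "k \<ge> j + 2"
    and F: "a \<in> F" "b \<in> F" "c \<in> F"
  shows "lead N k a b c"
proof -
  \<comment> \<open>The first bracket raises the depth by 1 and the second by
    \<open>i \<ge> 1\<close>, so together they reach any \<open>k \<ge> j + 2\<close>.\<close>
  define i where "i = k - j - 1"
  have i: "i \<ge> 1" "k = (j + 1) + i" using k by (auto simp: i_def)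
  have j1: "j + 1 \<ge> 1" and k1: "k \<ge> 1" using k by auto
  note lF = lead_F[OF l j]
  have div: "\<exists>z\<in>F. 2 * (z * x) = y" if x: "x \<in> F" "x \<noteq> 0" and y: "y \<in> F" for x y
  proof -
    have "2 * x \<in> F" "2 * x \<noteq> 0" using x F_two F_mult' by blast+
    then obtain u where u: "u \<in> F" "2 * x * u = e" by (rule F_inverse)
    have "2 * ((y * u) * x) = y * (2 * x * u)" by (simp only: ac_simps)
    then show ?thesis using u y F_e' F_mult by metis
  qed
  note B = lead_bracket[OF l j order_refl e_in_F]
  have b1: "lead N (j + 1) (- \<gamma>) (2 * \<alpha>) 0" and b2: "lead N (j + 1) \<beta> 0 (- (2 * \<alpha>))"
    and b3: "lead N (j + 1) 0 (- (2 * \<beta>)) (2 * \<gamma>)"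
    using B lF by (simp_all add: F_e)
  note BB = lead_bracket[OF _ j1 i(1), folded i(2)]
  have neg: "- y \<in> F" if "y \<in> F" for y using that by (rule F_uminus)
  have "(\<forall>y\<in>F. lead N k y 0 0) \<and> (\<forall>y\<in>F. lead N k 0 y 0) \<and> (\<forall>y\<in>F. lead N k 0 0 y)"
  proof -
    consider "\<gamma> \<noteq> 0" | "\<beta> \<noteq> 0" | "\<alpha> \<noteq> 0" "\<beta> = 0" "\<gamma> = 0" using nz by blast
    then show ?thesis
    proof cases
      case 1
      have E: "lead N k 0 y 0" if y: "y \<in> F" for y
      proof -
        obtain z where z: "z \<in> F" "2 * (z * \<gamma>) = - y" using div[OF lF(3) 1 neg[OF y]] by blast
        show ?thesis using BB(1)[OF b1 z(1)] z(2) by simp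
      qed
      have H: "lead N k y 0 0" if y: "y \<in> F" for y
      proof -
        obtain z where z: "z \<in> F" "2 * (z * \<gamma>) = - y" using div[OF lF(3) 1 neg[OF y]] by blast
        show ?thesis using BB(1)[OF b3 z(1)] z(2) by (simp add: mult.left_commute)
      qed
      have "lead N k 0 0 y" if y: "y \<in> F" for y
      proof -
        obtain z where z: "z \<in> F" "2 * (z * \<gamma>) = y" using div[OF lF(3) 1 y] by blast
        have "z * (2 * \<alpha>) \<in> F" by (rule F_mult[OF z(1)])
        then show ?thesis using lead_diff[OF BB(2)[OF b1 z(1)] H[OF \<open>z * (2 * \<alpha>) \<in> F\<close>] k1] z(2) by simp
      qed
      then show ?thesis using E H by blast
    next
      case 2
      have E: "lead N k 0 0 y" if y: "y \<in> F" for y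
      proof -
        obtain z where z: "z \<in> F" "2 * (z * \<beta>) = - y" using div[OF lF(2) 2 neg[OF y]] by blast
        show ?thesis using BB(2)[OF b2 z(1)] z(2) by simp
      qed
      have H: "lead N k y 0 0" if y: "y \<in> F" for y
      proof -
        obtain z where z: "z \<in> F" "2 * (z * \<beta>) = - y" using div[OF lF(2) 2 neg[OF y]] by blast
        show ?thesis using BB(2)[OF b3 z(1)] z(2) by (simp add: mult.left_commute)
      qed
      have "lead N k 0 y 0" if y: "y \<in> F" for y
      proof -
        obtain z where z: "z \<in> F" "2 * (z * \<beta>) = y" using div[OF lF(2) 2 y] by blast
        have "z * (2 * \<alpha>) \<in> F" by (rule F_mult[OF z(1)])
        then show ?thesis using lead_diff[OF BB(1)[OF b2 z(1)] H[OF \<open>z * (2 * \<alpha>) \<in> F\<close>] k1] z(2) by simp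
      qed
      then show ?thesis using E H by blast
    next
      case 3
      have a2: "2 * \<alpha> \<in> F" "2 * \<alpha> \<noteq> 0" using lF(1) 3(1) F_two F_mult' by blast+
      have H: "lead N k y 0 0" if y: "y \<in> F" for y
      proof -
        obtain z where z: "z \<in> F" "2 * (z * \<alpha>) = y" using div[OF lF(1) 3(1) y] by blast
        show ?thesis using BB(2)[OF b1 z(1)] z(2) 3 by (simp add: mult.left_commute)
      qed
      have E: "lead N k 0 y 0" if y: "y \<in> F" for y
      proof -
        obtain z where z: "z \<in> F" "2 * (z * (2 * \<alpha>)) = - y" using div[OF a2 neg[OF y]] by blast
        show ?thesis using BB(3)[OF b1 z(1)] z(2) 3 by simp
      qed
      have "lead N k 0 0 y" if y: "y \<in> F" for y
      proof -
        obtain z where z: "z \<in> F" "2 * (z * (2 * \<alpha>)) = - y" using div[OF a2 neg[OF y]] by blast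
        show ?thesis using BB(3)[OF b2 z(1)] z(2) 3 by simp
      qed
      then show ?thesis using E H by blast
    qed
  qed
  then have "lead N k a 0 0" "lead N k 0 b 0" "lead N k 0 0 c" using F by auto
  from lead_add[OF lead_add[OF this(1,2) k1] this(3) k1] show ?thesis by simp
qed

text \<open>Approximation run downwards from \<open>M\<close>: an element of \<open>N\<close> with
  the right leading matrix is divided off, and the quotient lies one level deeper, where induction
  applies. The base is \<open>GK M \<subseteq> N\<close>. Only the matrix part \<open>Ap\<close> is
  matched; vectors and centre are adjusted later.\<close>

lemma lead_imp_matrices:
  assumes GK: "GK M \<subseteq> N" and all: "\<And>k a b c. k \<ge> j \<Longrightarrow> a \<in> F \<Longrightarrow> b \<in> F \<Longrightarrow> c \<in> F \<Longrightarrow> lead N k a b c"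
    and j: "j \<ge> 1" and g: "g \<in> JC" "lev j g"
  obtains h where "h \<in> N" "Ap h = Ap g"
proof -
  have NJ: "N \<subseteq> JC" using N by (simp add: Qclosed_def)
  have top: "\<exists>h\<in>N. Ap h = Ap g" if g: "g \<in> JC" "lev M g" for g
  proof -
    have "Ap g \<in> GK M" using g by (simp add: GK_eq_MM MM_def Ap_def JC_def lev_def)
    then show ?thesis using GK by (intro bexI[of _ "Ap g"]) (auto simp: Ap_def)
  qed
  have "\<forall>g\<in>JC. lev j g \<longrightarrow> (\<exists>h\<in>N. Ap h = Ap g)" if "j \<le> M"
    using that
  proof (induction rule: inc_induct)
    case base
    then show ?case using top by blast
  next
    case (step n)
    show ?case
    proof (intro ballI impI)
      fix g assume g: "g \<in> JC" "lev n g"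
      have n1: "n \<ge> 1" using step j by simp
      have gP: "ea g - 1 \<in> P n" "eb g \<in> P n" "ec g \<in> P n" "ed g - 1 \<in> P n" using g by (auto simp: lev_def)
      have "lead N n ((ea g - 1) $ n) (eb g $ n) (ec g $ n)"
        using step(1) gP by (intro all P_coeff[of _ n])
      then obtain h where h: "h \<in> N" "lev n h" "(ea h - 1) $ n = (ea g - 1) $ n" "eb h $ n = eb g $ n"
          "ec h $ n = ec g $ n" by (auto simp: lead_def)
      have hJ: "h \<in> JC" using h NJ by blast
      have hP: "ea h - 1 \<in> P n" "eb h \<in> P n" "ec h \<in> P n" "ed h - 1 \<in> P n" using h by (auto simp: lev_def)
      have "(ed h - 1) $ n = (ed g - 1) $ n"
        using lev_trace[OF hJ h(2) n1] lev_trace[OF g n1] h(3) by simp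
      moreover have "x - y \<in> P (Suc n)" if "x \<in> P n" "y \<in> P n" "y $ n = x $ n" for x y
        using P_diff[OF that(1,2)] that(3) by (simp add: P_Suc_iff)
      ultimately have "(ea g - 1) - (ea h - 1) \<in> P (Suc n)" "eb g - eb h \<in> P (Suc n)"
          "ec g - ec h \<in> P (Suc n)" "(ed g - 1) - (ed h - 1) \<in> P (Suc n)"
        using gP hP h by blast+
      then have d: "ea g - ea h \<in> P (Suc n)" "eb g - eb h \<in> P (Suc n)"
          "ec g - ec h \<in> P (Suc n)" "ed g - ed h \<in> P (Suc n)" by simp_all
      define q where "q = jmult (jinv h) g"
      have qJ: "q \<in> JC" unfolding q_def by (rule jmult_closed[OF jinv_closed[OF hJ] g(1)])
      have det: "ea h * ed h - eb h * ec h = 1" by (rule JC_det[OF hJ])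
      have "ea q - 1 = ed h * (ea g - ea h) - eb h * (ec g - ec h) + ((ea h * ed h - eb h * ec h) - 1)"
        "eb q = ed h * (eb g - eb h) - eb h * (ed g - ed h)"
        "ec q = ea h * (ec g - ec h) - ec h * (ea g - ea h)"
        "ed q - 1 = ea h * (ed g - ed h) - ec h * (eb g - eb h) + ((ea h * ed h - eb h * ec h) - 1)"
        by (simp_all add: q_def algebra_simps)
      then have "lev (Suc n) q" unfolding lev_def det using d by (simp add: P_diff P_mult_left)
      then obtain h' where h': "h' \<in> N" "Ap h' = Ap q" using step(3) qJ by blast
      have "Ap (jmult h h') = Ap (jmult h q)" by (simp only: Ap_jmult h')
      also have "jmult h q = g"
      proof -
        have "h \<otimes>\<^bsub>J\<^esub> (inv\<^bsub>J\<^esub> h \<otimes>\<^bsub>J\<^esub> g) = g"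
          using hJ g(1) by (simp add: carrier_J[symmetric] J.m_assoc[symmetric])
        then show ?thesis by (simp add: q_def mult_J inv_J[OF hJ])
      qed
      finally have "Ap (jmult h h') = Ap g" .
      moreover have "jmult h h' \<in> N" using N h(1) h'(1) by (auto simp: Qclosed_def)
      ultimately show "\<exists>h\<in>N. Ap h = Ap g" by blast
    qed
  qed
  moreover have "\<exists>h\<in>N. Ap h = Ap g" if "\<not> j \<le> M"
    using top[OF g(1)] g(2) that P_mono[of M j] by (auto simp: lev_def)
  ultimately have "\<exists>h\<in>N. Ap h = Ap g" using g by blast
  then show thesis using that by blast
qed

end

end

section \<open>Vectors and centre in a normal subgroup\<close>

context jacobi
begin

definition "tv x y w = El 1 0 0 1 x y (w :: 'r fps)"

lemma tv_sel [simp]: "ea (tv x y w) = 1" "eb (tv x y w) = 0" "ec (tv x y w) = 0" "ed (tv x y w) = 1"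
  "ex (tv x y w) = x" "ey (tv x y w) = y" "ew (tv x y w) = w"
  by (simp_all add: tv_def)

lemma jmult_tv: "jmult (tv x y w) (tv x' y' w') = tv (x + x') (y + y') (w + w' + restr S (x * y' - y * x'))"
  by (simp add: jmult_def tv_def)

lemma jcomm_tv:
  "jcomm (tv x y w) (upp f) = tv 0 (f * x) (restr S (- (f * x * x)))"
  "jcomm (tv x y w) (low f) = tv (f * y) 0 (restr S (f * y * y))"
  "jcomm (tv x y w) (vec1 u) = cen (- (restr S (u * y)) - restr S (u * y))"
  by (auto intro!: elt.expand simp: jcomm_def upp_def low_def vec1_def cen_def
      restr_uminus restr_diff algebra_simps)

definition tpow :: "nat \<Rightarrow> 'r fps" where "tpow n = fps_const e * fps_X ^ n"

lemma tpow_P: "tpow n \<in> P n" and tpow_nth: "tpow n $ n = e" and tpow_nz: "tpow n $ n \<noteq> 0"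
  using P_monom[OF e_in_F] P_monom_nth[of e n n] e_nz by (simp_all add: tpow_def)

text \<open>Commutators with \<open>upp f\<close> and \<open>low f\<close> swap the axes:
  \<open>(x, y)\<close> goes to \<open>(0, f * x)\<close> or to \<open>(f * y, 0)\<close>. Division
  by the given coordinate makes every deeper series reachable. Of the resulting central coordinate
  only the depth is controlled.\<close>

lemma tv_row:
  assumes N: "N \<lhd> J" and g: "tv x y w \<in> N"
  shows "x \<in> P k \<Longrightarrow> x $ k \<noteq> 0 \<Longrightarrow> t \<ge> 1 \<Longrightarrow> z \<in> P (k + t) \<Longrightarrow> \<exists>w'\<in>P (2 * k + t). tv 0 z w' \<in> N"
    and "y \<in> P k \<Longrightarrow> y $ k \<noteq> 0 \<Longrightarrow> t \<ge> 1 \<Longrightarrow> z \<in> P (k + t) \<Longrightarrow> \<exists>w'\<in>P (2 * k + t). tv z 0 w' \<in> N"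
proof -
  assume x: "x \<in> P k" "x $ k \<noteq> 0" and t: "t \<ge> 1" and z: "z \<in> P (k + t)"
  obtain f where f: "f \<in> P t" "z = x * f" by (rule P_divide[OF x z])
  have "jcomm (tv x y w) (upp f) \<in> N"
    by (rule jcomm_normal[OF N g upp_JC[OF P_mono[OF t f(1)]]])
  then have "tv 0 z (restr S (- (f * x * x))) \<in> N"
    unfolding jcomm_tv(1) by (simp add: f(2) mult.commute)
  moreover have "f * x * x \<in> P (t + k + k)" by (intro P_mult f x)
  then have "restr S (- (f * x * x)) \<in> P (2 * k + t)"
    by (intro restr_P P_uminus) (simp add: add.commute mult_2 add.left_commute)
  ultimately show "\<exists>w'\<in>P (2 * k + t). tv 0 z w' \<in> N" by blast
next
  assume y: "y \<in> P k" "y $ k \<noteq> 0" and t: "t \<ge> 1" and z: "z \<in> P (k + t)"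
  obtain f where f: "f \<in> P t" "z = y * f" by (rule P_divide[OF y z])
  have "jcomm (tv x y w) (low f) \<in> N"
    by (rule jcomm_normal[OF N g low_JC[OF P_mono[OF t f(1)]]])
  then have "tv z 0 (restr S (f * y * y)) \<in> N"
    unfolding jcomm_tv(2) by (simp add: f(2) mult.commute)
  moreover have "f * y * y \<in> P (t + k + k)" by (intro P_mult f y)
  then have "restr S (f * y * y) \<in> P (2 * k + t)"
    by (intro restr_P) (simp add: add.commute mult_2 add.left_commute)
  ultimately show "\<exists>w'\<in>P (2 * k + t). tv z 0 w' \<in> N" by blast
qed

lemma normal_JC: "N \<lhd> J \<Longrightarrow> N \<subseteq> JC"
  using normal_imp_subgroup subgroup.subset by (force simp: carrier_J)

lemma normal_jmult: "N \<lhd> J \<Longrightarrow> g \<in> N \<Longrightarrow> h \<in> N \<Longrightarrow> jmult g h \<in> N"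
  using subgroup.m_closed[OF normal_imp_subgroup] by (force simp: mult_J)

lemma normal_jinv: "N \<lhd> J \<Longrightarrow> g \<in> N \<Longrightarrow> jinv g \<in> N"
  using subgroup.m_inv_closed[OF normal_imp_subgroup, of N J g] normal_JC[of N] inv_J[of g] by auto

text \<open>One commutator reaches one axis and a second one the other, with central errors of depth
  at least \<open>2 * m + t\<close>. A commutator of \<open>vec1 (tpow 1)\<close> with a vector of
  depth \<open>m + 2\<close> then fills the centre from depth \<open>m + 3\<close> on. Vectors of
  depth \<open>m + 6\<close> are reached with \<open>t = 5\<close>, and their central errors of
  depth \<open>2 * m + 5\<close> are within the part of the centre already filled.\<close>

lemma normal_contains_tv:
  assumes N: "N \<lhd> J" and V: V and g: "tv x y w \<in> N" and m: "m \<ge> 1"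
    and xy: "x \<in> P m" "y \<in> P m" "x $ m \<noteq> 0 \<or> y $ m \<noteq> 0"
    and abc: "a \<in> P (m + 6)" "b \<in> P (m + 6)" "c \<in> P (m + 6)" "restr S c = c"
  shows "tv a b c \<in> N"
proof -
  have rows: "(\<exists>w'\<in>P (2 * m + t). tv 0 z w' \<in> N) \<and> (\<exists>w'\<in>P (2 * m + t). tv z 0 w' \<in> N)"
    if t: "t \<ge> 1" and z: "z \<in> P (m + t + 1)" for t z
  proof -
    have z': "z \<in> P (m + t)" using z by (rule P_mono[rotated]) simp
    have le: "2 * m + t \<le> 2 * (m + t) + 1" by simp
    show ?thesis
    proof (cases "x $ m = 0")
      case False
      obtain w' where w': "tv 0 (tpow (m + t)) w' \<in> N"
        using tv_row(1)[OF N g xy(1) False t tpow_P] by blast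
      show ?thesis
        using tv_row(1)[OF N g xy(1) False t z'] tv_row(2)[OF N w' tpow_P tpow_nz order_refl z] P_mono[OF le] by blast
    next
      case True
      then have y0: "y $ m \<noteq> 0" using xy by simp
      obtain w' where w': "tv (tpow (m + t)) 0 w' \<in> N"
        using tv_row(2)[OF N g xy(2) y0 t tpow_P] by blast
      show ?thesis
        using tv_row(2)[OF N g xy(2) y0 t z'] tv_row(1)[OF N w' tpow_P tpow_nz order_refl z] P_mono[OF le] by blast
    qed
  qed
  have cen: "cen u \<in> N" if u: "u \<in> P (m + 3)" "restr S u = u" for u
  proof -
    obtain u' where u': "u' \<in> P (m + 3)" "u = 2 * u'" by (rule P_half[OF u(1)])
    have "u' \<in> P (1 + (m + 1 + 1))" using u'(1) by (simp add: numeral_3_eq_3)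
    then obtain s where s: "s \<in> P (m + 1 + 1)" "u' = tpow 1 * s" by (rule P_divide[OF tpow_P tpow_nz])
    obtain w' where w': "tv 0 (- s) w' \<in> N" using rows[OF order_refl P_uminus[OF s(1)]] by blast
    have "jcomm (tv 0 (- s) w') (vec1 (tpow 1)) \<in> N"
      by (rule jcomm_normal[OF N w' vec1_JC[OF tpow_P V]])
    moreover have "- restr S (tpow 1 * - s) - restr S (tpow 1 * - s) = u"
    proof -
      have "u = u' + u'" using u'(2) by (simp only: mult_2)
      then have "u = restr S u' + restr S u'" using u(2) restr_add by metis
      then show ?thesis by (simp add: s(2) restr_uminus)
    qed
    ultimately show ?thesis unfolding jcomm_tv(3) by simp
  qed
  have m5: "m + 6 = m + 5 + 1" by simp
  obtain w1 w2 where w1: "w1 \<in> P (2 * m + 5)" "tv a 0 w1 \<in> N" and w2: "w2 \<in> P (2 * m + 5)" "tv 0 b w2 \<in> N"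
    using rows[of 5 a] rows[of 5 b] abc(1,2) m5 by auto
  define w0 where "w0 = w1 + w2 + restr S (a * b)"
  have ab: "tv a b w0 \<in> N" using normal_jmult[OF N w1(2) w2(2)] by (simp add: jmult_tv w0_def)
  have "w1 \<in> P (m + 3)" "w2 \<in> P (m + 3)" "a * b \<in> P (m + 3)" "c \<in> P (m + 3)"
    using P_mono[OF _ w1(1), of "m + 3"] P_mono[OF _ w2(1), of "m + 3"]
      P_mono[OF _ P_mult_right[OF abc(1)], of "m + 3"] P_mono[OF _ abc(3), of "m + 3"] by auto
  then have "c - w0 \<in> P (m + 3)" unfolding w0_def by (intro P_diff P_add restr_P)
  moreover have "restr S (c - w0) = c - w0"
    using abc(4) ab normal_JC[OF N] by (auto simp: restr_diff JC_def)
  ultimately have "cen (c - w0) \<in> N" by (rule cen)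
  from normal_jmult[OF N ab this] show ?thesis
    using jmult_tv[of a b w0 0 0 "c - w0"] by (simp add: cen_def tv_def)
qed

text \<open>The Cayley transform of the trace zero part of \<open>A\<close> is an element of \<open>SL\<^sub>2\<close> commuting with \<open>A\<close>, so its
  commutator with \<open>(A, v, w)\<close> has trivial matrix part.\<close>

lemma centralizer_step:
  assumes N: "N \<lhd> J" and g: "g \<in> N" and v: "ex g \<in> P b" "ey g \<in> P b"
    and Y: "ea g - ed g \<in> P j" "eb g \<in> P j" "ec g \<in> P j"
    and nd: "ex g $ b * (ea g - ed g) $ j + 2 * (ey g $ b * ec g $ j) \<noteq> 0 \<or>
      2 * (ex g $ b * eb g $ j) - ey g $ b * (ea g - ed g) $ j \<noteq> 0"
  obtains x y w where "tv x y w \<in> N" "x \<in> P (Suc b)" "y \<in> P (Suc b)" "x $ Suc b \<noteq> 0 \<or> y $ Suc b \<noteq> 0"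
proof -
  have gJ: "g \<in> JC" using normal_JC[OF N] g by blast
  have div: "\<exists>f'\<in>P 0. f = tpow j * f' \<and> f $ j = f' $ 0" if f: "f \<in> P j" for f
  proof -
    obtain f' where f': "f' \<in> P 0" "f = tpow j * f'" using P_divide[OF tpow_P tpow_nz, of f j 0] f by auto
    then have "f $ j = f' $ 0"
      using P_mult_nth[OF tpow_P f'(1), of j] by (simp add: tpow_nth F_e P_coeff)
    then show ?thesis using f' by blast
  qed
  obtain \<alpha> where \<alpha>: "\<alpha> \<in> P 0" "ea g - ed g = tpow j * \<alpha>" "(ea g - ed g) $ j = \<alpha> $ 0" using div[OF Y(1)] by blast
  obtain \<beta> where \<beta>: "\<beta> \<in> P 0" "eb g = tpow j * \<beta>" "eb g $ j = \<beta> $ 0" using div[OF Y(2)] by blast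
  obtain \<gamma> where \<gamma>: "\<gamma> \<in> P 0" "ec g = tpow j * \<gamma>" "ec g $ j = \<gamma> $ 0" using div[OF Y(3)] by blast
  define t where "t = tpow 1"
  have t: "t \<in> P 1" "t $ 1 = e" using tpow_P tpow_nth by (auto simp: t_def)
  define \<Delta> where "\<Delta> = - (\<alpha> * \<alpha> + 4 * (\<beta> * \<gamma>))"
  have t2: "t * t * f \<in> P 2" for f using P_mult_right[OF P_mult[OF t(1) t(1)], of f] by (simp add: numeral_2_eq_2)
  have "1 + t * t * \<Delta> - 1 \<in> P 2" using t2 by simp
  then obtain \<eta> where \<eta>: "(1 + t * t * \<Delta>) * \<eta> = 1" "\<eta> - 1 \<in> P 2" by (rule P_unit_inverse) auto
  \<comment> \<open>\<open>Y = (\<alpha>, 2 \<beta>; 2 \<gamma>, - \<alpha>)\<close> is twice the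
    trace zero part of \<open>A\<close> divided by \<open>t^j\<close>, and
    \<open>Y^2 = - \<Delta>\<close>. Hence
    \<open>(1 + t Y) / (1 - t Y) = (1 - t^2 \<Delta> + 2 t Y) * \<eta>\<close>. Because of the
    division by \<open>t^j\<close>, the leading term of \<open>C - 1\<close> sits at depth 1
    whatever \<open>j\<close> is.\<close>
  define c where "c = El ((1 - t * t * \<Delta> + 2 * (t * \<alpha>)) * \<eta>) (4 * (t * \<beta> * \<eta>)) (4 * (t * \<gamma> * \<eta>))
    ((1 - t * t * \<Delta> - 2 * (t * \<alpha>)) * \<eta>) 0 0 0"
  have c1: "ea c - 1 = \<eta> * (2 * (t * \<alpha>) - 2 * (t * t * \<Delta>))" "ed c - 1 = \<eta> * (- 2 * (t * \<alpha>) - 2 * (t * t * \<Delta>))"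
  proof -
    have "ea c - 1 = ea c - (1 + t * t * \<Delta>) * \<eta>" "ed c - 1 = ed c - (1 + t * t * \<Delta>) * \<eta>" by (simp_all add: \<eta>(1))
    then show "ea c - 1 = \<eta> * (2 * (t * \<alpha>) - 2 * (t * t * \<Delta>))" "ed c - 1 = \<eta> * (- 2 * (t * \<alpha>) - 2 * (t * t * \<Delta>))"
      by (simp_all add: c_def algebra_simps)
  qed
  have cJ: "c \<in> JC"
  proof -
    have "ea c * ed c - eb c * ec c = ((1 - t * t * \<Delta>) * (1 - t * t * \<Delta>) - 4 * (t * t * (\<alpha> * \<alpha> + 4 * (\<beta> * \<gamma>)))) * (\<eta> * \<eta>)"
      by (simp add: c_def algebra_simps)
    also have "(1 - t * t * \<Delta>) * (1 - t * t * \<Delta>) - 4 * (t * t * (\<alpha> * \<alpha> + 4 * (\<beta> * \<gamma>)))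
        = (1 + t * t * \<Delta>) * (1 + t * t * \<Delta>)"
      by (simp add: \<Delta>_def algebra_simps)
    also have "\<dots> * (\<eta> * \<eta>) = ((1 + t * t * \<Delta>) * \<eta>) * ((1 + t * t * \<Delta>) * \<eta>)" by (simp only: ac_simps)
    finally have det: "ea c * ed c - eb c * ec c = 1" by (simp add: \<eta>(1))
    have t1: "t * f \<in> P 1" for f by (rule P_mult_right[OF t(1)])
    have "t * t * \<Delta> \<in> P 1" by (simp only: mult.assoc t1)
    note t3 = P_mult_left[OF this]
    have "ea c - 1 \<in> P 1" "ed c - 1 \<in> P 1"
      unfolding c1
      using P_mult_left[OF P_diff[OF P_mult_left[OF t1] t3]] P_mult_left[OF P_diff[OF P_mult_left[OF t1] t3]] .
    moreover have "eb c \<in> P 1" "ec c \<in> P 1"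
      unfolding c_def elt.sel using P_mult_left[OF P_mult_right[OF t1]] by blast+
    ultimately show ?thesis using det by (simp add: JC_def c_def)
  qed
  have cQ: "inQ c" using cJ by (simp add: inQ_def c_def)
  have D: "ea (jmult g c) - ea (jmult c g) = 0" "eb (jmult g c) - eb (jmult c g) = 0"
    "ec (jmult g c) - ec (jmult c g) = 0" "ed (jmult g c) - ed (jmult c g) = 0"
  proof -
    have "ea (jmult g c) - ea (jmult c g) = eb g * ec c - eb c * ec g"
      "eb (jmult g c) - eb (jmult c g) = eb c * (ea g - ed g) - eb g * (ea c - ed c)"
      "ec (jmult g c) - ec (jmult c g) = ec g * (ea c - ed c) - ec c * (ea g - ed g)"
      "ed (jmult g c) - ed (jmult c g) = ec g * eb c - ec c * eb g"
      by (simp_all add: algebra_simps)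
    moreover have "ea c - ed c = 4 * (t * \<alpha> * \<eta>)" by (simp add: c_def algebra_simps)
    ultimately show "ea (jmult g c) - ea (jmult c g) = 0" "eb (jmult g c) - eb (jmult c g) = 0"
      "ec (jmult g c) - ec (jmult c g) = 0" "ed (jmult g c) - ed (jmult c g) = 0"
      using \<alpha>(2) \<beta>(2) \<gamma>(2) by (simp_all add: c_def algebra_simps)
  qed
  define k where "k = jcomm g c"
  have lev: "lev m k" for m
    unfolding k_def by (rule jcomm_lead(5)[OF gJ cJ]) (simp_all only: D P_zero)
  have "ea k - 1 = 0" "eb k = 0" "ec k = 0" "ed k - 1 = 0"
    by (rule P_all_imp_zero, use lev in \<open>simp add: lev_def\<close>)+
  then have k1: "ea k = 1" "eb k = 0" "ec k = 0" "ed k = 1" by simp_all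
  then have ktv: "k = tv (ex k) (ey k) (ew k)" by (simp add: tv_def elt.expand)
  have kN: "k \<in> N" unfolding k_def by (rule jcomm_normal[OF N g cJ])
  have lead: "f \<in> P (Suc b) \<and> f $ Suc b = 2 * u $ b"
    if u: "u \<in> P b" and s: "s \<in> P b" and f: "f = \<eta> * (2 * (t * u) - 2 * (t * t * s'))" "s' = \<Delta> * s" for f u s s'
  proof -
    have tu: "t * u \<in> P (Suc b)" "(t * u) $ Suc b = u $ b"
      using P_mult[OF t(1) u] P_mult_nth[OF t(1) u] t(2) F_e P_coeff[OF u] by auto
    have "t * t * s' \<in> P (Suc (Suc b))"
      using P_mult[OF P_mult[OF t(1) t(1)] P_mult_left[OF s, of \<Delta>]] by (simp add: f(2))
    then have ts: "2 * (t * t * s') \<in> P (Suc (Suc b))" by (rule P_mult_left)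
    define q where "q = 2 * (t * u) - 2 * (t * t * s')"
    have q: "q \<in> P (Suc b)" unfolding q_def by (rule P_diff[OF P_mult_left[OF tu(1)] P_mono[OF _ ts]]) simp
    have "(\<eta> - 1) * q \<in> P (2 + Suc b)" by (rule P_mult[OF \<eta>(2) q])
    then have "(\<eta> - 1) * q \<in> P (Suc (Suc b))" by (rule P_mono[rotated]) simp
    moreover have "f - 2 * (t * u) = (\<eta> - 1) * q - 2 * (t * t * s')" by (simp add: f(1) q_def[symmetric]) (simp add: q_def algebra_simps)
    ultimately have d: "f - 2 * (t * u) \<in> P (Suc (Suc b))" using ts by (simp add: P_diff)
    have "f $ Suc b = (2 * (t * u)) $ Suc b" by (rule P_diff_Suc_nth[OF d])
    also have "\<dots> = 2 * u $ b" by (simp only: mult_2 fps_add_nth tu(2))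
    finally have "f $ Suc b = 2 * u $ b" .
    moreover have "f \<in> P (Suc b)" unfolding f(1) q_def[symmetric] by (rule P_mult_left[OF q])
    ultimately show ?thesis by blast
  qed
  \<comment> \<open>\<open>(u1, u2) = v Y\<close>. The vector of the commutator is
    \<open>v (C - 1)\<close> with leading term \<open>2 t v Y\<close>, and \<open>nd\<close> says
    that this does not vanish.\<close>
  define u1 where "u1 = ex g * \<alpha> + 2 * (ey g * \<gamma>)"
  define u2 where "u2 = 2 * (ex g * \<beta>) - ey g * \<alpha>"
  have nth: "(f * h) $ b = f $ b * h $ 0" if "f \<in> P b" "h \<in> P 0" for f h
    using P_mult_nth[OF that] by simp
  have u: "u1 \<in> P b" "u2 \<in> P b" unfolding u1_def u2_def
    using P_add[OF P_mult_right[OF v(1)] P_mult_left[OF P_mult_right[OF v(2)]]]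
      P_diff[OF P_mult_left[OF P_mult_right[OF v(1)]] P_mult_right[OF v(2)]] .
  have un: "u1 $ b = ex g $ b * (ea g - ed g) $ j + 2 * (ey g $ b * ec g $ j)"
    "u2 $ b = 2 * (ex g $ b * eb g $ j) - ey g $ b * (ea g - ed g) $ j"
    unfolding \<alpha>(3) \<beta>(3) \<gamma>(3) u1_def u2_def
    by (simp_all only: fps_add_nth fps_sub_nth mult_2 nth[OF v(1) \<alpha>(1)] nth[OF v(2) \<gamma>(1)]
        nth[OF v(1) \<beta>(1)] nth[OF v(2) \<alpha>(1)])
  have "ex k = ex g * (ea c - 1) + ey g * ec c" "ey k = ex g * eb c + ey g * (ed c - 1)"
    using jcomm_vec(1,2)[OF gJ cQ] k1 by (simp_all add: k_def)
  then have "ex k = \<eta> * (2 * (t * u1) - 2 * (t * t * (\<Delta> * ex g)))" "ey k = \<eta> * (2 * (t * u2) - 2 * (t * t * (\<Delta> * ey g)))"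
    unfolding c1 by (simp_all add: c_def u1_def u2_def algebra_simps)
  then have K: "ex k \<in> P (Suc b)" "ex k $ Suc b = 2 * u1 $ b" "ey k \<in> P (Suc b)" "ey k $ Suc b = 2 * u2 $ b"
    using lead[OF u(1) v(1) _ refl] lead[OF u(2) v(2) _ refl] by blast+
  have "u1 $ b \<noteq> 0 \<or> u2 $ b \<noteq> 0" using nd un by simp
  then have "ex k $ Suc b \<noteq> 0 \<or> ey k $ Suc b \<noteq> 0"
    using K F_two P_coeff[OF u(1)] P_coeff[OF u(2)] by metis
  then show thesis using that[of "ex k" "ey k" "ew k"] ktv kN K by simp
qed

text \<open>If the leading vector is not killed by the leading trace zero matrix,
  \<open>centralizer_step\<close> applies at once. Otherwise a commutator with \<open>upp t\<close>
  or \<open>low t\<close> shifts both depths by one and produces a pair that is not degenerate. Each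
  of the two commutators costs one level, hence \<open>b + 2\<close>.\<close>

lemma vector_step:
  assumes N: "N \<lhd> J" and g: "g \<in> N" and v: "ex g \<in> P b" "ey g \<in> P b" "ex g $ b \<noteq> 0 \<or> ey g $ b \<noteq> 0"
    and Y: "ea g - ed g \<in> P j" "eb g \<in> P j" "ec g \<in> P j" and j: "j \<ge> 1"
    and Y0: "(ea g - ed g) $ j \<noteq> 0 \<or> eb g $ j \<noteq> 0 \<or> ec g $ j \<noteq> 0"
  obtains b' x y w where "b' \<le> b + 2" "b' \<ge> b" "tv x y w \<in> N" "x \<in> P b'" "y \<in> P b'" "x $ b' \<noteq> 0 \<or> y $ b' \<noteq> 0"
proof -
  note outer = that
  have gJ: "g \<in> JC" using normal_JC[OF N] g by blast
  have JN: "jcomm g c \<in> N" if "inQ c" for c using jcomm_normal[OF N g] that by (simp add: inQ_def)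
  note ndF = F_no_zero_div
  have F: "ex g $ b \<in> F" "ey g $ b \<in> F" "(ea g - ed g) $ j \<in> F" "eb g $ j \<in> F" "ec g $ j \<in> F"
    using v Y P_coeff by blast+
  define t where "t = tpow 1"
  have t: "t \<in> P 1" "t $ 1 = e" using tpow_P tpow_nth by (auto simp: t_def)
  have tf: "t * f \<in> P (Suc i)" "(t * f) $ Suc i = f $ i" if "f \<in> P i" for f i
    using P_mult[OF t(1) that] P_mult_nth[OF t(1) that] t(2) F_e P_coeff[OF that] by auto
  let ?nd = "ex g $ b * (ea g - ed g) $ j + 2 * (ey g $ b * ec g $ j) \<noteq> 0 \<or>
      2 * (ex g $ b * eb g $ j) - ey g $ b * (ea g - ed g) $ j \<noteq> 0"
  have finish: thesis if k: "k \<in> N" "ex k \<in> P (Suc b)" "ey k \<in> P (Suc b)" "ea k - ed k \<in> P (Suc j)"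
      "eb k \<in> P (Suc j)" "ec k \<in> P (Suc j)"
      "ex k $ Suc b * (ea k - ed k) $ Suc j + 2 * (ey k $ Suc b * ec k $ Suc j) \<noteq> 0 \<or>
      2 * (ex k $ Suc b * eb k $ Suc j) - ey k $ Suc b * (ea k - ed k) $ Suc j \<noteq> 0" for k
  proof (rule centralizer_step[OF N k])
    fix x y w assume "tv x y w \<in> N" "x \<in> P (Suc (Suc b))" "y \<in> P (Suc (Suc b))" "x $ Suc (Suc b) \<noteq> 0 \<or> y $ Suc (Suc b) \<noteq> 0"
    then show thesis using outer[of "Suc (Suc b)"] by simp
  qed
  have general: "ex k - (ex g * (ea c - 1) + ey g * ec c) \<in> P (Suc (Suc b))"
    "ey k - (ex g * eb c + ey g * (ed c - 1)) \<in> P (Suc (Suc b))"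
    "(ea k - ed k) - (d1 - d4) \<in> P (Suc (Suc j))" "eb k - d2 \<in> P (Suc (Suc j))" "ec k - d3 \<in> P (Suc (Suc j))"
    if c: "inQ c" and k: "k = jcomm g c" and D: "ea (jmult g c) - ea (jmult c g) = d1" "eb (jmult g c) - eb (jmult c g) = d2"
      "ec (jmult g c) - ec (jmult c g) = d3" "ed (jmult g c) - ed (jmult c g) = d4"
    and P: "d1 \<in> P (Suc j)" "d2 \<in> P (Suc j)" "d3 \<in> P (Suc j)" "d4 \<in> P (Suc j)" for c k d1 d2 d3 d4
  proof -
    have cJ: "c \<in> JC" using c by (simp add: inQ_def)
    note L = jcomm_lead[OF gJ cJ, of "Suc j", unfolded D, OF P, folded k]
    have "(ea k - 1 - d1) - (ed k - 1 - d4) \<in> P (Suc (Suc j))" by (rule P_diff[OF L(1,4)])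
    then show "(ea k - ed k) - (d1 - d4) \<in> P (Suc (Suc j))" by (simp add: algebra_simps)
    show "eb k - d2 \<in> P (Suc (Suc j))" "ec k - d3 \<in> P (Suc (Suc j))" by (rule L)+
    have lk: "ea k - 1 \<in> P (Suc j)" "eb k \<in> P (Suc j)" "ec k \<in> P (Suc j)" "ed k - 1 \<in> P (Suc j)"
      using L(5) by (auto simp: lev_def)
    have Q: "f * h \<in> P (Suc (Suc b))" if "f \<in> P b" "h \<in> P (Suc j)" for f h
      by (rule P_mono[OF _ P_mult[OF that]]) (use j in simp)
    have eq: "ex k - (ex g * (ea c - 1) + ey g * ec c) = - (ex g * (ea k - 1) + ey g * ec k)"
      "ey k - (ex g * eb c + ey g * (ed c - 1)) = - (ex g * eb k + ey g * (ed k - 1))"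
      unfolding k jcomm_vec(1,2)[OF gJ c] by (simp_all add: algebra_simps)
    show "ex k - (ex g * (ea c - 1) + ey g * ec c) \<in> P (Suc (Suc b))"
      "ey k - (ex g * eb c + ey g * (ed c - 1)) \<in> P (Suc (Suc b))"
      unfolding eq
      using P_uminus[OF P_add[OF Q[OF v(1) lk(1)] Q[OF v(2) lk(3)]]]
        P_uminus[OF P_add[OF Q[OF v(1) lk(2)] Q[OF v(2) lk(4)]]] .
  qed
  have up: "f \<in> P i \<and> f $ i = h $ i" if "f - h \<in> P (Suc i)" "h \<in> P i" for f h i
    using P_add[OF P_mono[OF _ that(1), of i] that(2)] P_diff_Suc_nth[OF that(1)] by simp
  show thesis
  proof (cases ?nd)
    case True
    show thesis
      by (rule centralizer_step[OF N g v(1,2) Y True]) (rule that[of "Suc b"], simp_all)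
  next
    case False
    then have z: "ex g $ b * (ea g - ed g) $ j + 2 * (ey g $ b * ec g $ j) = 0"
      "2 * (ex g $ b * eb g $ j) - ey g $ b * (ea g - ed g) $ j = 0" by auto
    \<comment> \<open>If both products vanished together with the two entries of \<open>v Y\<close>,
      then the leading vector or the leading matrix would be zero.\<close>
    consider "ex g $ b * ec g $ j \<noteq> 0" | "ey g $ b * eb g $ j \<noteq> 0"
    proof -
      have False if h: "ex g $ b * ec g $ j = 0" "ey g $ b * eb g $ j = 0"
      proof (cases "ex g $ b = 0")
        case False
        then have "ec g $ j = 0" using ndF[OF F(1,5)] h by blast
        then have "ex g $ b * (ea g - ed g) $ j = 0" using z(1) by simp
        then have a0: "(ea g - ed g) $ j = 0" using ndF[OF F(1,3)] False by blast
        then have "2 * (ex g $ b * eb g $ j) = 0" using z(2) by simp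
        then have "ex g $ b * eb g $ j = 0" using F_two F_mult[OF F(1)] by blast
        then have "eb g $ j = 0" using ndF[OF F(1,4)] False by blast
        then show False using a0 \<open>ec g $ j = 0\<close> Y0 by simp
      next
        case True
        then have y0: "ey g $ b \<noteq> 0" using v by simp
        then have b0: "eb g $ j = 0" using ndF[OF F(2,4)] h by blast
        have "ey g $ b * (ea g - ed g) $ j = 0" using z(2) True by simp
        then have a0: "(ea g - ed g) $ j = 0" using ndF[OF F(2,3)] y0 by blast
        then have "2 * (ey g $ b * ec g $ j) = 0" using z(1) True by simp
        then have "ey g $ b * ec g $ j = 0" using F_two F_mult[OF F(2)] by blast
        then have "ec g $ j = 0" using ndF[OF F(2,5)] y0 by blast
        then show False using a0 b0 Y0 by simp
      qed
      then show thesis using that by blast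
    qed
    then show thesis
    proof cases
      case 1
      define k where "k = jcomm g (upp t)"
      have D: "ea (jmult g (upp t)) - ea (jmult (upp t) g) = - (t * ec g)"
        "eb (jmult g (upp t)) - eb (jmult (upp t) g) = t * (ea g - ed g)"
        "ec (jmult g (upp t)) - ec (jmult (upp t) g) = 0" "ed (jmult g (upp t)) - ed (jmult (upp t) g) = t * ec g"
        by (simp_all add: upp_def algebra_simps)
      have G: "ex k - 0 \<in> P (Suc (Suc b))" "ey k - t * ex g \<in> P (Suc (Suc b))"
        "(ea k - ed k) - (- (t * ec g) - t * ec g) \<in> P (Suc (Suc j))"
        "eb k - t * (ea g - ed g) \<in> P (Suc (Suc j))" "ec k - 0 \<in> P (Suc (Suc j))"
        using general[OF inQ_upp[OF t(1)] k_def D P_uminus[OF tf(1)[OF Y(3)]] tf(1)[OF Y(1)] P_zero tf(1)[OF Y(3)]]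
        by (simp_all add: upp_def mult.commute)
      have E: "ex k \<in> P (Suc b)" "ex k $ Suc b = 0" "ey k \<in> P (Suc b)" "ey k $ Suc b = ex g $ b"
        "ea k - ed k \<in> P (Suc j)" "(ea k - ed k) $ Suc j = - (2 * ec g $ j)"
        "eb k \<in> P (Suc j)" "ec k \<in> P (Suc j)" "ec k $ Suc j = 0"
        using up[OF G(1) P_zero] up[OF G(2) tf(1)[OF v(1)]] up[OF G(4) tf(1)[OF Y(1)]] up[OF G(5) P_zero]
          up[OF G(3) P_diff[OF P_uminus[OF tf(1)[OF Y(3)]] tf(1)[OF Y(3)]]]
          tf(2)[OF v(1)] tf(2)[OF Y(3)] by auto
      have "2 * (ex g $ b * ec g $ j) \<noteq> 0" using 1 F_two F_mult[OF F(1)] by blast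
      then show thesis
        by (intro finish[of k]) (use E JN[OF inQ_upp[OF t(1)]] in \<open>simp_all add: k_def[symmetric] mult.left_commute\<close>)
    next
      case 2
      define k where "k = jcomm g (low t)"
      have D: "ea (jmult g (low t)) - ea (jmult (low t) g) = t * eb g"
        "eb (jmult g (low t)) - eb (jmult (low t) g) = 0"
        "ec (jmult g (low t)) - ec (jmult (low t) g) = - (t * (ea g - ed g))"
        "ed (jmult g (low t)) - ed (jmult (low t) g) = - (t * eb g)"
        by (simp_all add: low_def algebra_simps)
      have G: "ex k - t * ey g \<in> P (Suc (Suc b))" "ey k - 0 \<in> P (Suc (Suc b))"
        "(ea k - ed k) - (t * eb g - - (t * eb g)) \<in> P (Suc (Suc j))"
        "eb k - 0 \<in> P (Suc (Suc j))" "ec k - - (t * (ea g - ed g)) \<in> P (Suc (Suc j))"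
        using general[OF inQ_low[OF t(1)] k_def D tf(1)[OF Y(2)] P_zero P_uminus[OF tf(1)[OF Y(1)]] P_uminus[OF tf(1)[OF Y(2)]]]
        by (simp_all add: low_def mult.commute)
      have E: "ex k \<in> P (Suc b)" "ex k $ Suc b = ey g $ b" "ey k \<in> P (Suc b)" "ey k $ Suc b = 0"
        "ea k - ed k \<in> P (Suc j)" "(ea k - ed k) $ Suc j = 2 * eb g $ j"
        "eb k \<in> P (Suc j)" "ec k \<in> P (Suc j)" "eb k $ Suc j = 0"
        using up[OF G(2) P_zero] up[OF G(1) tf(1)[OF v(2)]] up[OF G(5) P_uminus[OF tf(1)[OF Y(1)]]] up[OF G(4) P_zero]
          up[OF G(3) P_diff[OF tf(1)[OF Y(2)] P_uminus[OF tf(1)[OF Y(2)]]]]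
          tf(2)[OF v(2)] tf(2)[OF Y(2)] by auto
      have "2 * (ey g $ b * eb g $ j) \<noteq> 0" using 2 F_two F_mult[OF F(2)] by blast
      then show thesis
        by (intro finish[of k]) (use E JN[OF inQ_low[OF t(1)]] in \<open>simp_all add: k_def[symmetric] mult.left_commute\<close>)
    qed
  qed
qed

text \<open>If the trace zero part of the matrix vanishes, the matrix is a scalar with square 1 and
  congruent to 1 modulo \<open>t\<close>, hence 1 as \<open>p\<close> is odd, and \<open>g\<close>
  already has the desired form. Otherwise \<open>vector_step\<close> applies at the depth of the
  trace zero part.\<close>

lemma vector_exists:
  assumes N: "N \<lhd> J" and g: "g \<in> N" and v: "ex g \<in> P b" "ey g \<in> P b" "ex g $ b \<noteq> 0 \<or> ey g $ b \<noteq> 0"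
  obtains b' x y w where "b' \<le> b + 2" "b' \<ge> b" "tv x y w \<in> N" "x \<in> P b'" "y \<in> P b'" "x $ b' \<noteq> 0 \<or> y $ b' \<noteq> 0"
proof (cases "ea g - ed g = 0 \<and> eb g = 0 \<and> ec g = 0")
  case True
  have gJ: "g \<in> JC" using normal_JC[OF N] g by blast
  define f where "f = ea g - 1"
  have "ea g * ea g = 1" using JC_det[OF gJ] True by simp
  then have ff: "2 * f = - (f * f)" by (simp add: f_def algebra_simps)
  have fP: "f \<in> P 1" using JC_lev[OF gJ] by (simp add: f_def lev_def)
  have "f \<in> P k" for k
  proof (rule ccontr)
    assume nk: "f \<notin> P k"
    obtain n where n: "1 \<le> n" "n < k" "f \<in> P n" "f $ n \<noteq> 0" by (rule P_val[OF fP nk])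
    have "(f * f) $ n = 0" using P_coeff_0[OF P_mult[OF n(3,3)], of n] n(1) by simp
    then have "(2 * f) $ n = 0" unfolding ff by simp
    then have "2 * f $ n = 0" by (simp only: mult_2 fps_add_nth)
    then show False using F_two P_coeff[OF n(3)] n(4) by blast
  qed
  then have "f = 0" by (rule P_all_imp_zero)
  then have "ea g = 1" "ed g = 1" using True by (auto simp: f_def)
  then have "g = tv (ex g) (ey g) (ew g)" using True by (simp add: tv_def elt.expand)
  then show thesis using that[of b "ex g" "ey g" "ew g"] v g by simp
next
  case False
  have gJ: "g \<in> JC" using normal_JC[OF N] g by blast
  have lev: "lev 1 g" by (rule JC_lev[OF gJ])
  let ?all = "\<lambda>k. ea g - ed g \<in> P k \<and> eb g \<in> P k \<and> ec g \<in> P k"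
  have "(ea g - 1) - (ed g - 1) \<in> P 1" by (rule P_diff) (use lev in \<open>simp_all add: lev_def\<close>)
  then have 1: "?all 1" using lev by (simp add: lev_def)
  have "\<exists>k. \<not> ?all k" using False P_all_imp_zero by blast
  define j where "j = (LEAST k. \<not> ?all (Suc k))"
  have ex: "\<exists>k. \<not> ?all (Suc k)" using \<open>\<exists>k. \<not> ?all k\<close> by (metis P_Suc_iff)
  have j: "\<not> ?all (Suc j)" unfolding j_def by (rule LeastI_ex[OF ex])
  have j0: "j \<noteq> 0" using j 1 by (metis One_nat_def)
  then obtain i where i: "j = Suc i" by (cases j) auto
  have "?all (Suc i)" using not_less_Least[of i "\<lambda>k. \<not> ?all (Suc k)"] i unfolding j_def[symmetric] by blast
  then have all: "ea g - ed g \<in> P j" "eb g \<in> P j" "ec g \<in> P j" by (simp_all add: i)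
  have nz: "(ea g - ed g) $ j \<noteq> 0 \<or> eb g $ j \<noteq> 0 \<or> ec g $ j \<noteq> 0"
    using j all by (simp only: P_Suc_iff) blast
  have j1: "j \<ge> 1" using j0 by simp
  show thesis by (rule vector_step[OF N g v all j1 nz]) (rule that)
qed

text \<open>Up to bounded error a normal subgroup is determined by the depths \<open>n\<close> and \<open>b\<close> of its matrix part and
  its vector part.\<close>

theorem normal_sandwich:
  assumes N: "N \<lhd> J" and GK: "GK M \<subseteq> N" and M: "M \<ge> 1"
  obtains n b where "1 \<le> n" "n \<le> M" "1 \<le> b" "b \<le> M" "N \<subseteq> MM n b 0" "MM (n + 10) (b + 8) (b + 8) \<subseteq> N"
proof -
  have NJ: "N \<subseteq> JC" by (rule normal_JC[OF N])
  have mM: "tpow M \<in> P 1" by (rule P_mono[OF M tpow_P])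
  have nM: "tpow M \<notin> P (Suc M)" using tpow_nz[of M] by (auto simp: P_Suc_iff)
  have depth: "\<exists>n. 1 \<le> n \<and> n \<le> M \<and> (\<forall>g\<in>N. Q n g) \<and> (\<exists>g\<in>N. \<not> Q (Suc n) g)"
    if Q1: "\<And>g. g \<in> N \<Longrightarrow> Q 1 g" and ex: "\<exists>g\<in>N. \<not> Q (Suc M) g" for Q :: "nat \<Rightarrow> 'r elt \<Rightarrow> bool"
  proof -
    define n where "n = (LEAST n. \<exists>g\<in>N. \<not> Q (Suc n) g)"
    have n: "\<exists>g\<in>N. \<not> Q (Suc n) g" unfolding n_def by (rule LeastI[of _ M]) (rule ex)
    have "n \<le> M" unfolding n_def by (rule Least_le) (rule ex)
    moreover have n0: "n \<noteq> 0" using n Q1 by (metis One_nat_def)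
    then obtain i where i: "n = Suc i" by (cases n) auto
    have "\<forall>g\<in>N. Q n g" using not_less_Least[of i "\<lambda>n. \<exists>g\<in>N. \<not> Q (Suc n) g"] i unfolding n_def[symmetric] by blast
    ultimately show ?thesis using n n0 by (intro exI[of _ n]) auto
  qed
  have "upp (tpow M) \<in> GK M"
    using upp_JC[OF mM] tpow_P[of M] by (simp add: GK_eq_MM MM_def lev_def upp_def)
  moreover have "\<not> lev (Suc M) (upp (tpow M))" using nM by (simp add: lev_def upp_def)
  ultimately have "\<exists>g\<in>N. \<not> lev (Suc M) g" using GK by blast
  then obtain n g0 where n: "1 \<le> n" "n \<le> M" "\<forall>g\<in>N. lev n g" and g0: "g0 \<in> N" "\<not> lev (Suc n) g0"
    using depth[of lev] JC_lev NJ by blast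
  obtain b where b: "1 \<le> b" "b \<le> M" "\<forall>g\<in>N. ex g \<in> P b \<and> ey g \<in> P b"
    and tv: "\<And>x y w. tv x y w \<in> JC \<Longrightarrow> x \<in> P (b + 8) \<Longrightarrow> y \<in> P (b + 8) \<Longrightarrow> w \<in> P (b + 8) \<Longrightarrow> tv x y w \<in> N"
  proof (cases V)
    case True
    have "vec1 (tpow M) \<in> GK M"
      using vec1_JC[OF mM True] tpow_P[of M] by (simp add: GK_eq_MM MM_def lev_def vec1_def)
    moreover have "\<not> (ex (vec1 (tpow M)) \<in> P (Suc M) \<and> ey (vec1 (tpow M)) \<in> P (Suc M))" using nM by (simp add: vec1_def)
    ultimately have "\<exists>g\<in>N. \<not> (ex g \<in> P (Suc M) \<and> ey g \<in> P (Suc M))" using GK by blast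
    moreover have "ex g \<in> P 1 \<and> ey g \<in> P 1" if "g \<in> N" for g using that NJ by (auto simp: JC_def)
    ultimately obtain b g where b: "1 \<le> b" "b \<le> M" "\<forall>g\<in>N. ex g \<in> P b \<and> ey g \<in> P b"
      and g: "g \<in> N" "\<not> (ex g \<in> P (Suc b) \<and> ey g \<in> P (Suc b))"
      using depth[of "\<lambda>b g. ex g \<in> P b \<and> ey g \<in> P b"] by blast
    have v: "ex g \<in> P b" "ey g \<in> P b" "ex g $ b \<noteq> 0 \<or> ey g $ b \<noteq> 0"
      using b(3) g by (auto simp: P_Suc_iff)
    obtain b' x y w where b': "b' \<le> b + 2" "b' \<ge> b" and xy: "tv x y w \<in> N" "x \<in> P b'" "y \<in> P b'" "x $ b' \<noteq> 0 \<or> y $ b' \<noteq> 0"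
      by (rule vector_exists[OF N g(1) v])
    \<comment> \<open>The 8 is \<open>2 + 6\<close>: two levels lost in \<open>vector_exists\<close>
      and six in \<open>normal_contains_tv\<close>.\<close>
    have "tv x y w \<in> N" if h: "tv x y w \<in> JC" "x \<in> P (b + 8)" "y \<in> P (b + 8)" "w \<in> P (b + 8)" for x y w
    proof (rule normal_contains_tv[OF N True xy(1) _ xy(2-4)])
      show "b' \<ge> 1" using b b' by simp
      show "restr S w = w" using h(1) by (simp add: JC_def)
    qed (use h(2-4) b'(1) in \<open>auto intro: P_mono[rotated]\<close>)
    then show thesis using that b by blast
  next
    case False
    have z: "ex g = 0 \<and> ey g = 0 \<and> ew g = 0" if "g \<in> JC" for g
    proof -
      have "V \<or> ex g = 0 \<and> ey g = 0" "restr S (ew g) = ew g" using that unfolding JC_def by blast+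
      then show ?thesis using False restr_nonV[OF False, of "ew g"] by simp
    qed
    have "El 1 0 0 1 0 0 0 \<in> N" using subgroup.one_closed[OF normal_imp_subgroup[OF N]] by (simp add: one_J)
    then have "tv x y w \<in> N" if "tv x y w \<in> JC" for x y w using z[OF that] by (simp add: tv_def)
    moreover have "\<forall>g\<in>N. ex g \<in> P 1 \<and> ey g \<in> P 1" using z NJ by auto
    ultimately show thesis using that[of 1] M by simp
  qed
  \<comment> \<open>Every commutator with a pure matrix pushes vector and centre down by at least
    one level. Chosen well, it raises the matrix depth by exactly one, so after \<open>r\<close>
    rounds the vectors are deep while the matrix is still only at \<open>n + r\<close>.\<close>
  have deep: "\<exists>g\<in>N. lev (n + r) g \<and> \<not> lev (Suc (n + r)) g \<and> ex g \<in> P (b + r) \<and> ey g \<in> P (b + r) \<and> (r \<ge> 1 \<longrightarrow> ew g \<in> P (b + r))" for r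
  proof (induction r)
    case 0
    then show ?case using n(3) g0 b(3) by auto
  next
    case (Suc r)
    then obtain g where g: "g \<in> N" "lev (n + r) g" "\<not> lev (Suc (n + r)) g" "ex g \<in> P (b + r)" "ey g \<in> P (b + r)" by blast
    have gJ: "g \<in> JC" using g NJ by blast
    define j where "j = n + r"
    have j1: "j \<ge> 1" using n by (simp add: j_def)
    define \<alpha> \<beta> \<gamma> where "\<alpha> = (ea g - 1) $ j" "\<beta> = eb g $ j" "\<gamma> = ec g $ j"
    have tr: "(ed g - 1) $ j = - \<alpha>" using lev_trace[OF gJ g(2)[folded j_def] j1] by (simp add: \<alpha>_\<beta>_\<gamma>_def(1))
    have nz: "\<alpha> \<noteq> 0 \<or> \<beta> \<noteq> 0 \<or> \<gamma> \<noteq> 0"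
    proof (rule ccontr)
      assume z: "\<not> ?thesis"
      then have "(ed g - 1) $ j = 0" using tr by simp
      then have "lev (Suc j) g"
        using z g(2)[folded j_def] unfolding lev_def \<alpha>_\<beta>_\<gamma>_def P_Suc_iff by blast
      then show False using g(3) by (simp add: j_def)
    qed
    have l: "lead {h. h = g} j \<alpha> \<beta> \<gamma>" using g(2) by (auto simp: lead_def \<alpha>_\<beta>_\<gamma>_def j_def)
    have Pj: "eb g \<in> P j" "ec g \<in> P j" "ea g - 1 \<in> P j" "ed g - 1 \<in> P j" using g(2) by (auto simp: lev_def j_def)
    have ad: "ea g - ed g \<in> P j" "(ea g - ed g) $ j = 2 * \<alpha>"
    proof -
      have "(ea g - 1) - (ed g - 1) \<in> P j" by (rule P_diff[OF Pj(3,4)])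
      then show "ea g - ed g \<in> P j" by simp
      have "(ea g - ed g) $ j = (ea g - 1) $ j - (ed g - 1) $ j" by simp
      then show "(ea g - ed g) $ j = 2 * \<alpha>" by (simp only: tr \<alpha>_\<beta>_\<gamma>_def(1)[symmetric] diff_minus_eq_add mult_2)
    qed
    define t where "t = tpow 1"
    have t: "t \<in> P 1" "t $ 1 = e" using tpow_P tpow_nth by (auto simp: t_def)
    have tf: "t * f \<in> P (Suc j)" "(t * f) $ Suc j = f $ j" if "f \<in> P j" for f
      using P_mult[OF t(1) that] P_mult_nth[OF t(1) that] t(2) F_e P_coeff[OF that] by auto
    have aF: "\<alpha> \<in> F" using P_coeff[OF Pj(3), of j] unfolding \<alpha>_\<beta>_\<gamma>_def(1) .
    \<comment> \<open>The bracket with \<open>upp t\<close> has leading entries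
      \<open>- \<gamma>\<close> and \<open>2 \<alpha>\<close>, the one with \<open>low t\<close> has
      \<open>\<beta>\<close> on the diagonal; one of them survives.\<close>
    obtain c where c: "inQ c" and lc: "lev (Suc j) (jcomm g c)" "\<not> lev (Suc (Suc j)) (jcomm g c)"
    proof (cases "\<alpha> \<noteq> 0 \<or> \<gamma> \<noteq> 0")
      case True
      have uJ: "upp t \<in> JC" by (rule upp_JC[OF t(1)])
      have D: "ea (jmult g (upp t)) - ea (jmult (upp t) g) = - (t * ec g)" "eb (jmult g (upp t)) - eb (jmult (upp t) g) = t * (ea g - ed g)"
        "ec (jmult g (upp t)) - ec (jmult (upp t) g) = 0" "ed (jmult g (upp t)) - ed (jmult (upp t) g) = t * ec g"
        by (simp_all add: upp_def algebra_simps)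
      note L = jcomm_lead[OF gJ uJ, of "Suc j", unfolded D, OF P_uminus[OF tf(1)[OF Pj(2)]] tf(1)[OF ad(1)] P_zero tf(1)[OF Pj(2)]]
      have "\<not> lev (Suc (Suc j)) (jcomm g (upp t))"
      proof
        assume "lev (Suc (Suc j)) (jcomm g (upp t))"
        then have "(ea (jcomm g (upp t)) - 1) $ Suc j = 0" "eb (jcomm g (upp t)) $ Suc j = 0"
          unfolding lev_def using P_coeff_0 by blast+
        then have "(- (t * ec g)) $ Suc j = 0" "(t * (ea g - ed g)) $ Suc j = 0"
          using P_diff_Suc_nth[OF L(1)] P_diff_Suc_nth[OF L(2)] by simp_all
        then have "\<gamma> = 0" "2 * \<alpha> = 0" using tf(2)[OF Pj(2)] tf(2)[OF ad(1)] ad(2) by (simp_all add: \<alpha>_\<beta>_\<gamma>_def(3))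
        then show False using True F_two[OF aF] by blast
      qed
      then show thesis using that[OF inQ_upp[OF t(1)]] L(5) by blast
    next
      case False
      then have b0: "\<beta> \<noteq> 0" using nz by simp
      have uJ: "low t \<in> JC" by (rule low_JC[OF t(1)])
      have D: "ea (jmult g (low t)) - ea (jmult (low t) g) = t * eb g" "eb (jmult g (low t)) - eb (jmult (low t) g) = 0"
        "ec (jmult g (low t)) - ec (jmult (low t) g) = - (t * (ea g - ed g))" "ed (jmult g (low t)) - ed (jmult (low t) g) = - (t * eb g)"
        by (simp_all add: low_def algebra_simps)
      note L = jcomm_lead[OF gJ uJ, of "Suc j", unfolded D, OF tf(1)[OF Pj(1)] P_zero P_uminus[OF tf(1)[OF ad(1)]] P_uminus[OF tf(1)[OF Pj(1)]]]
      have "\<not> lev (Suc (Suc j)) (jcomm g (low t))"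
      proof
        assume "lev (Suc (Suc j)) (jcomm g (low t))"
        then have "(ea (jcomm g (low t)) - 1) $ Suc j = 0" unfolding lev_def using P_coeff_0 by blast
        then have "(t * eb g) $ Suc j = 0" using P_diff_Suc_nth[OF L(1)] by simp
        then show False using tf(2)[OF Pj(1)] b0 by (simp add: \<alpha>_\<beta>_\<gamma>_def(2))
      qed
      then show thesis using that[OF inQ_low[OF t(1)]] L(5) by blast
    qed
    have cJ: "c \<in> JC" using c by (simp add: inQ_def)
    have "jcomm g c \<in> N" by (rule jcomm_normal[OF N g(1) cJ])
    then show ?case
      using lc jcomm_vec_P[OF gJ c g(4,5)] by (intro bexI[of _ "jcomm g c"]) (simp_all add: j_def)
  qed
  \<comment> \<open>From depth \<open>m\<close> on, all vectors and central elements lie in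
    \<open>N\<close>, so within \<open>N'\<close> only matrices matter. Eight rounds of
    \<open>deep\<close> give an element of \<open>N'\<close> with matrix depth \<open>n + 8\<close>,
    and \<open>lead_all\<close> needs two more levels: this is the 10.\<close>
  define m where "m = b + 8"
  define N' where "N' = {g \<in> N. ex g \<in> P m \<and> ey g \<in> P m \<and> ew g \<in> P m}"
  have Q: "Qclosed N'"
    unfolding Qclosed_def
  proof (intro conjI ballI allI impI)
    show "N' \<subseteq> JC" using NJ by (auto simp: N'_def)
    show "El 1 0 0 1 0 0 0 \<in> N'"
      using subgroup.one_closed[OF normal_imp_subgroup[OF N]] by (simp add: one_J N'_def)
    fix g assume g: "g \<in> N'"
    show "jmult g h \<in> N'" if h: "h \<in> N'" for h
      using g h normal_jmult[OF N] by (auto simp: N'_def intro!: P_add P_diff restr_P P_mult_right)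
    fix c assume c: "inQ c"
    have "ex (jcomm g c) \<in> P (Suc m)" "ey (jcomm g c) \<in> P (Suc m)" "ew (jcomm g c) \<in> P (Suc m)"
      using jcomm_vec_P[OF _ c] g NJ by (auto simp: N'_def)
    moreover have "jcomm g c \<in> N" using jcomm_normal[OF N] g c by (auto simp: N'_def inQ_def)
    ultimately show "jcomm g c \<in> N'" by (simp add: N'_def P_Suc_iff)
  qed
  obtain g where g: "g \<in> N" "lev (n + 8) g" "\<not> lev (Suc (n + 8)) g" "ex g \<in> P (b + 8)" "ey g \<in> P (b + 8)" "ew g \<in> P (b + 8)"
    using deep[of 8] by auto
  have gN': "g \<in> N'" using g by (simp add: N'_def m_def)
  have gJ: "g \<in> JC" using g NJ by blast
  define j where "j = n + 8"
  have j1: "j \<ge> 1" by (simp add: j_def)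
  have lead: "lead N' j ((ea g - 1) $ j) (eb g $ j) (ec g $ j)"
    using gN' g(2) by (auto simp: lead_def j_def)
  have nz: "(ea g - 1) $ j \<noteq> 0 \<or> eb g $ j \<noteq> 0 \<or> ec g $ j \<noteq> 0"
  proof (rule ccontr)
    assume z: "\<not> ?thesis"
    then have "(ed g - 1) $ j = 0" using lev_trace[OF gJ g(2)[folded j_def] j1] by simp
    then have "lev (Suc j) g" using z g(2)[folded j_def] unfolding lev_def P_Suc_iff by blast
    then show False using g(3) by (simp add: j_def)
  qed
  have GK': "GK (max M m) \<subseteq> N'"
  proof
    fix h assume h: "h \<in> GK (max M m)"
    then have "h \<in> N" using GK GK_mono[of M "max M m"] by auto
    moreover have "h \<in> GK m" using h GK_mono[of m "max M m"] by auto
    ultimately show "h \<in> N'" by (simp add: N'_def GK_eq_MM MM_def)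
  qed
  have "MM (n + 10) (b + 8) (b + 8) \<subseteq> N"
  proof
    fix h assume "h \<in> MM (n + 10) (b + 8) (b + 8)"
    then have h: "h \<in> JC" "lev (j + 2) h" "ex h \<in> P m" "ey h \<in> P m" "ew h \<in> P m"
      by (auto simp: MM_def j_def m_def add.commute)
    obtain q where q: "q \<in> N'" "Ap q = Ap h"
      by (rule lead_imp_matrices[OF Q GK' lead_all[OF Q lead nz j1] _ h(1,2)]) auto
    have qN: "q \<in> N" "q \<in> JC" using q NJ by (auto simp: N'_def)
    have V0: "V \<or> x = 0 \<and> y = 0" if "\<exists>g\<in>JC. x = ex g \<and> y = ey g" for x y using that by (auto simp: JC_def)
    have tvJ: "tv (ex g) (ey g) (ew g) \<in> JC" if "g \<in> JC" for g
      using that by (auto simp: JC_def)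
    have t1: "tv (ex q) (ey q) (ew q) \<in> N" "tv (ex h) (ey h) (ew h) \<in> N"
      using tv tvJ qN h q by (auto simp: N'_def m_def)
    have prod: "jmult (Ap g) (tv (ex g) (ey g) (ew g)) = g" for g
      by (simp add: elt.expand Ap_def)
    have "Ap h = jmult q (jinv (tv (ex q) (ey q) (ew q)))"
      unfolding q(2)[symmetric] by (simp add: elt.expand Ap_def)
    then have "Ap h \<in> N" using normal_jmult[OF N qN(1) normal_jinv[OF N t1(1)]] by simp
    then show "h \<in> N" using normal_jmult[OF N _ t1(2)] prod[of h] by metis
  qed
  moreover have "N \<subseteq> MM n b 0" using NJ n(3) b(3) by (auto simp: MM_def JC_def)
  ultimately show thesis using that n b by blast
qed

end

subsection \<open>Counting\<close>

context jacobi
begin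

section \<open>Upper bounds for subgroups and normal subgroups\<close>

definition \<sigma> :: "nat \<Rightarrow> nat" where "\<sigma> n = card (S \<inter> {..<n})"

lemma \<sigma>_le: "\<sigma> n \<le> n"
  using card_mono[of "{..<n}" "S \<inter> {..<n}"] by (simp add: \<sigma>_def)

lemma \<sigma>_mono: "m \<le> n \<Longrightarrow> \<sigma> m \<le> \<sigma> n"
  unfolding \<sigma>_def by (intro card_mono) auto

text \<open>Three matrix entries, two vector entries and one central coordinate per
  exponent.\<close>

lemma index_exp_le: "index_exp n \<le> 6 * n"
  using \<sigma>_le[of n] unfolding index_exp_def \<sigma>_def by (cases n; simp)

lemma p_power_le: "p ^ T \<le> 2 ^ (p * T)"
  using power_mono[of p "2 ^ p" T] by (simp add: power_mult less_imp_le)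

text \<open>The quotient by \<open>GK (4 * k + 4)\<close> has order \<open>p^T\<close> with
  \<open>T \<le> 6 * (4 * k + 4) = 24 * (k + 1)\<close>, and \<open>p^T \<le> 2^(p * T)\<close>
  bounds the number of generators.\<close>

lemma subgroups_upper:
  shows "finite (subgroups_of_index J (p ^ k))"
    and "card (subgroups_of_index J (p ^ k)) \<le> p ^ (p * (24 * (k + 1)) * (24 * (k + 1)))"
proof -
  define T where "T = index_exp (4 * k + 4)"
  have T: "T \<le> 24 * (k + 1)" using index_exp_le[of "4 * k + 4"] by (simp add: T_def)
  let ?I = "{H. subgroup H J \<and> GK (4 * k + 4) \<subseteq> H \<and> H \<subseteq> carrier J}"
  have sub: "subgroups_of_index J (p ^ k) \<subseteq> ?I"
    using finite_index_contains_GK subgroup.subset by (fastforce simp: subgroups_of_index_def)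
  have fin: "finite ((\<lambda>x. GK (4 * k + 4) #>\<^bsub>J\<^esub> x) ` carrier J)"
    using GK_finite_index[of "4 * k + 4"] by (simp add: J.rcosets_eq_image)
  have card: "card ((\<lambda>x. GK (4 * k + 4) #>\<^bsub>J\<^esub> x) ` carrier J) \<le> p ^ T"
    using GK_index[of "4 * k + 4"] by (simp add: J.rcosets_eq_image T_def)
  note I = J.card_intermediate_subgroups[OF GK_subgroup order_refl fin card p_power_le]
  show "finite (subgroups_of_index J (p ^ k))" using finite_subset[OF sub I(1)] .
  have "card (subgroups_of_index J (p ^ k)) \<le> (p ^ T) ^ (p * T)"
    using card_mono[OF I(1) sub] I(2) by simp
  also have "\<dots> = p ^ (p * T * T)" by (simp add: power_mult[symmetric] ac_simps)
  also have "\<dots> \<le> p ^ (p * (24 * (k + 1)) * (24 * (k + 1)))"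
    using T p_gt_2 by (intro power_increasing mult_mono) auto
  finally show "card (subgroups_of_index J (p ^ k)) \<le> p ^ (p * (24 * (k + 1)) * (24 * (k + 1)))" .
qed

lemma card_image_le_of_kernel:
  assumes "finite T" "\<tau> ` A \<subseteq> T" and "\<And>x y. x \<in> A \<Longrightarrow> y \<in> A \<Longrightarrow> \<tau> x = \<tau> y \<Longrightarrow> q x = q y"
  shows "finite (q ` A)" and "card (q ` A) \<le> card T"
proof -
  have "q ` A \<subseteq> (\<lambda>t. q (inv_into A \<tau> t)) ` (\<tau> ` A)"
  proof
    fix z assume "z \<in> q ` A"
    then obtain x where x: "x \<in> A" "z = q x" by blast
    have "\<tau> x \<in> \<tau> ` A" using x by blast
    then have "q (inv_into A \<tau> (\<tau> x)) = q x"
      using assms(3)[OF inv_into_into x(1)] f_inv_into_f by metis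
    with x have "z = q (inv_into A \<tau> (\<tau> x))" by simp
    then show "z \<in> (\<lambda>t. q (inv_into A \<tau> t)) ` (\<tau> ` A)"
      using \<open>\<tau> x \<in> \<tau> ` A\<close> by (rule image_eqI)
  qed
  moreover have fin: "finite (\<tau> ` A)" using assms(1,2) finite_subset by blast
  ultimately show "finite (q ` A)" "card (q ` A) \<le> card T"
    using finite_surj surj_card_le[of "\<tau> ` A" "q ` A"] card_mono[OF assms(1,2)] by (blast, force)
qed

text \<open>\<open>56 = 4 * 10 + 2 * 8\<close> counts the coefficients of four matrix and two vector
  entries between the two depths; all four matrix entries are recorded, which is good enough for an
  upper bound. The centre contributes the exponents of \<open>S\<close> below
  \<open>b + 8\<close>.\<close>

lemma MM_index_le:
  shows "finite ((\<lambda>x. MM (n + 10) (b + 8) (b + 8) #>\<^bsub>J\<^esub> x) ` MM n b 0)"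
    and "card ((\<lambda>x. MM (n + 10) (b + 8) (b + 8) #>\<^bsub>J\<^esub> x) ` MM n b 0) \<le> p ^ (56 + \<sigma> (b + 8))"
proof -
  define \<tau> where "\<tau> g = (trunc (n + 10) (ea g - 1), trunc (n + 10) (eb g), trunc (n + 10) (ec g), trunc (n + 10) (ed g - 1),
      trunc (b + 8) (ex g), trunc (b + 8) (ey g), trunc (b + 8) (ew g))" for g
  define T where "T = supported {n..<n + 10} \<times> supported {n..<n + 10} \<times> supported {n..<n + 10} \<times> supported {n..<n + 10} \<times>
      supported {b..<b + 8} \<times> supported {b..<b + 8} \<times> supported (S \<inter> {..<b + 8})"
  have finT: "finite T" by (simp add: T_def card_supported)
  have s: "trunc (m + l) f \<in> supported {m..<m + l}" if "f \<in> P m" for f m l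
    using that by (auto simp: trunc_def supported_def P_def)
  have sS: "trunc l f \<in> supported (S \<inter> {..<l})" if "f \<in> P 0" "restr S f = f" for f l
  proof -
    have "f $ i = 0" if "i \<notin> S" for i using that \<open>restr S f = f\<close> by (metis restr_nth)
    then show ?thesis using that by (auto simp: trunc_def supported_def P_def)
  qed
  have sub: "\<tau> ` MM n b 0 \<subseteq> T"
  proof (rule image_subsetI)
    fix g assume g: "g \<in> MM n b 0"
    have "restr S (ew g) = ew g" using g unfolding MM_def JC_def by blast
    then show "\<tau> g \<in> T"
      using g s sS unfolding \<tau>_def T_def MM_def lev_def by auto
  qed
  have cardT: "card T = p ^ (56 + \<sigma> (b + 8))"
    by (simp add: T_def card_cartesian_product card_supported \<sigma>_def power_add[symmetric])
  have K: "subgroup (MM (n + 10) (b + 8) (b + 8)) J" by (rule MM_subgroup) simp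
  have ker: "MM (n + 10) (b + 8) (b + 8) #>\<^bsub>J\<^esub> g = MM (n + 10) (b + 8) (b + 8) #>\<^bsub>J\<^esub> h"
    if gh: "g \<in> MM n b 0" "h \<in> MM n b 0" "\<tau> g = \<tau> h" for g h
  proof -
    have J: "g \<in> JC" "h \<in> JC" using gh by (auto simp: MM_def)
    have tr: "f - f' \<in> P m" if "trunc m f = trunc m f'" "f \<in> P l" "f' \<in> P l" for f f' m l
      using that trunc_eq_iff[of f f' m] P_mono[of 0 l "f - f'"] P_diff by blast
    have gP: "ea g - 1 \<in> P n" "eb g \<in> P n" "ec g \<in> P n" "ed g - 1 \<in> P n" "ex g \<in> P b" "ey g \<in> P b" "ew g \<in> P 0"
      and hP: "ea h - 1 \<in> P n" "eb h \<in> P n" "ec h \<in> P n" "ed h - 1 \<in> P n" "ex h \<in> P b" "ey h \<in> P b" "ew h \<in> P 0"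
      using gh by (auto simp: MM_def lev_def)
    have eq: "trunc (n + 10) (ea g - 1) = trunc (n + 10) (ea h - 1)" "trunc (n + 10) (eb g) = trunc (n + 10) (eb h)"
      "trunc (n + 10) (ec g) = trunc (n + 10) (ec h)" "trunc (n + 10) (ed g - 1) = trunc (n + 10) (ed h - 1)"
      "trunc (b + 8) (ex g) = trunc (b + 8) (ex h)" "trunc (b + 8) (ey g) = trunc (b + 8) (ey h)"
      "trunc (b + 8) (ew g) = trunc (b + 8) (ew h)"
      using gh(3) by (auto simp: \<tau>_def)
    have "(ea g - 1) - (ea h - 1) \<in> P (n + 10)" "(ed g - 1) - (ed h - 1) \<in> P (n + 10)"
      by (rule tr[OF eq(1) gP(1) hP(1)], rule tr[OF eq(4) gP(4) hP(4)])
    then have d: "ea g - ea h \<in> P (n + 10)" "ed g - ed h \<in> P (n + 10)" by simp_all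
    have d': "eb g - eb h \<in> P (n + 10)" "ec g - ec h \<in> P (n + 10)" "ex g - ex h \<in> P (b + 8)"
      "ey g - ey h \<in> P (b + 8)" "ew g - ew h \<in> P (b + 8)"
      by (rule tr[OF eq(2) gP(2) hP(2)], rule tr[OF eq(3) gP(3) hP(3)], rule tr[OF eq(5) gP(5) hP(5)],
          rule tr[OF eq(6) gP(6) hP(6)], rule tr[OF eq(7) gP(7) hP(7)])
    have det: "ea h * ed h - eb h * ec h = 1" by (rule JC_det[OF J(2)])
    define q where "q = jmult g (jinv h)"
    have A: "ea q - 1 = (ea g - ea h) * ed h - (eb g - eb h) * ec h + ((ea h * ed h - eb h * ec h) - 1)"
      "eb q = (eb g - eb h) * ea h - (ea g - ea h) * eb h"
      "ec q = (ec g - ec h) * ed h - (ed g - ed h) * ec h"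
      "ed q - 1 = (ed g - ed h) * ea h - (ec g - ec h) * eb h + ((ea h * ed h - eb h * ec h) - 1)"
      "ex q = (ex g - ex h) * ed h - (ey g - ey h) * ec h"
      "ey q = (ey g - ey h) * ea h - (ex g - ex h) * eb h"
      by (simp_all add: q_def algebra_simps)
    have "(ex g * ed h - ey g * ec h) * (ex h * eb h - ey h * ea h) - (ey g * ea h - ex g * eb h) * (ey h * ec h - ex h * ed h)
      = - ((ea h * ed h - eb h * ec h) * (ex g * ey h - ey g * ex h))"
      by (simp add: algebra_simps)
    also have "\<dots> = (ey g - ey h) * ex h - (ex g - ex h) * ey h" unfolding det by (simp add: algebra_simps)
    finally have W: "ew q = (ew g - ew h) + restr S ((ey g - ey h) * ex h - (ex g - ex h) * ey h)"
      by (simp add: q_def)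
    have "q \<in> MM (n + 10) (b + 8) (b + 8)"
      unfolding MM_def lev_def
    proof (intro CollectI conjI)
      show "q \<in> JC" unfolding q_def by (rule jmult_closed[OF J(1) jinv_closed[OF J(2)]])
      show "ea q - 1 \<in> P (n + 10)" "eb q \<in> P (n + 10)" "ec q \<in> P (n + 10)" "ed q - 1 \<in> P (n + 10)"
        unfolding A det using d d' by (simp_all add: P_diff P_mult_right)
      show "ex q \<in> P (b + 8)" "ey q \<in> P (b + 8)"
        unfolding A using d' by (simp_all add: P_diff P_mult_right)
      show "ew q \<in> P (b + 8)"
        unfolding W
        by (rule P_add[OF d'(5) restr_P[OF P_diff[OF P_mult_right[OF d'(4)] P_mult_right[OF d'(3)]]]])
    qed
    then show ?thesis
      using J.rcos_eq_iff[OF K, of g h] J by (simp add: carrier_J mult_J inv_J q_def)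
  qed
  show "finite ((\<lambda>x. MM (n + 10) (b + 8) (b + 8) #>\<^bsub>J\<^esub> x) ` MM n b 0)"
    "card ((\<lambda>x. MM (n + 10) (b + 8) (b + 8) #>\<^bsub>J\<^esub> x) ` MM n b 0) \<le> p ^ (56 + \<sigma> (b + 8))"
    unfolding cardT[symmetric]
    by (rule card_image_le_of_kernel[OF finT sub], erule (2) ker)+
qed

definition between :: "nat \<Rightarrow> nat \<Rightarrow> 'r elt set set" where
  "between n b = {H. subgroup H J \<and> MM (n + 10) (b + 8) (b + 8) \<subseteq> H \<and> H \<subseteq> MM n b 0}"

lemma card_between:
  assumes "56 + \<sigma> (b + 8) \<le> E"
  shows "finite (between n b)" and "card (between n b) \<le> p ^ (p * E * E)"
proof -
  have "p ^ (56 + \<sigma> (b + 8)) \<le> p ^ E" using assms p_gt_2 by (intro power_increasing) auto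
  then have c: "card ((\<lambda>x. MM (n + 10) (b + 8) (b + 8) #>\<^bsub>J\<^esub> x) ` MM n b 0) \<le> p ^ E"
    using MM_index_le(2)[of n b] by simp
  have K: "subgroup (MM (n + 10) (b + 8) (b + 8)) J" by (rule MM_subgroup) simp
  have B: "MM n b 0 \<subseteq> carrier J" by (auto simp: MM_def carrier_J)
  note I = J.card_intermediate_subgroups[OF K B MM_index_le(1) c p_power_le]
  show "finite (between n b)" unfolding between_def by (rule I(1))
  have "card (between n b) \<le> (p ^ E) ^ (p * E)" unfolding between_def by (rule I(2))
  also have "\<dots> = p ^ (p * E * E)" by (simp add: power_mult[symmetric] ac_simps)
  finally show "card (between n b) \<le> p ^ (p * E * E)" .
qed

lemma normal_between:
  assumes "N \<in> normal_subgroups_of_index J (p ^ k)"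
  obtains n b where "1 \<le> n" "n \<le> 4 * k + 4" "1 \<le> b" "b \<le> 4 * k + 4" "N \<in> between n b"
proof -
  have N: "N \<lhd> J" "finite (rcosets\<^bsub>J\<^esub> N)" "card (rcosets\<^bsub>J\<^esub> N) = p ^ k"
    using assms by (auto simp: normal_subgroups_of_index_def)
  have Ns: "subgroup N J" by (rule normal_imp_subgroup[OF N(1)])
  have "GK (4 * k + 4) \<subseteq> N" using finite_index_contains_GK[OF Ns N(2)] N(3) by simp
  then show thesis
    by (rule normal_sandwich[OF N(1)]) (use that Ns in \<open>auto simp: between_def\<close>)
qed

lemma normal_finite: "finite (normal_subgroups_of_index J n)" if "finite (subgroups_of_index J n)" for n
proof (rule finite_subset[OF _ that])
  show "normal_subgroups_of_index J n \<subseteq> subgroups_of_index J n"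
    using normal_imp_subgroup by (auto simp: normal_subgroups_of_index_def subgroups_of_index_def)
qed

text \<open>The linear factors count the pairs of depths. For given depths the section between the
  two \<open>MM\<close> has at most \<open>p^E\<close> cosets, since
  \<open>b + 8 \<le> 4 * k + 12\<close>.\<close>

lemma normals_upper:
  assumes E: "56 + \<sigma> (4 * k + 12) \<le> E"
  shows "card (normal_subgroups_of_index J (p ^ k)) \<le> (4 * k + 4) * (4 * k + 4) * p ^ (p * E * E)"
proof -
  let ?I = "{1..4 * k + 4} \<times> {1..4 * k + 4}"
  have b: "finite (between n b) \<and> card (between n b) \<le> p ^ (p * E * E)" if "b \<le> 4 * k + 4" for n b
  proof -
    have "56 + \<sigma> (b + 8) \<le> E" using \<sigma>_mono[of "b + 8" "4 * k + 12"] that E by simp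
    then show ?thesis using card_between by blast
  qed
  have "normal_subgroups_of_index J (p ^ k) \<subseteq> (\<Union>z\<in>?I. between (fst z) (snd z))"
    by (rule subsetI, erule normal_between) force
  moreover have "finite (\<Union>z\<in>?I. between (fst z) (snd z))" using b by auto
  ultimately have "card (normal_subgroups_of_index J (p ^ k)) \<le> card (\<Union>z\<in>?I. between (fst z) (snd z))"
    by (intro card_mono)
  also have "\<dots> \<le> (\<Sum>z\<in>?I. card (between (fst z) (snd z)))" by (rule card_UN_le) simp
  also have "\<dots> \<le> (\<Sum>z\<in>?I. p ^ (p * E * E))" using b by (intro sum_mono) auto
  also have "\<dots> = (4 * k + 4) * (4 * k + 4) * p ^ (p * E * E)"
    by (simp only: sum_constant card_cartesian_product card_atLeastAtMost of_nat_id diff_Suc_1 Suc_eq_plus1 add_diff_cancel_right')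
  finally show ?thesis .
qed

lemma index_dvd:
  assumes "subgroup H J" "subgroup K J" "K \<subseteq> H" "card (rcosets\<^bsub>J\<^esub> K) = p ^ T" "finite (rcosets\<^bsub>J\<^esub> K)"
  obtains k where "k \<le> T" "card (rcosets\<^bsub>J\<^esub> H) = p ^ k" "finite (rcosets\<^bsub>J\<^esub> H)"
proof -
  have "card (rcosets\<^bsub>J\<^esub> H) dvd p ^ T"
    using J.index_tower(2)[OF assms(2,1,3,5)] assms(4) by (metis dvd_triv_left)
  then obtain k where "k \<le> T" "card (rcosets\<^bsub>J\<^esub> H) = p ^ k" using divides_primepow_nat[OF prime, of _ T] by blast
  then show thesis using that J.index_tower(1)[OF assms(2,1,3,5)] by blast
qed

lemma index_le:
  assumes "subgroup H J" "subgroup K J" "K \<subseteq> H" "finite (rcosets\<^bsub>J\<^esub> K)"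
    "card (rcosets\<^bsub>J\<^esub> K) = p ^ T" "card (rcosets\<^bsub>J\<^esub> H) = p ^ k"
  shows "k \<le> T"
  using index_dvd[OF assms(1-3,5,4)] assms(6) p_gt_2
  by (metis One_nat_def Suc_lessD numeral_2_eq_2 power_inject_exp)

text \<open>Without vectors the sandwich reads
  \<open>GK (n + 10) \<subseteq> N \<subseteq> GK n\<close>, so
  \<open>3 * (n - 1) \<le> k \<le> 3 * (n + 9)\<close>: the index leaves a window of bounded length
  for \<open>n\<close>, and no factor growing with \<open>k\<close> remains.\<close>

lemma SL2_normals_upper:
  assumes V: "\<not> V"
  shows "card (normal_subgroups_of_index J (p ^ k)) \<le> 12 * p ^ (p * 56 * 56)"
proof -
  have MM: "MM i j l = MM i j' l'" for i j l j' l'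
  proof -
    have z: "ex g = 0 \<and> ey g = 0 \<and> ew g = 0" if "g \<in> JC" for g
    proof -
      have "V \<or> ex g = 0 \<and> ey g = 0" "restr S (ew g) = ew g" using that unfolding JC_def by blast+
      then show ?thesis using V restr_nonV[OF V, of "ew g"] by simp
    qed
    then show ?thesis by (auto simp: MM_def)
  qed
  have idx: "index_exp n = 3 * (n - 1)" for n
    unfolding index_exp_def using V S_empty[OF V] by simp
  have \<sigma>: "\<sigma> n = 0" for n unfolding \<sigma>_def using S_empty[OF V] by simp
  have sub: "normal_subgroups_of_index J (p ^ k) \<subseteq> (\<Union>n\<in>{k div 3 - 9..k div 3 + 1}. between n 1)"
  proof
    fix N assume N: "N \<in> normal_subgroups_of_index J (p ^ k)"
    then have N': "subgroup N J" "card (rcosets\<^bsub>J\<^esub> N) = p ^ k" "finite (rcosets\<^bsub>J\<^esub> N)"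
      using normal_imp_subgroup by (auto simp: normal_subgroups_of_index_def)
    obtain n b where n: "1 \<le> n" and bt: "N \<in> between n b" using normal_between[OF N] by blast
    then have b1: "N \<in> between n 1"
      unfolding between_def using MM[of "n + 10" "b + 8" "b + 8" "1 + 8" "1 + 8"] MM[of n b 0 1 0] by simp
    have 1: "GK (n + 10) \<subseteq> N" and 2: "N \<subseteq> GK n"
      using bt unfolding between_def GK_eq_MM MM[of "n + 10" "b + 8" "b + 8" "n + 10" "n + 10"] MM[of n b 0 n n] by auto
    have "k \<le> index_exp (n + 10)"
      by (rule index_le[OF N'(1) GK_subgroup 1 GK_finite_index GK_index N'(2)]) simp_all
    moreover have "index_exp n \<le> k"
      by (rule index_le[OF GK_subgroup N'(1) 2 N'(3,2) GK_index[OF n]])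
    ultimately have "n \<in> {k div 3 - 9..k div 3 + 1}" using n unfolding idx by auto
    then show "N \<in> (\<Union>n\<in>{k div 3 - 9..k div 3 + 1}. between n 1)" using b1 by blast
  qed
  have b: "finite (between n 1) \<and> card (between n 1) \<le> p ^ (p * 56 * 56)" for n
    using card_between[of 1 56 n] \<sigma> by simp
  have "card (normal_subgroups_of_index J (p ^ k)) \<le> card (\<Union>n\<in>{k div 3 - 9..k div 3 + 1}. between n 1)"
    using b by (intro card_mono[OF _ sub]) auto
  also have "\<dots> \<le> (\<Sum>n\<in>{k div 3 - 9..k div 3 + 1}. card (between n 1))" by (rule card_UN_le) simp
  also have "\<dots> \<le> (\<Sum>n\<in>{k div 3 - 9..k div 3 + 1}. p ^ (p * 56 * 56))" using b by (intro sum_mono) auto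
  also have "\<dots> = card {k div 3 - 9..k div 3 + 1} * p ^ (p * 56 * 56)" by simp
  also have "\<dots> \<le> 12 * p ^ (p * 56 * 56)" by (intro mult_right_mono) auto
  finally show ?thesis .
qed

subsubsection \<open>Families of subgroups\<close>

text \<open>Every member has index \<open>p^k\<close> with
  \<open>k0 \<le> k \<le> index_exp m\<close>, so some \<open>k\<close> receives at least the
  average share. A positive \<open>k0\<close> shortens the range where the family itself has bounded
  size.\<close>

lemma family_pigeonhole:
  assumes fin: "finite Fam" and sub: "\<And>H. H \<in> Fam \<Longrightarrow> subgroup H J \<and> GK m \<subseteq> H" and m: "m \<ge> 1"
    and low: "\<And>H k. H \<in> Fam \<Longrightarrow> card (rcosets\<^bsub>J\<^esub> H) = p ^ k \<Longrightarrow> k0 \<le> k"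
  obtains k where "k \<le> index_exp m" "card Fam \<le> (index_exp m + 1 - k0) *
      card {H \<in> Fam. finite (rcosets\<^bsub>J\<^esub> H) \<and> card (rcosets\<^bsub>J\<^esub> H) = p ^ k}"
proof -
  note outer = that
  define A where "A k = {H \<in> Fam. finite (rcosets\<^bsub>J\<^esub> H) \<and> card (rcosets\<^bsub>J\<^esub> H) = p ^ k}" for k
  let ?I = "{k0..index_exp m}"
  have "Fam \<subseteq> (\<Union>k\<in>?I. A k)"
  proof
    fix H assume H: "H \<in> Fam"
    obtain k where k: "k \<le> index_exp m" "card (rcosets\<^bsub>J\<^esub> H) = p ^ k" "finite (rcosets\<^bsub>J\<^esub> H)"
      using index_dvd[OF _ GK_subgroup _ GK_index[OF m] GK_finite_index[OF m], of H] sub[OF H] by blast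
    then show "H \<in> (\<Union>k\<in>?I. A k)" using H low[OF H k(2)] by (auto simp: A_def)
  qed
  then have "card Fam \<le> card (\<Union>k\<in>?I. A k)" using fin by (intro card_mono) (auto simp: A_def)
  also have "\<dots> \<le> (\<Sum>k\<in>?I. card (A k))" by (rule card_UN_le) simp
  finally have le: "card Fam \<le> (\<Sum>k\<in>?I. card (A k))" .
  show thesis
  proof (cases "?I = {}")
    case True
    then show thesis using outer[of 0] le by simp
  next
    case False
    show thesis
    proof (rule ccontr)
      assume no: "\<not> thesis"
      have "card ?I * card (A k) < card Fam" if "k \<in> ?I" for k
        using that no outer[of k] unfolding A_def by (simp add: not_le) (meson not_le)
      then have "(\<Sum>k\<in>?I. card ?I * card (A k)) < (\<Sum>k\<in>?I. card Fam)"
        using False by (intro sum_strict_mono) auto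
      then have "card ?I * (\<Sum>k\<in>?I. card (A k)) < card ?I * card Fam"
        by (simp only: sum_distrib_left[symmetric] sum_constant of_nat_id)
      then show False using mult_le_mono2[OF le, of "card ?I"] by linarith
    qed
  qed
qed

text \<open>Graphs of linear maps \<open>X\<close> from the coefficients at the first \<open>m\<close> positions to those at the last
  \<open>m\<close> positions.\<close>

definition graph :: "(nat \<Rightarrow> nat) \<Rightarrow> nat \<Rightarrow> (nat \<times> nat \<Rightarrow> 'r) \<Rightarrow> 'r fps \<Rightarrow> bool" where
  "graph pos m X f \<longleftrightarrow> (\<forall>i<m. f $ pos (m + i) = (\<Sum>j<m. X (i, j) * f $ pos j))"

lemma graph_cong: "(\<And>i. i < 2 * m \<Longrightarrow> f $ pos i = g $ pos i) \<Longrightarrow> graph pos m X f \<longleftrightarrow> graph pos m X g"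
  by (auto simp: graph_def)

lemma graph_add: "graph pos m X f \<Longrightarrow> graph pos m X g \<Longrightarrow> graph pos m X (f + g)"
  by (auto simp: graph_def distrib_left sum.distrib)

lemma graph_uminus: "graph pos m X f \<Longrightarrow> graph pos m X (- f)"
  by (auto simp: graph_def sum_negf)

lemma graph_zero: "(\<And>i. i < 2 * m \<Longrightarrow> f $ pos i = 0) \<Longrightarrow> graph pos m X f"
  by (auto simp: graph_def)

lemma graph_distinct:
  assumes pos: "inj_on pos {..<2 * m}" and X: "X \<in> {..<m} \<times> {..<m} \<rightarrow>\<^sub>E F" "X' \<in> {..<m} \<times> {..<m} \<rightarrow>\<^sub>E F" "X \<noteq> X'"
  obtains f where "\<forall>i. f $ i \<in> F" "\<forall>i. i \<notin> pos ` {..<2 * m} \<longrightarrow> f $ i = 0" "graph pos m X f" "\<not> graph pos m X' f"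
proof -
  have Y: "\<exists>f. (\<forall>i. f $ i \<in> F) \<and> (\<forall>i. i \<notin> pos ` {..<2 * m} \<longrightarrow> f $ i = 0) \<and>
      (\<forall>Y \<in> {..<m} \<times> {..<m} \<rightarrow>\<^sub>E F. graph pos m Y f \<longleftrightarrow> (\<forall>i<m. X (i, j) = Y (i, j)))" if j: "j < m" for j
  proof -
    \<comment> \<open>The \<open>j\<close>-th basis vector together with its image under
      \<open>X\<close>: it lies on the graph of \<open>Y\<close> exactly when \<open>X\<close> and
      \<open>Y\<close> share column \<open>j\<close>.\<close>
    define c where "c s = (if s = j then e else if s < m then 0 else X (s - m, j))" for s
    define f where "f = Abs_fps (\<lambda>i. if i \<in> pos ` {..<2 * m} then c (inv_into {..<2 * m} pos i) else 0)"
    have fpos: "f $ pos s = c s" if "s < 2 * m" for s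
      using that by (simp add: f_def inv_into_f_f[OF pos])
    have cF: "c s \<in> F" if "s < 2 * m" for s using X(1) j that by (auto simp: c_def PiE_def Pi_def)
    have inv: "inv_into {..<2 * m} pos i < 2 * m" if "i \<in> pos ` {..<2 * m}" for i
      using inv_into_into[OF that] by simp
    have "graph pos m Y f \<longleftrightarrow> (\<forall>i<m. X (i, j) = Y (i, j))" if Y: "Y \<in> {..<m} \<times> {..<m} \<rightarrow>\<^sub>E F" for Y
    proof -
      have "(\<Sum>j'<m. Y (i, j') * f $ pos j') = Y (i, j)" if i: "i < m" for i
      proof -
        have "(\<Sum>j'<m. Y (i, j') * f $ pos j') = (\<Sum>j'<m. if j' = j then Y (i, j) * e else 0)"
          by (intro sum.cong) (auto simp: fpos c_def)
        also have "\<dots> = Y (i, j) * e" using j by simp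
        also have "\<dots> = Y (i, j)" using Y i j by (intro F_e') (auto simp: PiE_def Pi_def)
        finally show ?thesis .
      qed
      moreover have "f $ pos (m + i) = X (i, j)" if "i < m" for i using that j by (simp add: fpos c_def)
      ultimately show ?thesis by (auto simp: graph_def)
    qed
    moreover have "f $ i \<in> F" for i using cF inv by (simp add: f_def)
    moreover have "f $ i = 0" if "i \<notin> pos ` {..<2 * m}" for i using that by (simp add: f_def)
    ultimately show ?thesis by blast
  qed
  have "\<exists>i j. i < m \<and> j < m \<and> X (i, j) \<noteq> X' (i, j)"
  proof (rule ccontr)
    assume "\<not> ?thesis"
    then have "X z = X' z" if "z \<in> {..<m} \<times> {..<m}" for z using that by auto
    then show False using PiE_ext[OF X(1,2)] X(3) by blast
  qed
  then obtain i j where ij: "i < m" "j < m" "X (i, j) \<noteq> X' (i, j)" by blast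
  obtain f where f: "\<forall>i. f $ i \<in> F" "\<forall>i. i \<notin> pos ` {..<2 * m} \<longrightarrow> f $ i = 0"
      "\<forall>Y \<in> {..<m} \<times> {..<m} \<rightarrow>\<^sub>E F. graph pos m Y f \<longleftrightarrow> (\<forall>i<m. X (i, j) = Y (i, j))"
    using Y[OF ij(2)] by blast
  have "graph pos m X f" "\<not> graph pos m X' f" using f(3) X ij by auto
  then show thesis using that f by blast
qed

lemma card_matrices: "card ({..<m} \<times> {..<m} \<rightarrow>\<^sub>E F) = p ^ (m * m)" "finite ({..<m} \<times> {..<m} \<rightarrow>\<^sub>E F)"
  by (simp_all add: card_PiE card_F finite_PiE card_cartesian_product)

text \<open>A subgroup of index \<open>p^k\<close> contains \<open>upp (tpow (4 * k + 4))\<close>,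
  which bounds its depth. So the \<open>k\<close> chosen by pigeonhole tends to infinity with the
  depth.\<close>

lemma index_ge:
  assumes H: "subgroup H J" "finite (rcosets\<^bsub>J\<^esub> H)" "card (rcosets\<^bsub>J\<^esub> H) = p ^ k" and lev: "\<And>g. g \<in> H \<Longrightarrow> eb g \<in> P n"
  shows "n \<le> 4 * k + 4"
proof (rule ccontr)
  assume n: "\<not> n \<le> 4 * k + 4"
  have "GK (4 * k + 4) \<subseteq> H" using finite_index_contains_GK[OF H(1,2)] H(3) by simp
  moreover have "upp (tpow (4 * k + 4)) \<in> GK (4 * k + 4)"
    using upp_JC[OF P_mono[OF _ tpow_P]] tpow_P[of "4 * k + 4"] by (simp add: GK_eq_MM MM_def lev_def upp_def)
  ultimately have "tpow (4 * k + 4) \<in> P n" using lev by (force simp: upp_def)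
  then have "tpow (4 * k + 4) $ (4 * k + 4) = 0" using n by (intro P_coeff_0) auto
  then show False using tpow_nz by blast
qed

text \<open>Modulo \<open>t^(2 n)\<close> the upper right entry is additive on \<open>GK n\<close>,
  so every subspace of its coefficients at \<open>n, ..., 2 n - 1\<close> defines a subgroup between
  \<open>GK (2 * n)\<close> and \<open>GK n\<close>. With \<open>n = 2 * m\<close> the graphs of the
  \<open>m\<close> by \<open>m\<close> matrices are \<open>p^(m * m)\<close> such subspaces.\<close>

lemma subgroups_lower:
  assumes m: "m \<ge> 1"
  obtains k where "2 * m \<le> 4 * k + 4" "k \<le> 24 * m"
    "p ^ (m * m) \<le> (24 * m + 1) * card (subgroups_of_index J (p ^ k))"
proof -
  define n where "n = 2 * m"
  define pos where "pos i = n + i" for i :: nat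
  define H where "H X = {g \<in> GK n. graph pos m X (eb g)}" for X
  have n1: "n \<ge> 1" using m by (simp add: n_def)
  have Hs: "subgroup (H X) J" for X
  proof (rule J.subgroupI)
    show "H X \<noteq> {}" using subgroup.one_closed[OF GK_subgroup, of n] by (auto simp: H_def one_J intro!: graph_zero)
    fix g assume g: "g \<in> H X"
    then have gJ: "g \<in> JC" by (simp add: H_def GK_eq_MM MM_def)
    show "inv\<^bsub>J\<^esub> g \<in> H X"
      using g subgroup.m_inv_closed[OF GK_subgroup, of g n] graph_uminus by (simp add: H_def inv_J[OF gJ])
    fix h assume h: "h \<in> H X"
    have P: "ea g - 1 \<in> P n" "eb g \<in> P n" "eb h \<in> P n" "ed h - 1 \<in> P n"
      using g h by (auto simp: H_def GK_eq_MM MM_def lev_def)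
    have "eb (jmult g h) - (eb g + eb h) = (ea g - 1) * eb h + eb g * (ed h - 1)"
      by (simp add: algebra_simps)
    also have "\<dots> \<in> P (n + n)" by (intro P_add P_mult P)
    finally have d: "eb (jmult g h) - (eb g + eb h) \<in> P (n + n)" .
    have "eb (jmult g h) $ pos i = (eb g + eb h) $ pos i" if "i < 2 * m" for i
      using P_coeff_0[OF d, of "pos i"] that by (simp add: pos_def n_def del: jmult_sel)
    then have "graph pos m X (eb (jmult g h)) \<longleftrightarrow> graph pos m X (eb g + eb h)" by (rule graph_cong)
    then show "g \<otimes>\<^bsub>J\<^esub> h \<in> H X"
      using g h graph_add subgroup.m_closed[OF GK_subgroup, of g n h] by (simp add: H_def mult_J del: jmult_sel)
  qed (auto simp: H_def GK_eq_MM MM_def carrier_J)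
  have GKH: "GK (2 * n) \<subseteq> H X" for X
  proof
    fix g assume g: "g \<in> GK (2 * n)"
    then have "eb g \<in> P (2 * n)" by (simp add: GK_eq_MM MM_def lev_def)
    then have "graph pos m X (eb g)" by (intro graph_zero P_coeff_0) (auto simp: pos_def n_def)
    then show "g \<in> H X" using g GK_mono[of n "2 * n"] by (auto simp: H_def)
  qed
  have inj: "inj_on H ({..<m} \<times> {..<m} \<rightarrow>\<^sub>E F)"
  proof (rule inj_onI, rule ccontr)
    fix X X' assume X: "X \<in> {..<m} \<times> {..<m} \<rightarrow>\<^sub>E F" "X' \<in> {..<m} \<times> {..<m} \<rightarrow>\<^sub>E F" "H X = H X'" "X \<noteq> X'"
    have injp: "inj_on pos {..<2 * m}" by (simp add: pos_def inj_on_def)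
    obtain f where f: "\<forall>i. f $ i \<in> F" "\<forall>i. i \<notin> pos ` {..<2 * m} \<longrightarrow> f $ i = 0" "graph pos m X f" "\<not> graph pos m X' f"
      by (rule graph_distinct[OF injp X(1,2,4)])
    have "i \<notin> pos ` {..<2 * m}" if "i < n" for i using that by (auto simp: pos_def)
    then have fn: "f \<in> P n" using f(1,2) by (auto simp: P_def)
    then have "upp f \<in> GK n"
      using upp_JC[OF P_mono[OF n1 fn]] by (simp add: GK_eq_MM MM_def lev_def upp_def)
    then have "upp f \<in> H X" "upp f \<notin> H X'" using f by (auto simp: H_def upp_def)
    then show False using X by blast
  qed
  let ?Fam = "H ` ({..<m} \<times> {..<m} \<rightarrow>\<^sub>E F)"
  obtain k where k: "k \<le> index_exp (2 * n)"
      "card ?Fam \<le> (index_exp (2 * n) + 1) * card {K \<in> ?Fam. finite (rcosets\<^bsub>J\<^esub> K) \<and> card (rcosets\<^bsub>J\<^esub> K) = p ^ k}"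
    by (rule family_pigeonhole[of ?Fam "2 * n" 0]) (use Hs GKH n1 card_matrices in auto)
  have ie: "index_exp (2 * n) \<le> 24 * m" using index_exp_le[of "2 * n"] by (simp add: n_def)
  have sub: "{K \<in> ?Fam. finite (rcosets\<^bsub>J\<^esub> K) \<and> card (rcosets\<^bsub>J\<^esub> K) = p ^ k} \<subseteq> subgroups_of_index J (p ^ k)"
    using Hs by (auto simp: subgroups_of_index_def)
  have cardF: "card ?Fam = p ^ (m * m)" using card_image[OF inj] card_matrices by simp
  then have "{K \<in> ?Fam. finite (rcosets\<^bsub>J\<^esub> K) \<and> card (rcosets\<^bsub>J\<^esub> K) = p ^ k} \<noteq> {}"
    using k(2) p_gt_2 by (metis card.empty le_zero_eq mult_is_0 not_numeral_less_zero power_eq_0_iff)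
  then obtain X where X: "finite (rcosets\<^bsub>J\<^esub> (H X))" "card (rcosets\<^bsub>J\<^esub> (H X)) = p ^ k" by auto
  have kn: "n \<le> 4 * k + 4"
    by (rule index_ge[OF Hs X]) (simp add: H_def GK_eq_MM MM_def lev_def)
  have "p ^ (m * m) \<le> (index_exp (2 * n) + 1) * card (subgroups_of_index J (p ^ k))"
    using k(2) mult_le_mono2[OF card_mono[OF subgroups_upper(1) sub]] unfolding cardF by (rule le_trans)
  also have "\<dots> \<le> (24 * m + 1) * card (subgroups_of_index J (p ^ k))" using ie by (intro mult_right_mono) auto
  finally show thesis using that kn k(1) ie by (auto simp: n_def)
qed

text \<open>Modulo \<open>t^n\<close> the elements of \<open>MM n n 0\<close> are central, so any
  subspace of the coefficients of \<open>W\<close> below exponent \<open>n\<close> cuts out a normal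
  subgroup. With \<open>\<sigma> n \<ge> 2 * m\<close> exponents available there is room for the
  graphs of \<open>p^(m * m)\<close> matrices.\<close>

lemma normals_lower:
  assumes n: "n \<ge> 1" and m: "2 * m \<le> \<sigma> n"
  obtains k where "n \<le> 4 * k + 4" "k \<le> 6 * n"
    "p ^ (m * m) \<le> (6 * n + 1) * card (normal_subgroups_of_index J (p ^ k))"
proof -
  have "card {..<2 * m} \<le> card (S \<inter> {..<n})" using m by (simp add: \<sigma>_def)
  then obtain pos where pos: "pos ` {..<2 * m} \<subseteq> S \<inter> {..<n}" "inj_on pos {..<2 * m}"
    using card_le_inj[of "{..<2 * m}" "S \<inter> {..<n}"] by auto
  define H where "H X = {g \<in> MM n n 0. graph pos m X (ew g)}" for X
  have posn: "pos i < n" if "i < 2 * m" for i using pos(1) that by auto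
  have Hs: "subgroup (H X) J" for X
  proof (rule J.subgroupI)
    have M: "subgroup (MM n n 0) J" by (rule MM_subgroup) simp
    show "H X \<noteq> {}" using subgroup.one_closed[OF M] by (auto simp: H_def one_J intro!: graph_zero)
    fix g assume g: "g \<in> H X"
    then have gJ: "g \<in> JC" by (simp add: H_def MM_def)
    show "inv\<^bsub>J\<^esub> g \<in> H X"
      using g subgroup.m_inv_closed[OF M, of g] graph_uminus by (simp add: H_def inv_J[OF gJ])
    fix h assume h: "h \<in> H X"
    have "ex h \<in> P n" "ey h \<in> P n" using h by (auto simp: H_def MM_def)
    then have d: "restr S ((ex g * ea h + ey g * ec h) * ey h - (ex g * eb h + ey g * ed h) * ex h) \<in> P n"
      by (intro restr_P P_diff P_mult_left)
    have "ew (jmult g h) $ pos i = (ew g + ew h) $ pos i" if "i < 2 * m" for i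
      using P_coeff_0[OF d posn[OF that]] by simp
    then have "graph pos m X (ew (jmult g h)) \<longleftrightarrow> graph pos m X (ew g + ew h)" by (rule graph_cong)
    then show "g \<otimes>\<^bsub>J\<^esub> h \<in> H X"
      using g h graph_add subgroup.m_closed[OF M, of g h] by (simp add: H_def mult_J del: jmult_sel)
  qed (auto simp: H_def MM_def carrier_J)
  have Hn: "H X \<lhd> J" for X
    unfolding J.normal_inv_iff
  proof (intro conjI ballI Hs)
    fix x h assume x: "x \<in> carrier J" and h: "h \<in> H X"
    have hJ: "h \<in> JC" using h by (simp add: H_def MM_def)
    have "jcong n h (cen (ew h))" using h by (simp add: H_def MM_def jcong_def lev_def cen_def)
    then have "jcong n (x \<otimes>\<^bsub>J\<^esub> h \<otimes>\<^bsub>J\<^esub> inv\<^bsub>J\<^esub> x) (x \<otimes>\<^bsub>J\<^esub> cen (ew h) \<otimes>\<^bsub>J\<^esub> inv\<^bsub>J\<^esub> x)"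
      unfolding mult_J by (intro jcong_mult jcong_refl)
    moreover have "x \<otimes>\<^bsub>J\<^esub> cen (ew h) \<otimes>\<^bsub>J\<^esub> inv\<^bsub>J\<^esub> x = cen (ew h)"
    proof -
      have c: "cen (ew h) \<in> carrier J" using hJ by (simp add: carrier_J JC_def cen_def)
      have "x \<otimes>\<^bsub>J\<^esub> cen (ew h) = cen (ew h) \<otimes>\<^bsub>J\<^esub> x"
        unfolding mult_J by (rule elt.expand) (simp add: cen_def)
      then show ?thesis using x c by (simp add: J.m_assoc)
    qed
    moreover have "x \<otimes>\<^bsub>J\<^esub> h \<otimes>\<^bsub>J\<^esub> inv\<^bsub>J\<^esub> x \<in> carrier J" using x hJ by (simp add: carrier_J[symmetric])
    moreover define q where "q = x \<otimes>\<^bsub>J\<^esub> h \<otimes>\<^bsub>J\<^esub> inv\<^bsub>J\<^esub> x"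
    ultimately have q: "jcong n q (cen (ew h))" "q \<in> JC" by (simp_all add: carrier_J)
    have d: "ew q - ew h \<in> P n" using q(1) by (simp add: jcong_def cen_def)
    have "ew q $ pos i = ew h $ pos i" if "i < 2 * m" for i
      using P_coeff_0[OF d posn[OF that]] by simp
    then have "graph pos m X (ew q)" using graph_cong[of m "ew q" pos "ew h" X] h by (simp add: H_def)
    then show "x \<otimes>\<^bsub>J\<^esub> h \<otimes>\<^bsub>J\<^esub> inv\<^bsub>J\<^esub> x \<in> H X"
      using q unfolding q_def[symmetric] by (simp add: H_def MM_def jcong_def cen_def lev_def JC_def)
  qed
  have GKH: "GK n \<subseteq> H X" for X
  proof
    fix g assume g: "g \<in> GK n"
    then have "ew g \<in> P n" by (simp add: GK_eq_MM MM_def)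
    then have "ew g $ pos i = 0" if "i < 2 * m" for i using posn[OF that] by (rule P_coeff_0)
    then have "graph pos m X (ew g)" by (rule graph_zero)
    then show "g \<in> H X" using g P_mono[of 0 n] by (auto simp: H_def GK_eq_MM MM_def)
  qed
  have inj: "inj_on H ({..<m} \<times> {..<m} \<rightarrow>\<^sub>E F)"
  proof (rule inj_onI, rule ccontr)
    fix X X' assume X: "X \<in> {..<m} \<times> {..<m} \<rightarrow>\<^sub>E F" "X' \<in> {..<m} \<times> {..<m} \<rightarrow>\<^sub>E F" "H X = H X'" "X \<noteq> X'"
    obtain f where f: "\<forall>i. f $ i \<in> F" "\<forall>i. i \<notin> pos ` {..<2 * m} \<longrightarrow> f $ i = 0" "graph pos m X f" "\<not> graph pos m X' f"
      by (rule graph_distinct[OF pos(2) X(1,2,4)])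
    have "f \<in> P 0" using f(1) by (simp add: P_def)
    moreover have "restr S f = f" using f(2) pos(1) by (auto simp: fps_eq_iff)
    ultimately have "cen f \<in> MM n n 0" using cen_JC[of f] by (simp add: MM_def lev_def cen_def)
    then have "cen f \<in> H X" "cen f \<notin> H X'" using f by (auto simp: H_def cen_def)
    then show False using X by blast
  qed
  let ?Fam = "H ` ({..<m} \<times> {..<m} \<rightarrow>\<^sub>E F)"
  obtain k where k: "k \<le> index_exp n"
      "card ?Fam \<le> (index_exp n + 1) * card {K \<in> ?Fam. finite (rcosets\<^bsub>J\<^esub> K) \<and> card (rcosets\<^bsub>J\<^esub> K) = p ^ k}"
    by (rule family_pigeonhole[of ?Fam n 0]) (use Hs GKH n card_matrices in auto)
  have ie: "index_exp n \<le> 6 * n" by (rule index_exp_le)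
  have sub: "{K \<in> ?Fam. finite (rcosets\<^bsub>J\<^esub> K) \<and> card (rcosets\<^bsub>J\<^esub> K) = p ^ k} \<subseteq> normal_subgroups_of_index J (p ^ k)"
    using Hn by (auto simp: normal_subgroups_of_index_def)
  have cardF: "card ?Fam = p ^ (m * m)" using card_image[OF inj] card_matrices by simp
  then have "{K \<in> ?Fam. finite (rcosets\<^bsub>J\<^esub> K) \<and> card (rcosets\<^bsub>J\<^esub> K) = p ^ k} \<noteq> {}"
    using k(2) p_gt_2 by (metis card.empty le_zero_eq mult_is_0 not_numeral_less_zero power_eq_0_iff)
  then obtain X where X: "finite (rcosets\<^bsub>J\<^esub> (H X))" "card (rcosets\<^bsub>J\<^esub> (H X)) = p ^ k" by auto
  have kn: "n \<le> 4 * k + 4"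
    by (rule index_ge[OF Hs X]) (simp add: H_def MM_def lev_def)
  have "p ^ (m * m) \<le> (index_exp n + 1) * card (normal_subgroups_of_index J (p ^ k))"
    using k(2) mult_le_mono2[OF card_mono[OF normal_finite[OF subgroups_upper(1)] sub]] unfolding cardF by (rule le_trans)
  also have "\<dots> \<le> (6 * n + 1) * card (normal_subgroups_of_index J (p ^ k))" using ie by (intro mult_right_mono) auto
  finally show thesis using that kn k(1) ie by auto
qed

text \<open>\<open>GK n / GK (n + 1)\<close> is a central section, the additive group of
  \<open>sl_2(F)\<close>, so its \<open>p^2\<close> planes that express the lower left entry
  linearly by the first row give normal subgroups. Their \<open>k\<close> lie among four values and
  \<open>p^2 \<ge> 9\<close>, so some index occurs at least twice. A count of 1 would not do for the
  growth type, since its powers never exceed \<open>p\<close>.\<close>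

lemma SL2_normals_lower:
  assumes V: "\<not> V" and n: "n \<ge> 1"
  obtains k where "n \<le> 4 * k + 4" "2 \<le> card (normal_subgroups_of_index J (p ^ k))"
proof -
  have z: "ex g = 0 \<and> ey g = 0 \<and> ew g = 0" if "g \<in> JC" for g
  proof -
    have "V \<or> ex g = 0 \<and> ey g = 0" "restr S (ew g) = ew g" using that unfolding JC_def by blast+
    then show ?thesis using V restr_nonV[OF V, of "ew g"] by simp
  qed
  define H where "H z = {g \<in> GK n. ec g $ n = fst z * (ea g - 1) $ n + snd z * eb g $ n}" for z
  have comm: "jcong (Suc n) (jmult x h) (jmult h x)" if x: "x \<in> JC" and h: "h \<in> JC" "lev n h" for x h
  proof -
    have xP: "ea x - 1 \<in> P 1" "eb x \<in> P 1" "ec x \<in> P 1" "ed x - 1 \<in> P 1" using JC_lev[OF x] by (auto simp: lev_def)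
    have hP: "ea h - 1 \<in> P n" "eb h \<in> P n" "ec h \<in> P n" "ed h - 1 \<in> P n" using h(2) by (auto simp: lev_def)
    have dx: "(ea x - 1) - (ed x - 1) \<in> P 1" and dh: "(ea h - 1) - (ed h - 1) \<in> P n"
      by (rule P_diff[OF xP(1,4)], rule P_diff[OF hP(1,4)])
    have Q: "f * f' - q * q' \<in> P (Suc n)" if "f \<in> P n" "f' \<in> P 1" "q \<in> P n" "q' \<in> P 1" for f f' q q'
      using P_diff[OF P_mult[OF that(1,2)] P_mult[OF that(3,4)]] by simp
    have eqs: "ea (jmult x h) - ea (jmult h x) = ec h * eb x - eb h * ec x"
      "eb (jmult x h) - eb (jmult h x) = eb h * ((ea x - 1) - (ed x - 1)) - ((ea h - 1) - (ed h - 1)) * eb x"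
      "ec (jmult x h) - ec (jmult h x) = ((ea h - 1) - (ed h - 1)) * ec x - ec h * ((ea x - 1) - (ed x - 1))"
      "ed (jmult x h) - ed (jmult h x) = eb h * ec x - ec h * eb x"
      by (simp_all add: algebra_simps)
    show ?thesis
      unfolding jcong_def eqs
      using z[OF jmult_closed[OF x h(1)]] z[OF jmult_closed[OF h(1) x]] Q xP hP dx dh
      by (simp del: jmult_sel)
  qed
  have nth: "f $ n = g $ n" if "f - g \<in> P (Suc n)" for f g by (rule P_diff_Suc_nth[OF that])
  have Hs: "subgroup (H u) J" for u
  proof (rule J.subgroupI)
    have "\<one>\<^bsub>J\<^esub> \<in> H u" using subgroup.one_closed[OF GK_subgroup, of n] by (simp add: H_def one_J)
    then show "H u \<noteq> {}" by blast
    fix g assume g: "g \<in> H u"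
    then have gJ: "g \<in> JC" and gl: "lev n g" by (simp_all add: H_def GK_eq_MM MM_def)
    show "inv\<^bsub>J\<^esub> g \<in> H u"
      using g subgroup.m_inv_closed[OF GK_subgroup, of g n] lev_trace[OF gJ gl n] n
      by (auto simp: H_def inv_J[OF gJ])
    fix h assume h: "h \<in> H u"
    then have hl: "lev n h" by (simp add: H_def GK_eq_MM MM_def)
    have P: "ea g - 1 \<in> P n" "eb g \<in> P n" "ec g \<in> P n" "ed g - 1 \<in> P n"
      "ea h - 1 \<in> P n" "eb h \<in> P n" "ec h \<in> P n" "ed h - 1 \<in> P n"
      using gl hl by (auto simp: lev_def)
    have Q: "f * f' + q * q' \<in> P (Suc n)" if "f \<in> P n" "f' \<in> P n" "q \<in> P n" "q' \<in> P n" for f f' q q'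
      using P_mono[OF _ P_add[OF P_mult[OF that(1,2)] P_mult[OF that(3,4)]], of "Suc n"] n by simp
    have eqs: "(ea (jmult g h) - 1) - ((ea g - 1) + (ea h - 1)) = (ea g - 1) * (ea h - 1) + eb g * ec h"
      "eb (jmult g h) - (eb g + eb h) = (ea g - 1) * eb h + eb g * (ed h - 1)"
      "ec (jmult g h) - (ec g + ec h) = ec g * (ea h - 1) + (ed g - 1) * ec h"
      by (simp_all add: algebra_simps)
    have d: "(ea (jmult g h) - 1) - ((ea g - 1) + (ea h - 1)) \<in> P (Suc n)"
      "eb (jmult g h) - (eb g + eb h) \<in> P (Suc n)" "ec (jmult g h) - (ec g + ec h) \<in> P (Suc n)"
      unfolding eqs by (intro Q P)+
    note c = d[THEN P_diff_Suc_nth, unfolded fps_add_nth]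
    have "ec g $ n = fst u * (ea g - 1) $ n + snd u * eb g $ n" "ec h $ n = fst u * (ea h - 1) $ n + snd u * eb h $ n"
      using g h by (auto simp: H_def)
    then have "ec (jmult g h) $ n = fst u * (ea (jmult g h) - 1) $ n + snd u * eb (jmult g h) $ n"
      unfolding c by (simp only: distrib_left) (simp only: ac_simps)
    then show "g \<otimes>\<^bsub>J\<^esub> h \<in> H u"
      using g h subgroup.m_closed[OF GK_subgroup, of g n h] by (simp add: H_def mult_J del: jmult_sel)
  qed (auto simp: H_def GK_eq_MM MM_def carrier_J)
  have Hn: "H u \<lhd> J" for u
    unfolding J.normal_inv_iff
  proof (intro conjI ballI Hs)
    fix x h assume x: "x \<in> carrier J" and h: "h \<in> H u"
    have hG: "h \<in> GK n" using h by (simp add: H_def)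
    have hJ: "h \<in> JC" "lev n h" using hG by (simp_all add: GK_eq_MM MM_def)
    have "jcong (Suc n) (jmult (jmult x h) (inv\<^bsub>J\<^esub> x)) (jmult (jmult h x) (inv\<^bsub>J\<^esub> x))"
      by (rule jcong_mult[OF comm[OF x[unfolded carrier_J] hJ] jcong_refl])
    moreover have "h \<otimes>\<^bsub>J\<^esub> x \<otimes>\<^bsub>J\<^esub> inv\<^bsub>J\<^esub> x = h" using x hJ by (simp add: carrier_J[symmetric] J.m_assoc)
    moreover define q where "q = x \<otimes>\<^bsub>J\<^esub> h \<otimes>\<^bsub>J\<^esub> inv\<^bsub>J\<^esub> x"
    ultimately have q: "jcong (Suc n) q h" by (simp add: mult_J)
    have qG: "q \<in> GK n" using GK_normal[of n] x hG unfolding J.normal_inv_iff q_def by blast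
    have "(ea q - 1) - (ea h - 1) \<in> P (Suc n)" "eb q - eb h \<in> P (Suc n)" "ec q - ec h \<in> P (Suc n)"
      using q by (simp_all add: jcong_def)
    from this[THEN nth] have "q \<in> H u" using h qG unfolding H_def by simp
    then show "x \<otimes>\<^bsub>J\<^esub> h \<otimes>\<^bsub>J\<^esub> inv\<^bsub>J\<^esub> x \<in> H u" by (simp add: q_def)
  qed
  have GKH: "GK (Suc n) \<subseteq> H u" for u
  proof
    fix g assume g: "g \<in> GK (Suc n)"
    then have l: "ea g - 1 \<in> P (Suc n)" "eb g \<in> P (Suc n)" "ec g \<in> P (Suc n)" by (simp_all add: GK_eq_MM MM_def lev_def)
    have "(ea g - 1) $ n = 0" "eb g $ n = 0" "ec g $ n = 0" by (rule P_coeff_0[OF l(1)] P_coeff_0[OF l(2)] P_coeff_0[OF l(3)]; simp)+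
    then show "g \<in> H u" using g GK_Suc[of n] by (auto simp: H_def simp del: fps_sub_nth)
  qed
  have coeffs: "\<exists>g\<in>GK n. (ea g - 1) $ n = a \<and> eb g $ n = b \<and> ec g $ n = c" if F: "a \<in> F" "b \<in> F" "c \<in> F" for a b c
  proof -
    define M where "M x = fps_const x * fps_X ^ n" for x :: 'r
    have M: "M x \<in> P n" "M x $ n = x" if "x \<in> F" for x
      using P_monom[OF that] P_monom_nth[of x n n] by (simp_all add: M_def)
    have "1 + M a - 1 \<in> P n" using M F by simp
    then obtain v where v: "(1 + M a) * v = 1" "v - 1 \<in> P n" by (rule P_unit_inverse[OF _ n])
    define g where "g = El (1 + M a) (M b) (M c) ((1 + M b * M c) * v) 0 0 0"
    have d: "(1 + M b * M c) * v - 1 \<in> P n"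
      using M F by (intro unit_mult_P v) (simp add: P_mult_right)
    have "(1 + M a) * ((1 + M b * M c) * v) = (1 + M b * M c) * ((1 + M a) * v)" by (simp only: ac_simps)
    then have det: "(1 + M a) * ((1 + M b * M c) * v) - M b * M c = 1" by (simp add: v)
    have "lev n g" using M F d by (simp add: lev_def g_def)
    moreover have "g \<in> JC"
      using det M(1)[OF F(1)] M(1)[OF F(2)] M(1)[OF F(3)] d P_mono[OF n] by (simp add: JC_def g_def)
    ultimately have "g \<in> GK n" by (simp add: GK_eq_MM MM_def g_def)
    then show ?thesis using M F by (intro bexI[of _ g]) (simp_all add: g_def)
  qed
  have inj: "inj_on H (F \<times> F)"
  proof (rule inj_onI)
    fix u u' assume u: "u \<in> F \<times> F" "u' \<in> F \<times> F" "H u = H u'"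
    then have F: "fst u \<in> F" "snd u \<in> F" "fst u' \<in> F" "snd u' \<in> F" by auto
    have mem: "c = fst u * a + snd u * b \<longleftrightarrow> c = fst u' * a + snd u' * b" if "a \<in> F" "b \<in> F" "c \<in> F" for a b c
    proof -
      obtain g where g: "g \<in> GK n" "(ea g - 1) $ n = a" "eb g $ n = b" "ec g $ n = c" using coeffs[OF \<open>a \<in> F\<close> \<open>b \<in> F\<close> \<open>c \<in> F\<close>] by blast
      have "g \<in> H u \<longleftrightarrow> g \<in> H u'" using u by simp
      then show ?thesis unfolding H_def mem_Collect_eq g(2-4) using g(1) by blast
    qed
    have "fst u = fst u'" using mem[of e 0 "fst u"] F by (simp add: F_e')
    moreover have "snd u = snd u'" using mem[of 0 e "snd u"] F by (simp add: F_e')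
    ultimately show "u = u'" by (rule prod_eqI)
  qed
  let ?Fam = "H ` (F \<times> F)"
  have idx: "index_exp i = 3 * (i - 1)" for i unfolding index_exp_def using V S_empty[OF V] by simp
  have HG: "H u \<subseteq> GK n" for u by (auto simp: H_def)
  obtain k where k: "card ?Fam \<le> (index_exp (Suc n) + 1 - index_exp n) *
      card {K \<in> ?Fam. finite (rcosets\<^bsub>J\<^esub> K) \<and> card (rcosets\<^bsub>J\<^esub> K) = p ^ k}"
  proof (rule family_pigeonhole[of ?Fam "Suc n" "index_exp n"])
    fix K k assume K: "K \<in> ?Fam" "card (rcosets\<^bsub>J\<^esub> K) = p ^ k"
    then obtain u where u: "K = H u" by blast
    have "finite (rcosets\<^bsub>J\<^esub> K)" using K(2) p_gt_2 by (intro card_ge_0_finite) simp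
    then show "index_exp n \<le> k"
      using index_le[OF GK_subgroup Hs HG _ _ GK_index[OF n], of u k] K(2) by (simp add: u)
  next
    show "subgroup K J \<and> GK (Suc n) \<subseteq> K" if "K \<in> ?Fam" for K using that Hs GKH by blast
  qed (simp_all add: that)
  let ?A = "{K \<in> ?Fam. finite (rcosets\<^bsub>J\<^esub> K) \<and> card (rcosets\<^bsub>J\<^esub> K) = p ^ k}"
  have "card ?Fam = p * p" using card_image[OF inj] by (simp add: card_cartesian_product card_F)
  moreover have "index_exp (Suc n) + 1 - index_exp n = 4" using n by (simp add: idx)
  moreover have "3 * 3 \<le> p * p" using p_gt_2 by (intro mult_le_mono) auto
  ultimately have A: "2 \<le> card ?A" using k by simp
  then have "?A \<noteq> {}" by (metis card.empty not_numeral_le_zero)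
  then obtain u where X: "finite (rcosets\<^bsub>J\<^esub> (H u))" "card (rcosets\<^bsub>J\<^esub> (H u)) = p ^ k" by auto
  have kn: "n \<le> 4 * k + 4"
    by (rule index_ge[OF Hs X]) (simp add: H_def GK_eq_MM MM_def lev_def)
  have "?A \<subseteq> normal_subgroups_of_index J (p ^ k)" using Hn by (auto simp: normal_subgroups_of_index_def)
  from card_mono[OF normal_finite[OF subgroups_upper(1)] this] A have "2 \<le> card (normal_subgroups_of_index J (p ^ k))" by linarith
  then show thesis using that kn by blast
qed

end

subsection \<open>Growth types\<close>

text \<open>The two estimates may use different constants: as \<open>g \<ge> 1\<close>, and
  \<open>f \<ge> 1\<close> wherever the lower estimate holds, both survive passing to the
  maximum.\<close>

lemma of_growth_typeI:
  fixes f :: "nat \<Rightarrow> nat" and g :: "nat \<Rightarrow> real"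
  assumes g: "\<And>n. g n \<ge> 1" and up: "\<And>n. n \<ge> 1 \<Longrightarrow> real (f n) < g n powr C1"
    and low: "\<And>M. \<exists>n\<ge>M. g n < real (f n) powr C2"
  shows "of_growth_type (\<lambda>n. real (f n)) g"
  unfolding of_growth_type_def
proof (intro exI conjI allI impI)
  show "real (f n) < g n powr (max C1 C2)" if "n \<ge> 1" for n
    using up[OF that] powr_mono[of C1 "max C1 C2" "g n"] g[of n] by simp
  have "g n < real (f n) powr (max C1 C2)" if "g n < real (f n) powr C2" for n
  proof -
    have "f n \<noteq> 0" using that g[of n] by (intro notI) simp
    then have "real (f n) powr C2 \<le> real (f n) powr (max C1 C2)" by (intro powr_mono) auto
    then show ?thesis using that by simp
  qed
  then show "\<exists>\<^sub>\<infinity>n. g n < real (f n) powr (max C1 C2)"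
    using low unfolding INFM_nat_le by blast
qed

text \<open>\<open>exp 1 \<le> 3 \<le> p\<close>. Polynomial factors are bounded by exponentials and
  thereby absorbed into powers of \<open>p\<close>.\<close>

lemma exp_le_powr:
  assumes "p \<ge> 3" "x \<ge> 0"
  shows "exp x \<le> real p powr x"
proof -
  have "exp 1 \<le> real p" using exp_le assms(1) by linarith
  then have "1 \<le> ln (real p)" using assms(1) by (subst ln_ge_iff) auto
  then have "x \<le> x * ln (real p)" using assms(2) by (simp add: mult_le_cancel_left1)
  then show ?thesis using assms(1) by (simp add: powr_def)
qed

section \<open>A set of exponents with prescribed counting function\<close>

definition power_floor :: "real \<Rightarrow> nat \<Rightarrow> nat" where
  "power_floor \<alpha> n = nat \<lfloor>real n powr \<alpha>\<rfloor>"

text \<open>For \<open>\<alpha> \<le> 1\<close> one step adds at most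
  \<open>n^(\<alpha> - 1) \<le> 1\<close>, because \<open>n^(\<alpha> - 1)\<close> decreases in
  \<open>n\<close>; so the floor never skips an integer.\<close>

lemma power_floor_Suc:
  assumes "0 < \<alpha>" "\<alpha> \<le> 1"
  shows "power_floor \<alpha> n \<le> power_floor \<alpha> (Suc n)" and "power_floor \<alpha> (Suc n) \<le> Suc (power_floor \<alpha> n)"
proof -
  have "real n powr \<alpha> \<le> real (Suc n) powr \<alpha>" using assms by (intro powr_mono2) auto
  then show "power_floor \<alpha> n \<le> power_floor \<alpha> (Suc n)" unfolding power_floor_def by (intro nat_mono floor_mono)
  have "real (Suc n) powr \<alpha> \<le> real n powr \<alpha> + 1"
  proof (cases "n = 0")
    case False
    have split: "y powr \<alpha> = y * y powr (\<alpha> - 1)" if "y > 0" for y :: real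
      using that powr_add[of y 1 "\<alpha> - 1"] by simp
    have "real (Suc n) powr \<alpha> = real (Suc n) * real (Suc n) powr (\<alpha> - 1)" by (rule split) simp
    also have "\<dots> \<le> real (Suc n) * real n powr (\<alpha> - 1)"
      using assms False by (intro mult_left_mono powr_mono2') auto
    also have "\<dots> = real n powr \<alpha> + real n powr (\<alpha> - 1)"
      using split[of "real n"] False by (simp add: algebra_simps)
    also have "real n powr (\<alpha> - 1) \<le> real n powr 0" using assms False by (intro powr_mono) auto
    finally show ?thesis using False by simp
  qed simp
  then have "\<lfloor>real (Suc n) powr \<alpha>\<rfloor> \<le> \<lfloor>real n powr \<alpha>\<rfloor> + 1" by linarith
  then show "power_floor \<alpha> (Suc n) \<le> Suc (power_floor \<alpha> n)" unfolding power_floor_def by linarith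
qed

text \<open>A function with steps 0 and 1 starting at 0 counts its own jumps. The jump set is the
  \<open>S\<close> used for \<open>\<epsilon> < 2\<close>.\<close>

lemma card_jumps:
  assumes "0 < \<alpha>" "\<alpha> \<le> 1"
  shows "card ({j. power_floor \<alpha> (Suc j) \<noteq> power_floor \<alpha> j} \<inter> {..<n}) = power_floor \<alpha> n"
proof (induction n)
  case 0
  then show ?case by (simp add: power_floor_def)
next
  case (Suc n)
  let ?S = "{j. power_floor \<alpha> (Suc j) \<noteq> power_floor \<alpha> j}"
  have "?S \<inter> {..<Suc n} = (if n \<in> ?S then insert n (?S \<inter> {..<n}) else ?S \<inter> {..<n})"
    by (auto simp: less_Suc_eq)
  then show ?case using Suc power_floor_Suc[OF assms, of n] by auto
qed

section \<open>Growth estimates for \<open>J\<close> and its pro-\<open>p\<close> copy\<close>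

context jacobi
begin

lemma subgroup_growth:
  "of_growth_type (\<lambda>k. real (card (subgroups_of_index J (p ^ k)))) (\<lambda>k. real p ^ (k\<^sup>2))"
proof (rule of_growth_typeI)
  have p1: "real p > 1" using p_gt_2 by simp
  show "1 \<le> real p ^ (k\<^sup>2)" for k using p1 by simp
  \<comment> \<open>\<open>2304 = 48^2\<close>, where \<open>24 * (k + 1) \<le> 48 * k\<close>; the
    extra 1 makes the inequality strict.\<close>
  show "real (card (subgroups_of_index J (p ^ k))) < (real p ^ (k\<^sup>2)) powr real (2304 * p + 1)" if k: "k \<ge> 1" for k
  proof -
    have h: "24 * (k + 1) \<le> 48 * k" using k by simp
    have "p * (24 * (k + 1)) * (24 * (k + 1)) \<le> p * (48 * k) * (48 * k)"
      by (rule mult_le_mono[OF mult_le_mono[OF le_refl h] h])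
    also have "\<dots> < k\<^sup>2 * (2304 * p + 1)" using k by (simp add: power2_eq_square algebra_simps)
    finally have "p * (24 * (k + 1)) * (24 * (k + 1)) < k\<^sup>2 * (2304 * p + 1)" .
    then have "p ^ (p * (24 * (k + 1)) * (24 * (k + 1))) < p ^ (k\<^sup>2 * (2304 * p + 1))"
      using p_gt_2 by (intro power_strict_increasing) auto
    then have "card (subgroups_of_index J (p ^ k)) < p ^ (k\<^sup>2 * (2304 * p + 1))"
      using subgroups_upper(2)[of k] by linarith
    then have "real (card (subgroups_of_index J (p ^ k))) < real (p ^ (k\<^sup>2 * (2304 * p + 1)))" by linarith
    also have "\<dots> = (real p ^ (k\<^sup>2)) ^ (2304 * p + 1)" by (simp only: of_nat_power power_mult)
    also have "\<dots> = (real p ^ (k\<^sup>2)) powr real (2304 * p + 1)" using p1 by (intro powr_realpow[symmetric]) simp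
    finally show ?thesis .
  qed
  show "\<exists>k\<ge>M. real p ^ (k\<^sup>2) < real (card (subgroups_of_index J (p ^ k))) powr real (1154 :: nat)" for M
  proof -
    \<comment> \<open>\<open>m \<ge> 5\<close> makes the square of the factor
      \<open>24 * m + 1\<close> at most \<open>p^(m * m)\<close>, so that \<open>c^2\<close> is at
      least \<open>p^(m * m)\<close>. From \<open>k \<le> 24 * m\<close> and
      \<open>24^2 = 576\<close> the power 577 of \<open>c^2\<close> suffices, and
      \<open>1154 = 2 * 577\<close>.\<close>
    define m where "m = 2 * M + 5"
    have m: "m \<ge> 1" "m \<ge> 5" by (simp_all add: m_def)
    obtain k where k: "2 * m \<le> 4 * k + 4" "k \<le> 24 * m"
        "p ^ (m * m) \<le> (24 * m + 1) * card (subgroups_of_index J (p ^ k))"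
      using subgroups_lower[OF m(1)] by blast
    define c where "c = card (subgroups_of_index J (p ^ k))"
    have "24 * m + 1 \<le> 32 * m" using m by simp
    also have "\<dots> \<le> 2 ^ 5 * 2 ^ m" by (intro mult_le_mono) (auto intro: less_imp_le)
    finally have "(24 * m + 1)\<^sup>2 \<le> (2 ^ 5 * 2 ^ m)\<^sup>2" by (rule power_mono) simp
    also have "\<dots> = 2 ^ ((5 + m) * 2)" by (simp only: power_add power_mult)
    also have "\<dots> \<le> 2 ^ (m * m)"
    proof (rule power_increasing)
      have "(5 + m) * 2 \<le> 5 * m" using m(2) by simp
      then show "(5 + m) * 2 \<le> m * m" using mult_le_mono1[OF m(2), of m] by (rule le_trans)
    qed simp
    also have "\<dots> \<le> p ^ (m * m)" using p_gt_2 by (intro power_mono) auto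
    finally have sq: "(24 * m + 1)\<^sup>2 \<le> p ^ (m * m)" .
    have "p ^ (m * m) * p ^ (m * m) \<le> ((24 * m + 1) * c) * ((24 * m + 1) * c)"
      using k(3) unfolding c_def by (intro mult_le_mono)
    also have "\<dots> = (24 * m + 1)\<^sup>2 * c\<^sup>2" by (simp only: power2_eq_square ac_simps)
    also have "\<dots> \<le> p ^ (m * m) * c\<^sup>2" using sq by (intro mult_le_mono1)
    finally have c2: "p ^ (m * m) \<le> c\<^sup>2" using p_gt_2 by simp
    have "k\<^sup>2 \<le> (24 * m)\<^sup>2" using k(2) by (intro power_mono) auto
    also have "\<dots> < m * m * 577" using m by (simp add: power2_eq_square)
    finally have "p ^ (k\<^sup>2) < p ^ (m * m * 577)" using p_gt_2 by (intro power_strict_increasing) auto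
    also have "\<dots> = (p ^ (m * m)) ^ 577" by (rule power_mult)
    also have "\<dots> \<le> (c\<^sup>2) ^ 577" by (rule power_mono[OF c2]) simp
    also have "\<dots> = c ^ 1154" by (simp add: power_mult[symmetric])
    finally have "p ^ (k\<^sup>2) < c ^ 1154" .
    then have "real p ^ (k\<^sup>2) < real c ^ 1154" by (metis of_nat_less_iff of_nat_power)
    moreover have "c > 0" using c2 p_gt_2 by (intro gr0I) simp
    ultimately have "real p ^ (k\<^sup>2) < real c powr real (1154 :: nat)" by (subst powr_realpow) auto
    moreover have "k \<ge> M" using k(1) by (simp add: m_def)
    ultimately show ?thesis by (auto simp: c_def)
  qed
qed

lemma normal_growth:
  assumes \<delta>: "0 < \<delta>" "\<delta> < 2" and \<sigma>: "\<And>n. \<sigma> n = power_floor (\<delta> / 2) n"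
  shows "of_growth_type (\<lambda>k. real (card (normal_subgroups_of_index J (p ^ k)))) (\<lambda>k. real p powr (real k powr \<delta>))"
proof (rule of_growth_typeI)
  have p3: "p \<ge> 3" and p1: "real p > 1" using p_gt_2 by auto
  show "1 \<le> real p powr (real k powr \<delta>)" for k using p1 by (intro ge_one_powr_ge_zero) auto
  have half: "real n powr (\<delta> / 2) * real n powr (\<delta> / 2) = real n powr \<delta>" for n :: nat
    by (simp add: powr_add[symmetric])
  \<comment> \<open>\<open>72 = 56 + 16\<close> bounds \<open>E\<close> relative to
    \<open>k^(\<delta>/2)\<close>, and \<open>5184 = 72^2\<close>. The term
    \<open>2 / \<delta>\<close> pays for \<open>k^2\<close> through
    \<open>ln k \<le> k^\<delta> / \<delta>\<close>; \<open>p^4\<close> pays for the factor 64, and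
    5 in place of 4 gives strictness.\<close>
  define C where "C = 5 + 2 / \<delta> + 5184 * real p"
  show "real (card (normal_subgroups_of_index J (p ^ k))) < (real p powr (real k powr \<delta>)) powr C" if k: "k \<ge> 1" for k
  proof -
    define E where "E = 56 + \<sigma> (4 * k + 12)"
    define y where "y = real k powr \<delta>"
    have y1: "y \<ge> 1" unfolding y_def using k \<delta> by (intro ge_one_powr_ge_zero) auto
    have x1: "real k powr (\<delta> / 2) \<ge> 1" using k \<delta> by (intro ge_one_powr_ge_zero) auto
    have "real (\<sigma> (4 * k + 12)) \<le> real (4 * k + 12) powr (\<delta> / 2)"
      unfolding \<sigma> power_floor_def by (simp add: of_nat_floor)
    also have "\<dots> \<le> (16 * real k) powr (\<delta> / 2)" using k \<delta> by (intro powr_mono2) auto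
    also have "\<dots> = 16 powr (\<delta> / 2) * real k powr (\<delta> / 2)" by (simp add: powr_mult)
    also have "\<dots> \<le> 16 powr 1 * real k powr (\<delta> / 2)" using \<delta> by (intro mult_right_mono powr_mono) auto
    finally have E: "real E \<le> 72 * real k powr (\<delta> / 2)" using x1 by (simp add: E_def)
    have "real E * real E \<le> (72 * real k powr (\<delta> / 2)) * (72 * real k powr (\<delta> / 2))"
      using E by (intro mult_mono) auto
    also have "\<dots> = 5184 * y" using half[of k] by (simp add: y_def algebra_simps)
    finally have EE: "real E * real E \<le> 5184 * y" .
    have "ln (real k) \<le> y / \<delta>" unfolding y_def using k \<delta> by (intro ln_powr_bound) auto
    have "real k * real k = exp (2 * ln (real k))" unfolding mult_2 exp_add using k by simp
    also have "\<dots> \<le> exp (2 * (y / \<delta>))" using \<open>ln (real k) \<le> y / \<delta>\<close> by simp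
    also have "\<dots> \<le> real p powr (2 * (y / \<delta>))" using p3 y1 \<delta> by (intro exp_le_powr) auto
    finally have kk: "real k * real k \<le> real p powr (2 * (y / \<delta>))" .
    have "(64 :: real) \<le> 3 ^ 4" by simp
    also have "\<dots> \<le> real p ^ 4" using p3 by (intro power_mono) auto
    also have "\<dots> = real p powr 4" using p1 by (simp add: powr_numeral)
    finally have p64: "64 \<le> real p powr 4" .
    have pE: "real (p ^ (p * E * E)) = real p powr real (p * E * E)"
      using p1 by (subst powr_realpow) auto
    have "real (card (normal_subgroups_of_index J (p ^ k))) \<le> real ((4 * k + 4) * (4 * k + 4) * p ^ (p * E * E))"
      unfolding of_nat_le_iff by (rule normals_upper) (simp add: E_def)
    also have "\<dots> = (real (4 * k + 4) * real (4 * k + 4)) * real (p ^ (p * E * E))"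
      by (simp only: of_nat_mult[of "(4 * k + 4) * (4 * k + 4)"] of_nat_mult[of "4 * k + 4"])
    also have "\<dots> = (real (4 * k + 4) * real (4 * k + 4)) * real p powr real (p * E * E)"
      unfolding pE by (rule refl)
    also have "\<dots> \<le> ((8 * real k) * (8 * real k)) * real p powr (real p * (5184 * y))"
    proof (intro mult_mono powr_mono)
      show "real (p * E * E) \<le> real p * (5184 * y)"
        using mult_left_mono[OF EE, of "real p"] by (simp add: mult.assoc)
    qed (use k p1 in auto)
    also have "\<dots> = (64 * (real k * real k)) * real p powr (real p * (5184 * y))" by simp
    also have "\<dots> \<le> (real p powr 4 * real p powr (2 * (y / \<delta>))) * real p powr (real p * (5184 * y))"
      using p64 kk by (intro mult_mono) auto
    also have "\<dots> = real p powr (4 + 2 * (y / \<delta>) + real p * (5184 * y))" by (simp add: powr_add)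
    also have "\<dots> < real p powr (y * C)"
    proof (rule powr_less_mono[OF _ p1])
      have "4 + 2 * (y / \<delta>) + real p * (5184 * y) < 5 * y + 2 * (y / \<delta>) + real p * (5184 * y)" using y1 by linarith
      also have "\<dots> = y * C" by (simp add: C_def algebra_simps)
      finally show "4 + 2 * (y / \<delta>) + real p * (5184 * y) < y * C" .
    qed
    also have "\<dots> = (real p powr (real k powr \<delta>)) powr C" by (simp add: powr_powr y_def)
    finally show ?thesis .
  qed
  show "\<exists>k\<ge>M. real p powr (real k powr \<delta>) < real (card (normal_subgroups_of_index J (p ^ k))) powr 1184" for M
  proof -
    \<comment> \<open>The bound 4 gives \<open>m \<ge> n^(\<delta>/2) / 4\<close> despite the floor
      and the halving, hence \<open>m^2 \<ge> z / 16\<close>. Half of this exponent pays for the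
      factor \<open>6 * n + 1\<close>; the rest, \<open>z / 32\<close>, is compared with
      \<open>k^\<delta> \<le> 36 * z\<close>, and \<open>1184 = 32 * 37\<close>.\<close>
    have "eventually (\<lambda>n. real n powr (\<delta> / 2) \<ge> 4) sequentially" using \<delta> by real_asymp
    moreover have "eventually (\<lambda>n. 6 * real n + 1 \<le> exp (real n powr \<delta> / 32)) sequentially" using \<delta> by real_asymp
    ultimately have "eventually (\<lambda>n. n \<ge> 4 * M + 5 \<and> real n powr (\<delta> / 2) \<ge> 4 \<and> 6 * real n + 1 \<le> exp (real n powr \<delta> / 32)) sequentially"
      using eventually_ge_at_top[of "4 * M + 5"] by eventually_elim simp
    from eventually_happens'[OF sequentially_bot this]
    obtain n where n: "n \<ge> 4 * M + 5" "real n powr (\<delta> / 2) \<ge> 4" "6 * real n + 1 \<le> exp (real n powr \<delta> / 32)"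
      by blast
    define z where "z = real n powr \<delta>"
    define m where "m = \<sigma> n div 2"
    have "real (\<sigma> n) \<ge> real n powr (\<delta> / 2) - 1" unfolding \<sigma> power_floor_def by linarith
    moreover have "real (\<sigma> n) \<le> 2 * real m + 1" unfolding m_def by linarith
    ultimately have "real m \<ge> real n powr (\<delta> / 2) / 4" using n(2) by linarith
    then have "real m * real m \<ge> (real n powr (\<delta> / 2) / 4) * (real n powr (\<delta> / 2) / 4)" by (intro mult_mono) auto
    then have mm: "real (m * m) \<ge> z / 16" using half[of n] by (simp add: z_def)
    have n1: "n \<ge> 1" and m2: "2 * m \<le> \<sigma> n" using n(1) by (auto simp: m_def)
    obtain k where k: "n \<le> 4 * k + 4" "k \<le> 6 * n"
        "p ^ (m * m) \<le> (6 * n + 1) * card (normal_subgroups_of_index J (p ^ k))"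
      using normals_lower[OF n1 m2] by blast
    define c where "c = card (normal_subgroups_of_index J (p ^ k))"
    have z0: "z \<ge> 0" "z > 0" using n1 by (simp_all add: z_def)
    have "real p powr (z / 32) * real p powr (z / 32) = real p powr (z / 16)" by (simp add: powr_add[symmetric])
    also have "\<dots> \<le> real p powr real (m * m)" using mm p1 by (intro powr_mono) auto
    also have "\<dots> = real (p ^ (m * m))" using p1 by (simp only: powr_realpow of_nat_power)
    also have "\<dots> \<le> real ((6 * n + 1) * c)" using k(3) unfolding c_def of_nat_le_iff .
    also have "\<dots> = (6 * real n + 1) * real c" by (simp add: algebra_simps)
    also have "\<dots> \<le> real p powr (z / 32) * real c"
    proof (rule mult_right_mono)
      have "exp (z / 32) \<le> real p powr (z / 32)" using p3 z0 by (intro exp_le_powr) auto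
      then show "6 * real n + 1 \<le> real p powr (z / 32)" using n(3) by (simp add: z_def)
    qed simp
    finally have c: "real p powr (z / 32) \<le> real c" using p1 by simp
    have "real k powr \<delta> \<le> (6 * real n) powr \<delta>" using k(2) \<delta> by (intro powr_mono2) auto
    also have "\<dots> = 6 powr \<delta> * z" by (simp add: powr_mult z_def)
    also have "\<dots> \<le> 6 powr 2 * z" using \<delta> z0 by (intro mult_right_mono powr_mono) auto
    also have "\<dots> = 36 * z" by simp
    also have "\<dots> < z / 32 * 1184" using z0 by simp
    finally have "real p powr (real k powr \<delta>) < real p powr (z / 32 * 1184)" by (rule powr_less_mono[OF _ p1])
    also have "\<dots> = (real p powr (z / 32)) powr 1184" by (simp add: powr_powr)
    also have "\<dots> \<le> real c powr 1184" using c by (intro powr_mono2) auto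
    finally have "real p powr (real k powr \<delta>) < real c powr 1184" .
    moreover have "k \<ge> M" using k(1) n(1) by simp
    ultimately show ?thesis by (auto simp: c_def)
  qed
qed

lemma SL2_normal_growth:
  assumes V: "\<not> V"
  shows "of_growth_type (\<lambda>k. real (card (normal_subgroups_of_index J (p ^ k)))) (\<lambda>k. real p powr (real k powr 0))"
proof (rule of_growth_typeI)
  have p3: "p \<ge> 3" and p1: "real p > 1" using p_gt_2 by auto
  show "1 \<le> real p powr (real k powr 0)" for k using p1 by (intro ge_one_powr_ge_zero) auto
  \<comment> \<open>\<open>0 powr 0 = 0\<close>, so the reference function is the constant
    \<open>p\<close> only for \<open>k \<ge> 1\<close>.\<close>
  show "real (card (normal_subgroups_of_index J (p ^ k))) < (real p powr (real k powr 0)) powr real (4 + p * 56 * 56)"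
    if k: "k \<ge> 1" for k
  proof -
    have "(12 :: nat) \<le> 3 ^ 3" by simp
    also have "3 ^ 3 \<le> p ^ 3" using p3 by (rule power_mono) simp
    finally have "12 * p ^ (p * 56 * 56) \<le> p ^ 3 * p ^ (p * 56 * 56)" by (rule mult_le_mono1)
    also have "\<dots> < p ^ (4 + p * 56 * 56)" unfolding power_add[symmetric] using p3 by (intro power_strict_increasing) auto
    finally have "card (normal_subgroups_of_index J (p ^ k)) < p ^ (4 + p * 56 * 56)"
      using SL2_normals_upper[OF V, of k] by linarith
    then have "real (card (normal_subgroups_of_index J (p ^ k))) < real (p ^ (4 + p * 56 * 56))" by (simp only: of_nat_less_iff)
    also have "\<dots> = real p powr real (4 + p * 56 * 56)" using p1 by (simp only: of_nat_power powr_realpow)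
    finally show ?thesis using k by simp
  qed
  show "\<exists>k\<ge>M. real p powr (real k powr 0) < real (card (normal_subgroups_of_index J (p ^ k))) powr real p" for M
  proof -
    obtain k where k: "4 * M + 8 \<le> 4 * k + 4" "2 \<le> card (normal_subgroups_of_index J (p ^ k))"
      using SL2_normals_lower[OF V, of "4 * M + 8"] by auto
    \<comment> \<open>With a count of at least 2 the exponent \<open>p\<close> is large
      enough.\<close>
    have "real p < 2 ^ p" by (metis less_exp of_nat_less_iff of_nat_numeral of_nat_power)
    also have "\<dots> = 2 powr real p" by (simp add: powr_realpow)
    also have "\<dots> \<le> real (card (normal_subgroups_of_index J (p ^ k))) powr real p" using k(2) by (intro powr_mono2) auto
    finally show ?thesis using k(1) by (intro exI[of _ k]) simp
  qed
qed

lemma pro_p_copy: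
  obtains G :: "(nat \<Rightarrow> nat) monoid" and T where "pro_p_group p G T"
    "\<And>k. finite (subgroups_of_index G (p ^ k))"
    "\<And>n. subgroup_count G n = card (subgroups_of_index J n)"
    "\<And>n. normal_subgroup_count G n = card (normal_subgroups_of_index J n)"
proof (rule pro_p_group_of_filtration[OF group_J prime, of "\<lambda>n. GK (Suc n)"])
  fix G :: "(nat \<Rightarrow> nat) monoid" and T h
  assume G: "group G" "h \<in> iso J G" "pro_p_group p G T"
  note bij = iso_bij_betw_subgroups[OF group_J G(1,2)]
  show thesis
  proof (rule that[OF G(3)])
    show "finite (subgroups_of_index G (p ^ k))" for k
      using bij_betw_finite[OF bij(1)] subgroups_upper(1) by blast
    show "subgroup_count G n = card (subgroups_of_index J n)" for n
      unfolding subgroup_count_def using bij_betw_same_card[OF bij(1)] by simp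
    show "normal_subgroup_count G n = card (normal_subgroups_of_index J n)" for n
      unfolding normal_subgroup_count_def using bij_betw_same_card[OF bij(2)] by simp
  qed
qed (use GK_normal GK_Suc GK_index GK_Inter GK_complete in auto)

end

text \<open>The restriction \<open>\<epsilon> \<le> 2\<close> is forced by
  \<open>not_of_growth_type_if_gt_2\<close>. Finiteness is asserted separately because an infinite
  set has cardinality 0, so the counts alone would not reveal it.\<close>

theorem corollary1:
  fixes p :: nat and \<epsilon> :: real
  assumes "prime p" and "p > 2" and "\<epsilon> > 0" and "\<epsilon> \<le> 2"
  shows "\<exists>(G :: (nat \<Rightarrow> nat) monoid) T.
           pro_p_group p G T \<and>
           (\<forall>k\<ge>1. finite (subgroups_of_index G (p ^ k))) \<and>
           of_growth_type (\<lambda>k. real (subgroup_count G (p ^ k))) (\<lambda>k. real p ^ (k\<^sup>2)) \<and>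
           of_growth_type (\<lambda>k. real (normal_subgroup_count G (p ^ k)))
             (\<lambda>k. real p powr (real k powr (2 - \<epsilon>)))"
proof -
  define \<alpha> where "\<alpha> = (2 - \<epsilon>) / 2"
  define S where "S = (if \<epsilon> < 2 then {j. power_floor \<alpha> (Suc j) \<noteq> power_floor \<alpha> j} else {})"
  interpret prime_idem p "residue_idem p" by (rule prime_idem_residue[OF assms(1,2)])
  interpret jacobi p "residue_idem p" "\<epsilon> < 2" S by unfold_locales (simp add: S_def)
  have "of_growth_type (\<lambda>k. real (card (normal_subgroups_of_index J (p ^ k)))) (\<lambda>k. real p powr (real k powr (2 - \<epsilon>)))"
  proof (cases "\<epsilon> < 2")
    case True
    have \<alpha>: "0 < \<alpha>" "\<alpha> \<le> 1" using True assms by (auto simp: \<alpha>_def)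
    show ?thesis
    proof (rule normal_growth)
      show "\<sigma> n = power_floor ((2 - \<epsilon>) / 2) n" for n
        unfolding \<sigma>_def using card_jumps[OF \<alpha>] True by (simp add: S_def \<alpha>_def)
    qed (use True assms in auto)
  next
    case False
    then have "\<epsilon> = 2" using assms by simp
    then show ?thesis using SL2_normal_growth[OF False] by simp
  qed
  moreover obtain G :: "(nat \<Rightarrow> nat) monoid" and T where "pro_p_group p G T"
    "\<And>k. finite (subgroups_of_index G (p ^ k))"
    "\<And>n. subgroup_count G n = card (subgroups_of_index J n)"
    "\<And>n. normal_subgroup_count G n = card (normal_subgroups_of_index J n)"
    by (rule pro_p_copy) blast
  ultimately show ?thesis using subgroup_growth by (intro exI[of _ G] exI[of _ T]) simp
qed

end
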